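(* Let $R=k[x_1,\ldots,x_d]$ be a polynomial ring over a field $k$ with $d\geq 2$, and let $I$ be a zero dimensional monomial ideal of $R$. For each $i$ let $I_i$ be the ideal obtained from $I$ by making $x_i=0$, and let $e(I_i)$ be its multiplicity. If $c_dx^d+c_{d-1}x^{d-1}+\cdots+c_1x+c_0$ is the Hilbert polynomial of the filtration $\mathcal{F}=\{\overline{I^n}\}_{n=0}^\infty$, then $$2c_{d-1}\geq\sum_{i=1}^{d-1}\frac{e(I_i)}{(d-1)!}.$$
   Context: Zero dimensional means $\dim(R/I)=0$. $\overline{J}$ denotes the integral closure of an ideal $J$ in $R$. The Hilbert polynomial of $\mathcal{F}$ is the polynomial with rational coefficients that agrees with $\ell_R(R/\overline{I^n})$ for $n\gg 0$; it has degree $d$. The ideal $I_i$ is the image of $I$ in the polynomial ring $R_i=k[x_j\mid j\neq i]$ in $d-1$ variables under the substitution $x_i\mapsto 0$; it is a zero dimensional monomial ideal of $R_i$, and its multiplicity $e(I_i)$ is $(d-1)!$ times the leading coefficient (in degree $d-1$) of the polynomial agreeing with $\ell_{R_i}(R_i/I_i^n)$ for $n\gg 0$ (equivalently, of the one for $\ell_{R_i}(R_i/\overline{I_i^n})$). *)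

theory Defs
  imports
    "HOL-Computational_Algebra.Polynomial"
    "HOL-Library.Poly_Mapping"
    "HOL-Library.Extended_Nat"
    "HOL-Library.Extended_Real"
    "HOL-Algebra.Module"
    "HOL-Algebra.QuotRing"
    "HOL-Algebra.Ideal_Product"
begin

section \<open>Krull dimension and length\<close>

text \<open>The zero ring has no prime ideals, so its dimension is \<open>-\<infinity>\<close>.\<close>

definition krull_dim :: "('a, 'm) ring_scheme \<Rightarrow> ereal" where
  "krull_dim R =
     (SUP n \<in> {n::nat. \<exists>P. (\<forall>i\<le>n. primeideal (P i) R) \<and> (\<forall>i<n. P i \<subset> P (Suc i))}.
        ereal (real n))"

definition module_length :: "('a, 'm) ring_scheme \<Rightarrow> ('a, 'b, 'n) module_scheme \<Rightarrow> enat" where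
  "module_length R M =
     (SUP n \<in> {n::nat. \<exists>N. (\<forall>i\<le>n. submodule (N i) R M) \<and> (\<forall>i<n. N i \<subset> N (Suc i))}. enat n)"

text \<open>\<open>R/J\<close> as an \<open>R\<close>-module, with \<open>R\<close> acting through \<open>R \<rightarrow> R/J\<close>.  The library's module records
  extend ring records, hence the multiplicative fields; no module notion uses them.\<close>

definition quotient_module :: "('a, 'm) ring_scheme \<Rightarrow> 'a set \<Rightarrow> ('a, 'a set) module" where
  "quotient_module R J =
     \<lparr>carrier = carrier (R Quot J), mult = mult (R Quot J), one = one (R Quot J),
      zero = zero (R Quot J), add = add (R Quot J),
      smult = (\<lambda>r X. (J +>\<^bsub>R\<^esub> r) \<otimes>\<^bsub>R Quot J\<^esub> X)\<rparr>"


section \<open>Powers and integral closure of ideals\<close>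

text \<open>In particular \<open>I\<^sup>0 = R\<close>.\<close>

definition ideal_pow :: "('a, 'm) ring_scheme \<Rightarrow> 'a set \<Rightarrow> nat \<Rightarrow> 'a set" where
  "ideal_pow R I n = I [^]\<^bsub>ideals_set R\<^esub> n"

text \<open>The equation of integral dependence is
  \<open>r\<^sup>n + a\<^sub>1 r\<^bsup>n-1\<^esup> + \<dots> + a\<^sub>n = 0\<close> with \<open>a\<^sub>i \<in> J\<^sup>i\<close>.\<close>

definition integral_closure :: "('a, 'm) ring_scheme \<Rightarrow> 'a set \<Rightarrow> 'a set" where
  "integral_closure R J =
     {r \<in> carrier R. \<exists>(n::nat) a. n > 0 \<and> (\<forall>i\<in>{1..n}. a i \<in> ideal_pow R J i) \<and>
        r [^]\<^bsub>R\<^esub> n \<oplus>\<^bsub>R\<^esub> (\<Oplus>\<^bsub>R\<^esub>i\<in>{1..n}. a i \<otimes>\<^bsub>R\<^esub> r [^]\<^bsub>R\<^esub> (n - i)) = \<zero>\<^bsub>R\<^esub>}"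


section \<open>Hilbert polynomials and multiplicity\<close>

definition is_hilbert_poly :: "('a, 'm) ring_scheme \<Rightarrow> (nat \<Rightarrow> 'a set) \<Rightarrow> rat poly \<Rightarrow> bool" where
  "is_hilbert_poly R F p \<longleftrightarrow>
     (\<forall>\<^sub>F n in sequentially. \<exists>l::nat.
        module_length R (quotient_module R (F n)) = enat l \<and> poly p (of_nat n) = of_nat l)"

text \<open>\<open>n\<close> stands for the dimension of \<open>R\<close>, and \<open>J\<close> for a zero dimensional ideal.\<close>

definition ideal_multiplicity :: "('a, 'm) ring_scheme \<Rightarrow> nat \<Rightarrow> 'a set \<Rightarrow> rat" where
  "ideal_multiplicity R n J =
     fact n * poly.coeff (THE p. is_hilbert_poly R (ideal_pow R J) p) n"

lemma is_hilbert_poly_unique: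
  assumes "is_hilbert_poly R F p" "is_hilbert_poly R F q"
  shows "p = q"
proof -
  have "\<forall>\<^sub>F n in sequentially. poly (p - q) (of_nat n) = 0"
    using assms unfolding is_hilbert_poly_def
    by eventually_elim auto
  then obtain N where N: "\<And>n. n \<ge> N \<Longrightarrow> poly (p - q) (of_nat n) = 0"
    by (auto simp: eventually_sequentially)
  have "infinite (range (\<lambda>n. of_nat (N + n) :: rat))"
    by (rule range_inj_infinite) (simp add: inj_def)
  moreover have "range (\<lambda>n. of_nat (N + n)) \<subseteq> {x. poly (p - q) x = 0}"
    using N le_add1 by blast
  ultimately have "infinite {x. poly (p - q) x = 0}"
    using finite_subset by blast
  then have "p - q = 0"
    using poly_roots_finite by blast
  then show ?thesis by simp
qed


section \<open>Polynomial rings in finitely many variables\<close>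

type_synonym 'k mpoly = "(nat \<Rightarrow>\<^sub>0 nat) \<Rightarrow>\<^sub>0 'k"

text \<open>\<open>k[x\<^sub>j | j \<in> V]\<close>, inside the ring of polynomials in the variables \<open>x\<^sub>0, x\<^sub>1, \<dots>\<close>; a polynomial
  maps exponent vectors to coefficients.\<close>

definition mpoly_ring :: "nat set \<Rightarrow> 'k::field mpoly ring" where
  "mpoly_ring V =
     \<lparr>carrier = {p. \<forall>m \<in> Poly_Mapping.keys p. Poly_Mapping.keys m \<subseteq> V},
      mult = (*), one = 1, zero = 0, add = (+)\<rparr>"

definition mpoly_monom :: "(nat \<Rightarrow>\<^sub>0 nat) \<Rightarrow> 'k::field mpoly" where
  "mpoly_monom m = Poly_Mapping.single m 1"

definition mpoly_const :: "'k \<Rightarrow> 'k::field mpoly" where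
  "mpoly_const c = Poly_Mapping.single 0 c"

definition mpoly_var :: "nat \<Rightarrow> 'k::field mpoly" where
  "mpoly_var j = mpoly_monom (Poly_Mapping.single j 1)"

definition mpoly_subst :: "(nat \<Rightarrow> 'k mpoly) \<Rightarrow> 'k mpoly \<Rightarrow> 'k::field mpoly" where
  "mpoly_subst \<sigma> p =
     (\<Sum>m \<in> Poly_Mapping.keys p.
        mpoly_const (Poly_Mapping.lookup p m) *
        (\<Prod>j \<in> Poly_Mapping.keys m. \<sigma> j ^ Poly_Mapping.lookup m j))"

definition set_var_zero :: "nat \<Rightarrow> 'k mpoly \<Rightarrow> 'k::field mpoly" where
  "set_var_zero i = mpoly_subst (mpoly_var(i := 0))"

definition monomial_ideal :: "nat set \<Rightarrow> 'k::field mpoly set \<Rightarrow> bool" where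
  "monomial_ideal V I \<longleftrightarrow>
     (\<exists>A. (\<forall>m\<in>A. Poly_Mapping.keys m \<subseteq> V) \<and> I = Idl\<^bsub>mpoly_ring V\<^esub> (mpoly_monom ` A))"

lemma cring_mpoly_ring: "cring (mpoly_ring V)"
proof (rule cringI)
  have neg: "- p \<in> carrier (mpoly_ring V)" if "p \<in> carrier (mpoly_ring V)" for p :: "'a mpoly"
    using that by (simp add: mpoly_ring_def in_keys_iff)
  show "abelian_group (mpoly_ring V :: 'a mpoly ring)"
  proof (rule abelian_groupI)
    fix p q :: "'a mpoly"
    assume "p \<in> carrier (mpoly_ring V)" "q \<in> carrier (mpoly_ring V)"
    then show "p \<oplus>\<^bsub>mpoly_ring V\<^esub> q \<in> carrier (mpoly_ring V)"
      using Poly_Mapping.keys_add[of p q] by (fastforce simp: mpoly_ring_def)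
  next
    fix p :: "'a mpoly" assume "p \<in> carrier (mpoly_ring V)"
    then show "\<exists>q\<in>carrier (mpoly_ring V). q \<oplus>\<^bsub>mpoly_ring V\<^esub> p = \<zero>\<^bsub>mpoly_ring V\<^esub>"
      using neg[of p] by (intro bexI[of _ "- p"]) (auto simp: mpoly_ring_def)
  qed (auto simp: mpoly_ring_def algebra_simps)
  show "Group.comm_monoid (mpoly_ring V :: 'a mpoly ring)"
  proof (rule comm_monoidI)
    fix p q :: "'a mpoly"
    assume pq: "p \<in> carrier (mpoly_ring V)" "q \<in> carrier (mpoly_ring V)"
    have "Poly_Mapping.keys m \<subseteq> V" if "m \<in> Poly_Mapping.keys (p * q)" for m
    proof -
      obtain a b where "a \<in> Poly_Mapping.keys p" "b \<in> Poly_Mapping.keys q" "m = a + b"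
        using \<open>m \<in> Poly_Mapping.keys (p * q)\<close> Poly_Mapping.keys_mult[of p q] by blast
      then show ?thesis
        using pq Poly_Mapping.keys_add[of a b] unfolding mpoly_ring_def by (simp, blast)
    qed
    then show "p \<otimes>\<^bsub>mpoly_ring V\<^esub> q \<in> carrier (mpoly_ring V)"
      by (simp add: mpoly_ring_def)
  qed (auto simp: mpoly_ring_def algebra_simps)
qed (auto simp: mpoly_ring_def algebra_simps)

end

theory Submission
  imports Defs "Jordan_Normal_Form.Determinant" "HOL-Library.Multiset" Complex_Main
begin

text \<open>
  Everything is translated into exponent vectors. If \<open>U\<close> is the set of exponents of monomials in
  \<open>I\<close>, the exponents of \<open>I\<^sup>n\<close> form the \<open>n\<close>-fold sumset \<open>E\<^sub>n\<close> of \<open>U\<close>, and those of the integral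
  closure of \<open>I\<^sup>n\<close> form \<open>G\<^sub>n = {m. \<exists>k\<ge>1. k m \<in> E\<^bsub>kn\<^esub>}\<close>, the lattice points of \<open>n\<close> times the Newton
  polyhedron (\<open>integral_closure_mspan\<close>). Lengths are numbers of missing exponents
  (\<open>length_mspan\<close>), so that for large \<open>n\<close> the value \<open>p(n)\<close> counts the lattice points of the orthant outside \<open>G\<^sub>n\<close>.

  Write a lattice point as \<open>(y, t)\<close> with \<open>t\<close> the exponent of \<open>x\<^sub>d\<close>, and let \<open>\<phi>\<^sub>n(y)\<close> be the real height
  at which the Newton polyhedron, scaled by \<open>n\<close>, begins above \<open>y\<close>. This is a convex function of
  \<open>y\<close> with \<open>\<phi>\<^bsub>2n\<^esub>(2y) = 2\<phi>\<^sub>n(y)\<close>, and the column above \<open>y\<close> contains between \<open>\<phi>\<^sub>n(y)\<close> and \<open>\<phi>\<^sub>n(y) + 1\<close>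
  missing points. Hence \<open>p(n) \<ge> \<Sum>\<^sub>y \<phi>\<^sub>n(y)\<close>. Give \<open>y\<close> the trapezoidal weight \<open>2\<^sup>-\<^sup>z\<close>, where \<open>z\<close> is the number of
  zero coordinates of \<open>y\<close>, and let \<open>A(n)\<close> be the weighted sum. The trapezoidal rule overestimates the
  integral of a convex function, which in discrete form says \<open>A(2n) \<le> 2\<^sup>d A(n)\<close>
  (\<open>corner_sum_double\<close>); iterating along \<open>2\<^sup>k n\<close> gives \<open>A(n) \<ge> c\<^sub>d n\<^sup>d\<close>. The remaining weight
  \<open>1 - 2\<^sup>-\<^sup>z\<close> is one half on each of the \<open>d - 1\<close> coordinate hyperplanes \<open>y\<^sub>i = 0\<close>, up to points with two
  zero coordinates, and on that hyperplane the sum of \<open>\<phi>\<^sub>n\<close> is the length belonging to the integral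
  closure of \<open>I\<^sub>i\<^sup>n\<close> up to \<open>O(n\<^sup>d\<^sup>-\<^sup>2)\<close>. So
  \<open>p(n) \<ge> c\<^sub>d n\<^sup>d + (1/2) \<Sum>\<^sub>i e(I\<^sub>i)/(d-1)! n\<^sup>d\<^sup>-\<^sup>1 - O(n\<^sup>d\<^sup>-\<^sup>2)\<close> (\<open>second_coeff_ge\<close>). There is
  no term for the last variable, because rounding the heights up to integers is only known to
  contribute a nonnegative amount.

  Three facts support this. The integral closure of a monomial ideal is the monomial ideal of the
  saturated exponents: one inclusion is the determinant trick, the other picks an extreme exponent.
  Dimension zero puts a power of each variable into \<open>I\<close> (\<open>krull_dim_zero_pure_powers\<close>). Finally,
  \<open>e(I\<^sub>i)\<close> is defined through ordinary powers, so their lengths must be shown to be eventually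
  polynomial (\<open>hilbert_function_expo_pow\<close>) and to differ from those of the closures only by a bounded
  shift of \<open>n\<close> (\<open>sat_expo_shift_sub\<close>).
\<close>

section \<open>Monomial ideals as sets of exponents\<close>

abbreviation lookup :: "('a \<Rightarrow>\<^sub>0 'b::zero) \<Rightarrow> 'a \<Rightarrow> 'b" where
  "lookup \<equiv> Poly_Mapping.lookup"

abbreviation keys :: "('a \<Rightarrow>\<^sub>0 'b::zero) \<Rightarrow> 'a set" where
  "keys \<equiv> Poly_Mapping.keys"

abbreviation single :: "'a \<Rightarrow> 'b \<Rightarrow> ('a \<Rightarrow>\<^sub>0 'b::zero)" where
  "single \<equiv> Poly_Mapping.single"

abbreviation expo :: "nat set \<Rightarrow> (nat \<Rightarrow>\<^sub>0 nat) set" where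
  "expo V \<equiv> {m. keys m \<subseteq> V}"

text \<open>For an upward closed set \<open>U\<close> this is the monomial ideal with exponent set \<open>U\<close>. For other
  sets it serves to track which exponents can occur in a polynomial.\<close>
definition mspan :: "(nat \<Rightarrow>\<^sub>0 nat) set \<Rightarrow> 'k::field mpoly set" where
  "mspan U = {p. keys p \<subseteq> U}"

definition up_closed :: "nat set \<Rightarrow> (nat \<Rightarrow>\<^sub>0 nat) set \<Rightarrow> bool" where
  "up_closed V U \<longleftrightarrow> U \<subseteq> expo V \<and> (\<forall>m\<in>U. \<forall>u\<in>expo V. m + u \<in> U)"

text \<open>The exponents of the powers of a monomial ideal; the zeroth power is the whole ring.\<close>
fun expo_pow :: "nat set \<Rightarrow> (nat \<Rightarrow>\<^sub>0 nat) set \<Rightarrow> nat \<Rightarrow> (nat \<Rightarrow>\<^sub>0 nat) set" where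
  "expo_pow V U 0 = expo V"
| "expo_pow V U (Suc n) = {a + b | a b. a \<in> expo_pow V U n \<and> b \<in> U}"

lemma keys_add_nat: "keys (a + b) = keys a \<union> keys (b :: nat \<Rightarrow>\<^sub>0 nat)"
  by (auto simp: in_keys_iff lookup_add)

lemma up_closedD: "up_closed V U \<Longrightarrow> m \<in> U \<Longrightarrow> keys u \<subseteq> V \<Longrightarrow> m + u \<in> U"
  by (auto simp: up_closed_def)

lemma up_closed_sub: "up_closed V U \<Longrightarrow> m \<in> U \<Longrightarrow> keys m \<subseteq> V"
  by (auto simp: up_closed_def)

lemma up_closed_le:
  assumes "up_closed V U" "m \<in> U" "keys m' \<subseteq> V" "\<And>j. lookup m j \<le> lookup m' j"
  shows "m' \<in> U"
proof -
  have "m' = m + (m' - m)"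
    by (rule poly_mapping_eqI) (use assms(4) in \<open>simp add: lookup_add lookup_minus\<close>)
  moreover have "keys (m' - m) \<subseteq> V"
    using assms(3) by (auto simp: in_keys_iff lookup_minus)
  ultimately show ?thesis using up_closedD[OF assms(1,2)] by metis
qed

lemma up_closed_expo: "up_closed V (expo V)"
  by (auto simp: up_closed_def keys_add_nat)

lemma up_closed_expo_pow:
  assumes "up_closed V U" shows "up_closed V (expo_pow V U n)"
proof (induction n)
  case 0 then show ?case by (simp add: up_closed_expo)
next
  case (Suc n)
  show ?case
    unfolding up_closed_def
  proof (intro conjI ballI)
    show "expo_pow V U (Suc n) \<subseteq> expo V"
      using up_closed_sub[OF Suc] up_closed_sub[OF assms] unfolding expo_pow.simps
      by (clarsimp simp: keys_add_nat) blast
  next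
    fix m u assume "m \<in> expo_pow V U (Suc n)" and u: "u \<in> expo V"
    then obtain a b where "m = a + b" "a \<in> expo_pow V U n" "b \<in> U" by auto
    moreover from this u have "b + u \<in> U" using up_closedD[OF assms] by blast
    ultimately show "m + u \<in> expo_pow V U (Suc n)"
      by (auto simp: add.assoc)
  qed
qed

lemma expo_pow_one: "up_closed V U \<Longrightarrow> expo_pow V U 1 = U"
proof (intro equalityI subsetI)
  fix m assume "up_closed V U" "m \<in> expo_pow V U 1"
  then obtain a b where "m = b + a" "b \<in> U" "a \<in> expo V" by (auto simp: add.commute)
  with \<open>up_closed V U\<close> show "m \<in> U" using up_closedD[of V U] by blast
next
  fix m assume "m \<in> U"
  then have "m = 0 + m" "0 \<in> expo V" by auto
  then show "m \<in> expo_pow V U 1" using \<open>m \<in> U\<close> unfolding One_nat_def expo_pow.simps by blast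
qed

lemma expo_pow_add:
  assumes U: "up_closed V U"
  shows "a \<in> expo_pow V U m \<Longrightarrow> b \<in> expo_pow V U n \<Longrightarrow> a + b \<in> expo_pow V U (m + n)"
proof (induction n arbitrary: b)
  case 0
  then show ?case using up_closedD[OF up_closed_expo_pow[OF U]] by auto
next
  case (Suc n)
  then obtain c e where "b = c + e" "c \<in> expo_pow V U n" "e \<in> U" by auto
  with Suc.IH[of c] Suc.prems(1) have "a + b = (a + c) + e" "a + c \<in> expo_pow V U (m + n)"
    by (simp_all add: add.assoc)
  with \<open>e \<in> U\<close> show ?case by auto
qed

lemma expo_pow_split:
  assumes U: "up_closed V U"
  shows "x \<in> expo_pow V U (m + n) \<Longrightarrow> \<exists>a b. x = a + b \<and> a \<in> expo_pow V U m \<and> b \<in> expo_pow V U n"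
proof (induction n arbitrary: x)
  case 0
  then show ?case by (intro exI[of _ x] exI[of _ 0]) auto
next
  case (Suc n)
  then obtain c e where ce: "x = c + e" "c \<in> expo_pow V U (m + n)" "e \<in> U" by auto
  from Suc.IH[OF ce(2)] obtain a b where "c = a + b" "a \<in> expo_pow V U m" "b \<in> expo_pow V U n" by auto
  then show ?case using ce
    by (intro exI[of _ a] exI[of _ "b + e"]) (auto simp: add.assoc)
qed

lemma expo_pow_antimono:
  assumes U: "up_closed V U" and "m \<le> n"
  shows "expo_pow V U n \<subseteq> expo_pow V U m"
proof
  fix x assume "x \<in> expo_pow V U n"
  then have "x \<in> expo_pow V U (m + (n - m))" using assms by simp
  from expo_pow_split[OF U this] obtain a b where "x = a + b" "a \<in> expo_pow V U m"
    "b \<in> expo_pow V U (n - m)" by auto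
  then show "x \<in> expo_pow V U m"
    using up_closedD[OF up_closed_expo_pow[OF U]] up_closed_sub[OF up_closed_expo_pow[OF U]] by blast
qed

text \<open>Powers of \<open>I\<^sup>n\<close> are powers of \<open>I\<close>, so that saturating the exponents of \<open>I\<^sup>n\<close> only refers to \<open>U\<close>.\<close>
lemma expo_pow_mult:
  assumes U: "up_closed V U"
  shows "expo_pow V (expo_pow V U n) k = expo_pow V U (n * k)"
proof (induction k)
  case (Suc k)
  show ?case
  proof (intro equalityI subsetI)
    fix x assume "x \<in> expo_pow V (expo_pow V U n) (Suc k)"
    then obtain a b where "x = a + b" "a \<in> expo_pow V U (n * k)" "b \<in> expo_pow V U n"
      using Suc by auto
    then show "x \<in> expo_pow V U (n * Suc k)"
      using expo_pow_add[OF U, of a "n * k" b n] by (simp add: add.commute)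
  next
    fix x assume "x \<in> expo_pow V U (n * Suc k)"
    then have "x \<in> expo_pow V U (n * k + n)" by (simp add: add.commute)
    from expo_pow_split[OF U this] Suc show "x \<in> expo_pow V (expo_pow V U n) (Suc k)" by auto
  qed
qed simp

text \<open>Exponent vectors form a semiring under convolution in which \<open>of_nat k\<close> is the scalar \<open>k\<close> at
  index \<open>0\<close>. Thus \<open>of_nat k * m\<close> is the \<open>k\<close>-fold multiple of \<open>m\<close>, and the ring laws apply to it.\<close>
lemma lookup_of_nat_mult: "lookup (of_nat k * (m :: nat \<Rightarrow>\<^sub>0 nat)) j = k * lookup m j"
  by (induction k) (auto simp: algebra_simps lookup_add)

lemma keys_of_nat_mult: "keys (of_nat k * (m :: nat \<Rightarrow>\<^sub>0 nat)) \<subseteq> keys m"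
  by (auto simp: in_keys_iff lookup_of_nat_mult)

lemma expo_pow_scale:
  assumes U: "up_closed V U"
  shows "m \<in> expo_pow V U n \<Longrightarrow> of_nat k * m \<in> expo_pow V U (k * n)"
proof (induction k)
  case (Suc k)
  then have "of_nat k * m + m \<in> expo_pow V U (k * n + n)" using expo_pow_add[OF U] by blast
  then show ?case by (simp add: algebra_simps)
qed simp

lemma mpoly_ring_simps [simp]:
  "carrier (mpoly_ring V) = mspan (expo V)"
  "p \<otimes>\<^bsub>mpoly_ring V\<^esub> q = p * q" "\<one>\<^bsub>mpoly_ring V\<^esub> = 1"
  "\<zero>\<^bsub>mpoly_ring V\<^esub> = 0" "p \<oplus>\<^bsub>mpoly_ring V\<^esub> q = p + q"
  by (auto simp: mpoly_ring_def mspan_def)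

lemma mspan_add: "p \<in> mspan U \<Longrightarrow> q \<in> mspan U \<Longrightarrow> p + q \<in> mspan U"
  using Poly_Mapping.keys_add[of p q] by (auto simp: mspan_def)

lemma mspan_uminus: "p \<in> mspan U \<Longrightarrow> - p \<in> mspan U"
  by (auto simp: mspan_def in_keys_iff)

lemma mspan_zero [simp]: "0 \<in> mspan U"
  by (auto simp: mspan_def)

lemma mspan_sum: "(\<And>i. i \<in> A \<Longrightarrow> f i \<in> mspan U) \<Longrightarrow> sum f A \<in> mspan U"
  by (induction A rule: infinite_finite_induct) (auto intro: mspan_add)

lemma mspan_mono: "U \<subseteq> U' \<Longrightarrow> mspan U \<subseteq> mspan U'"
  by (auto simp: mspan_def)

lemma mspan_mult:
  assumes "p \<in> mspan A" "q \<in> mspan B" "\<And>a b. a \<in> A \<Longrightarrow> b \<in> B \<Longrightarrow> a + b \<in> C"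
  shows "p * q \<in> mspan C"
  using assms Poly_Mapping.keys_mult[of p q] unfolding mspan_def by blast

lemma sum_single_lookup: "(\<Sum>m\<in>keys p. single m (lookup p m)) = p"
proof (rule poly_mapping_eqI)
  fix j
  have "lookup (\<Sum>m\<in>keys p. single m (lookup p m)) j
      = (\<Sum>m\<in>keys p. if m = j then lookup p m else 0)"
    by (simp add: lookup_sum lookup_single when_def)
  also have "\<dots> = lookup p j" by (simp add: in_keys_iff)
  finally show "lookup (\<Sum>m\<in>keys p. single m (lookup p m)) j = lookup p j" .
qed

lemma single_in_mspan: "m \<in> U \<Longrightarrow> single m c \<in> mspan U"
  by (auto simp: mspan_def)

lemma single_in_mspan_iff: "c \<noteq> 0 \<Longrightarrow> single m c \<in> mspan U \<longleftrightarrow> m \<in> U"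
  by (auto simp: mspan_def)

lemma a_inv_mpoly_ring:
  assumes "p \<in> mspan (expo V)" shows "\<ominus>\<^bsub>mpoly_ring V\<^esub> p = - p"
proof -
  interpret cring "mpoly_ring V" by (rule cring_mpoly_ring)
  show ?thesis
    by (rule minus_equality) (use assms in \<open>auto intro: mspan_uminus\<close>)
qed

lemma nat_pow_mpoly_ring: "p [^]\<^bsub>mpoly_ring V\<^esub> (n::nat) = p ^ n"
  by (induction n) (simp_all add: nat_pow_def mpoly_ring_def mult.commute)

lemma mspan_mult_carrier: "p \<in> mspan (expo V) \<Longrightarrow> q \<in> mspan (expo V) \<Longrightarrow> p * q \<in> mspan (expo V)"
  by (erule (1) mspan_mult) (auto simp: keys_add_nat)

lemma mspan_one: "1 \<in> mspan (expo V)"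
  by (auto simp: mspan_def)

lemma mspan_power: "p \<in> mspan (expo V) \<Longrightarrow> p ^ n \<in> mspan (expo V)"
  by (induction n) (auto intro: mspan_mult_carrier mspan_one)

lemma finsum_mpoly_ring:
  "finite A \<Longrightarrow> (\<And>i. i \<in> A \<Longrightarrow> f i \<in> mspan (expo V)) \<Longrightarrow> finsum (mpoly_ring V) f A = sum f A"
proof (induction A rule: finite_induct)
  interpret cring "mpoly_ring V" by (rule cring_mpoly_ring)
  case empty then show ?case by simp
next
  interpret cring "mpoly_ring V" by (rule cring_mpoly_ring)
  case (insert x F)
  then have "finsum (mpoly_ring V) f (insert x F) = f x \<oplus>\<^bsub>mpoly_ring V\<^esub> finsum (mpoly_ring V) f F"
    by (intro finsum_insert) auto
  then show ?case using insert by simp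
qed

lemma ideal_mspan:
  assumes U: "up_closed V U"
  shows "ideal (mspan U) (mpoly_ring V)"
proof (rule idealI)
  interpret cring "mpoly_ring V :: 'a mpoly ring" by (rule cring_mpoly_ring)
  show "ring (mpoly_ring V :: 'a mpoly ring)" by (rule ring_axioms)
  have sub: "mspan U \<subseteq> (mspan (expo V) :: 'a mpoly set)"
    using up_closed_sub[OF U] by (intro mspan_mono) auto
  show "subgroup (mspan U) (add_monoid (mpoly_ring V :: 'a mpoly ring))"
  proof (rule add.subgroupI)
    show "mspan U \<subseteq> carrier (mpoly_ring V :: 'a mpoly ring)" using sub by simp
    show "mspan U \<noteq> ({} :: 'a mpoly set)" using mspan_zero by blast
    fix a b :: "'a mpoly" assume a: "a \<in> mspan U"
    then have "\<ominus>\<^bsub>mpoly_ring V\<^esub> a = - a" using sub by (intro a_inv_mpoly_ring) auto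
    with a show "\<ominus>\<^bsub>mpoly_ring V\<^esub> a \<in> mspan U" using mspan_uminus[of a U] by simp
    assume "b \<in> mspan U"
    with a show "a \<oplus>\<^bsub>mpoly_ring V\<^esub> b \<in> mspan U" by (simp add: mspan_add)
  qed
  fix a x :: "'a mpoly" assume ax: "a \<in> mspan U" "x \<in> carrier (mpoly_ring V)"
  then show "a \<otimes>\<^bsub>mpoly_ring V\<^esub> x \<in> mspan U"
    using mspan_mult[of a U x "expo V" U] up_closedD[OF U] by auto
  then show "x \<otimes>\<^bsub>mpoly_ring V\<^esub> a \<in> mspan U" by (simp add: mult.commute)
qed

lemma monomial_ideal_mspan:
  assumes "monomial_ideal V I"
  shows "\<exists>U. up_closed V U \<and> I = mspan U"
proof -
  interpret cring "mpoly_ring V :: 'a mpoly ring" by (rule cring_mpoly_ring)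
  obtain A where A: "\<And>m. m \<in> A \<Longrightarrow> keys m \<subseteq> V"
    and I: "I = Idl\<^bsub>mpoly_ring V\<^esub> (mpoly_monom ` A)"
    using assms unfolding monomial_ideal_def by blast
  define U where "U = {a + u | a u. a \<in> A \<and> u \<in> expo V}"
  have U: "up_closed V U" unfolding up_closed_def U_def
    using A by (fastforce simp: keys_add_nat add.assoc)
  have AU: "A \<subseteq> U" unfolding U_def using A by force
  have AV: "mpoly_monom ` A \<subseteq> carrier (mpoly_ring V :: 'a mpoly ring)"
    using A by (auto simp: mpoly_monom_def intro!: single_in_mspan)
  have "I = mspan U"
  proof
    show "I \<subseteq> mspan U"
      unfolding I by (rule genideal_minimal[OF ideal_mspan[OF U]])
        (use AU in \<open>auto simp: mpoly_monom_def intro!: single_in_mspan\<close>)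
    have idI: "ideal I (mpoly_ring V)" unfolding I using AV by (rule genideal_ideal)
    then interpret I: ideal I "mpoly_ring V" .
    have AI: "mpoly_monom a \<in> I" if "a \<in> A" for a
      using genideal_self[OF AV] that I by auto
    have mI: "single m c \<in> I" if m: "m \<in> U" for m c
    proof -
      obtain a u where au: "m = a + u" "a \<in> A" "u \<in> expo V" using m unfolding U_def by auto
      have "mpoly_monom a \<otimes>\<^bsub>mpoly_ring V\<^esub> single u c \<in> I"
        using au by (intro I.I_r_closed AI) (auto intro!: single_in_mspan)
      then show ?thesis by (simp add: mpoly_monom_def mult_single au)
    qed
    have sI: "sum f S \<in> I" if "\<And>i. i \<in> S \<Longrightarrow> f i \<in> I" for f and S :: "(nat \<Rightarrow>\<^sub>0 nat) set"
      using that
    proof (induction S rule: infinite_finite_induct)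
      case (insert x F)
      then show ?case using I.a_closed[of "f x" "sum f F"] by simp
    qed (use I.zero_closed in auto)
    show "mspan U \<subseteq> I"
    proof
      fix p :: "'a mpoly" assume "p \<in> mspan U"
      then have "(\<Sum>m\<in>keys p. single m (lookup p m)) \<in> I"
        by (intro sI mI) (auto simp: mspan_def)
      then show "p \<in> I" by (simp add: sum_single_lookup)
    qed
  qed
  with U show ?thesis by blast
qed

text \<open>A single term of a sum of exponents is a product of two terms, and general elements are sums
  of such terms.\<close>
lemma ideal_prod_mspan:
  assumes "up_closed V A" "up_closed V B"
  shows "ideal_prod (mpoly_ring V) (mspan A) (mspan B) = (mspan {a + b | a b. a \<in> A \<and> b \<in> B} :: 'k::field mpoly set)"
    (is "?L = mspan ?C")
proof (intro equalityI subsetI)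
  fix p :: "'k mpoly" assume "p \<in> ?L"
  then show "p \<in> mspan ?C"
  proof (induction rule: ideal_prod.induct)
    case (prod i j)
    then show ?case using mspan_mult[of i A j B ?C] by auto
  next
    case (sum s1 s2) then show ?case using mspan_add by auto
  qed
next
  fix p :: "'k mpoly" assume p: "p \<in> mspan ?C"
  have sing: "single m c \<in> ?L" if m: "m \<in> ?C" for m c
  proof -
    obtain a b where ab: "m = a + b" "a \<in> A" "b \<in> B" using m by auto
    have "single a c \<otimes>\<^bsub>mpoly_ring V\<^esub> single b 1 \<in> ?L"
      by (rule ideal_prod.prod) (use ab in \<open>auto intro: single_in_mspan\<close>)
    then show ?thesis by (simp add: ab mult_single)
  qed
  have L: "ideal ?L (mpoly_ring V)"
    by (intro ring.ideal_prod_is_ideal ideal_mspan assms cring.axioms(1)[OF cring_mpoly_ring])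
  then interpret L: ideal ?L "mpoly_ring V" .
  have sI: "sum f S \<in> ?L" if "\<And>i. i \<in> S \<Longrightarrow> f i \<in> ?L" for f and S :: "(nat \<Rightarrow>\<^sub>0 nat) set"
    using that
  proof (induction S rule: infinite_finite_induct)
    case (insert x F)
    then show ?case using additive_subgroup.a_closed[OF ideal.axioms(1)[OF L], of "f x" "sum f F"] by simp
  qed (use additive_subgroup.zero_closed[OF ideal.axioms(1)[OF L]] in auto)
  have "(\<Sum>m\<in>keys p. single m (lookup p m)) \<in> ?L"
    by (intro sI sing) (use p in \<open>auto simp: mspan_def\<close>)
  then show "p \<in> ?L" by (simp add: sum_single_lookup)
qed

lemma ideal_pow_mspan:
  assumes U: "up_closed V U"
  shows "ideal_pow (mpoly_ring V) (mspan U) n = (mspan (expo_pow V U n) :: 'k::field mpoly set)"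
proof (induction n)
  case 0
  show ?case unfolding ideal_pow_def by (simp add: ideals_set_def)
next
  case (Suc n)
  have "ideal_pow (mpoly_ring V) (mspan U) (Suc n)
      = ideal_prod (mpoly_ring V) (ideal_pow (mpoly_ring V) (mspan U) n) (mspan U :: 'k mpoly set)"
    unfolding ideal_pow_def by (simp add: ideals_set_def)
  also have "\<dots> = mspan (expo_pow V U (Suc n))"
    unfolding Suc using ideal_prod_mspan[OF up_closed_expo_pow[OF U] U] by simp
  finally show ?case .
qed

text \<open>Substituting \<open>x\<^sub>i = 0\<close> deletes exactly the terms that involve \<open>x\<^sub>i\<close>.\<close>
lemma set_var_zero_lookup:
  "lookup (set_var_zero i p) m = (if lookup m i = 0 then lookup p m else 0)"
proof -
  have mon: "(\<Prod>j\<in>keys m. (mpoly_var(i := 0)) j ^ lookup m j)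
      = (if lookup m i = 0 then mpoly_monom m else 0 :: 'a mpoly)" for m
  proof (cases "lookup m i = 0")
    case True
    have p: "(mpoly_monom a :: 'a mpoly) ^ n = mpoly_monom (of_nat n * a)" for a n
      by (induction n) (auto simp: mpoly_monom_def mult_single algebra_simps)
    have "(\<Prod>j\<in>keys m. (mpoly_var(i := 0)) j ^ lookup m j)
        = (\<Prod>j\<in>keys m. mpoly_monom (single j (lookup m j)) :: 'a mpoly)"
    proof (rule prod.cong)
      fix j assume "j \<in> keys m"
      then have "j \<noteq> i" using True by (auto simp: in_keys_iff)
      moreover have "of_nat n * single j 1 = single j (n::nat)" for n
        by (rule poly_mapping_eqI) (simp add: lookup_of_nat_mult lookup_single when_def)
      ultimately show "(mpoly_var(i := 0)) j ^ lookup m j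
          = (mpoly_monom (single j (lookup m j)) :: 'a mpoly)"
        by (simp add: mpoly_var_def p)
    qed simp
    also have "\<dots> = mpoly_monom (\<Sum>j\<in>keys m. single j (lookup m j))"
    proof -
      have "(\<Prod>j\<in>S. mpoly_monom (f j)) = (mpoly_monom (\<Sum>j\<in>S. f j) :: 'a mpoly)"
        if "finite S" for S :: "nat set" and f
        using that by (induction S rule: finite_induct) (auto simp: mpoly_monom_def mult_single)
      then show ?thesis by simp
    qed
    also have "\<dots> = mpoly_monom m" by (simp add: sum_single_lookup)
    finally show ?thesis using True by simp
  next
    case False
    then have "i \<in> keys m" by (simp add: in_keys_iff)
    then have "(\<Prod>j\<in>keys m. (mpoly_var(i := 0)) j ^ lookup m j :: 'a mpoly) = 0"
      by (intro prod_zero) (use False in \<open>auto intro!: bexI[of _ i] simp: zero_power\<close>)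
    then show ?thesis using False by simp
  qed
  have "set_var_zero i p = (\<Sum>m\<in>keys p.
      if lookup m i = 0 then single m (lookup p m) else 0)"
    unfolding set_var_zero_def mpoly_subst_def mon
    by (intro sum.cong) (auto simp: mpoly_const_def mpoly_monom_def mult_single)
  then have "lookup (set_var_zero i p) m
      = (\<Sum>m'\<in>keys p. if m' = m then (if lookup m i = 0 then lookup p m else 0) else 0)"
    by (simp only: lookup_sum) (intro sum.cong, auto simp: lookup_single when_def)
  also have "\<dots> = (if lookup m i = 0 then lookup p m else 0)"
    by (simp add: in_keys_iff)
  finally show ?thesis .
qed

lemma set_var_zero_mspan:
  "set_var_zero i ` mspan U = mspan {m \<in> U. lookup m i = 0}"
proof (intro equalityI subsetI)
  fix p assume "p \<in> set_var_zero i ` mspan U"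
  then show "p \<in> mspan {m \<in> U. lookup m i = 0}"
    by (auto simp: mspan_def in_keys_iff set_var_zero_lookup split: if_splits)
next
  fix p assume p: "p \<in> mspan {m \<in> U. lookup m i = 0}"
  then have "set_var_zero i p = p"
    by (intro poly_mapping_eqI) (auto simp: set_var_zero_lookup mspan_def in_keys_iff)
  moreover have "p \<in> mspan U" using p by (auto simp: mspan_def)
  ultimately show "p \<in> set_var_zero i ` mspan U" by (metis imageI)
qed

lemma up_closed_face:
  "up_closed V U \<Longrightarrow> up_closed (V - {i}) {m \<in> U. lookup m i = 0}"
  unfolding up_closed_def by (auto simp: in_keys_iff lookup_add) (metis Diff_subset in_keys_iff subset_iff)

text \<open>A sum of nonnegative exponents is free of \<open>x\<^sub>i\<close> only if every summand is, so setting \<open>x\<^sub>i = 0\<close>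
  commutes with taking powers.\<close>
lemma expo_pow_face:
  assumes U: "up_closed V U"
  shows "expo_pow (V - {i}) {m \<in> U. lookup m i = 0} n = {m \<in> expo_pow V U n. lookup m i = 0}"
proof (induction n)
  case 0 then show ?case by (auto simp: in_keys_iff)
next
  case (Suc n)
  show ?case
  proof (intro equalityI subsetI)
    fix m assume "m \<in> expo_pow (V - {i}) {m \<in> U. lookup m i = 0} (Suc n)"
    then show "m \<in> {m \<in> expo_pow V U (Suc n). lookup m i = 0}"
      unfolding expo_pow.simps Suc by (clarsimp simp: lookup_add) blast
  next
    fix m assume "m \<in> {m \<in> expo_pow V U (Suc n). lookup m i = 0}"
    then obtain a b where ab: "m = a + b" "a \<in> expo_pow V U n" "b \<in> U"
      and "lookup m i = 0" by auto
    then have "lookup a i = 0" "lookup b i = 0" by (simp_all add: lookup_add)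
    with ab show "m \<in> expo_pow (V - {i}) {m \<in> U. lookup m i = 0} (Suc n)"
      unfolding expo_pow.simps Suc by blast
  qed
qed

section \<open>Length of a quotient by a monomial ideal\<close>

text \<open>Leading exponents with respect to the library's linear order on exponent vectors, which is
  compatible with addition.\<close>
definition lead_set :: "'k::field mpoly set \<Rightarrow> (nat \<Rightarrow>\<^sub>0 nat) set" where
  "lead_set S = {Max (keys p) | p. p \<in> S \<and> p \<noteq> 0}"

lemma keys_const_mult: "keys (mpoly_const c * p) \<subseteq> keys p"
  using Poly_Mapping.keys_mult[of "mpoly_const c" p] by (auto simp: mpoly_const_def split: if_splits)

lemma lookup_const_mult: "lookup (mpoly_const c * p) m = c * lookup p m"
proof -
  have "mpoly_const c * p = Poly_Mapping.map ((*) c) p"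
    unfolding mpoly_const_def by (rule mult_map_scale_conv_mult[symmetric])
  then show ?thesis by (simp add: Poly_Mapping.map.rep_eq when_def)
qed

text \<open>Gaussian elimination: an element of the larger space is reduced to zero by subtracting
  multiples of elements of the smaller one with the same leading exponent.  The induction is
  on the number of exponents of \<open>B\<close> that lie below some exponent of \<open>p\<close>.\<close>
lemma subspace_eq_if_lead_set_eq:
  fixes S S' :: "'k::field mpoly set"
  assumes fin: "finite B" and S: "S \<subseteq> S'" "S' \<subseteq> mspan B"
    and addS: "\<And>p q. p \<in> S \<Longrightarrow> q \<in> S \<Longrightarrow> p + q \<in> S"
    and scS: "\<And>c p. p \<in> S \<Longrightarrow> mpoly_const c * p \<in> S"
    and addS': "\<And>p q. p \<in> S' \<Longrightarrow> q \<in> S' \<Longrightarrow> p + q \<in> S'"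
    and scS': "\<And>c p. p \<in> S' \<Longrightarrow> mpoly_const c * p \<in> S'"
    and zero: "0 \<in> S" and lead: "lead_set S' \<subseteq> lead_set S"
  shows "S = S'"
proof -
  have "p \<in> S" if "p \<in> S'" for p
    using that
  proof (induction "card {b \<in> B. \<exists>k\<in>keys p. b \<le> k}" arbitrary: p rule: less_induct)
    case less
    show ?case
    proof (cases "p = 0")
      case True then show ?thesis using zero by simp
    next
      case False
      let ?m = "Max (keys p)"
      have "?m \<in> lead_set S" using lead less.prems False unfolding lead_set_def by blast
      then obtain q where q: "q \<in> S" "q \<noteq> 0" "Max (keys q) = ?m"
        unfolding lead_set_def by auto
      have mp: "?m \<in> keys p" using False by (intro Max_in) auto
      have mq: "?m \<in> keys q" unfolding q(3)[symmetric] using q(2) by (intro Max_in) auto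
      \<comment> \<open>cancel the leading term of \<open>p\<close>\<close>
      define c where "c = - (lookup p ?m / lookup q ?m)"
      define r where "r = p + mpoly_const c * q"
      have rS': "r \<in> S'" unfolding r_def using q S less.prems by (intro addS' scS') auto
      have rm: "lookup r ?m = 0"
        using mq by (simp add: r_def lookup_add lookup_const_mult c_def in_keys_iff)
      have le: "k < ?m" if "k \<in> keys r" for k
      proof -
        have "k \<in> keys p \<union> keys q"
          using that Poly_Mapping.keys_add[of p "mpoly_const c * q"] keys_const_mult[of c q]
          unfolding r_def by blast
        then have "k \<le> ?m" using Max_ge[OF finite_keys] q(3) by (metis UnE)
        moreover have "k \<noteq> ?m" using that rm by (auto simp: in_keys_iff)
        ultimately show ?thesis by simp
      qed
      have "?m \<in> B" using mp less.prems S by (auto simp: mspan_def)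
      then have "{b \<in> B. \<exists>k\<in>keys r. b \<le> k} \<subset> {b \<in> B. \<exists>k\<in>keys p. b \<le> k}"
      proof (intro psubsetI subsetI)
        fix b assume "b \<in> {b \<in> B. \<exists>k\<in>keys r. b \<le> k}"
        then obtain k where "b \<in> B" "k \<in> keys r" "b \<le> k" by auto
        moreover from this le[of k] have "b \<le> ?m" by simp
        ultimately show "b \<in> {b \<in> B. \<exists>k\<in>keys p. b \<le> k}" using mp by blast
      next
        have "?m \<notin> {b \<in> B. \<exists>k\<in>keys r. b \<le> k}" using le leD by blast
        moreover have "?m \<in> {b \<in> B. \<exists>k\<in>keys p. b \<le> k}" using mp \<open>?m \<in> B\<close> by blast
        ultimately show "{b \<in> B. \<exists>k\<in>keys r. b \<le> k} \<noteq> {b \<in> B. \<exists>k\<in>keys p. b \<le> k}"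
          by metis
      qed
      then have "card {b \<in> B. \<exists>k\<in>keys r. b \<le> k} < card {b \<in> B. \<exists>k\<in>keys p. b \<le> k}"
        by (intro psubset_card_mono) (use fin in auto)
      from less.hyps[OF this rS'] have "r \<in> S" .
      then have "r + mpoly_const (- c) * q \<in> S" using q by (intro addS scS)
      moreover have "r + mpoly_const (- c) * q = p"
        by (rule poly_mapping_eqI) (simp add: r_def lookup_add lookup_const_mult)
      ultimately show ?thesis by simp
    qed
  qed
  then show ?thesis using S by auto
qed

lemma zero_le_expo: "(0 :: nat \<Rightarrow>\<^sub>0 nat) \<le> u"
proof (cases "u = 0")
  case False
  let ?k = "Min (keys u)"
  have "?k \<in> keys u" using False by (intro Min_in) auto
  then have "0 < lookup u ?k" by (simp add: in_keys_iff)
  moreover have "lookup u k' = 0" if "k' < ?k" for k'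
    using that Min_le[OF finite_keys, of k' u] by (meson in_keys_iff leD)
  ultimately have "0 < u"
    by (auto simp: less_poly_mapping_def less_fun_def intro!: exI[of _ ?k])
  then show ?thesis by simp
qed simp

text \<open>Adding the largest missing exponent keeps the set upward closed, because multiplying by a
  monomial can only make an exponent larger.\<close>
lemma up_closed_chain:
  "up_closed V U \<Longrightarrow> finite (expo V - U) \<Longrightarrow> card (expo V - U) = c \<Longrightarrow>
   \<exists>W. W 0 = U \<and> (\<forall>i\<le>c. up_closed V (W i)) \<and> (\<forall>i<c. W i \<subset> W (Suc i))"
proof (induction c arbitrary: U)
  case 0 then show ?case by (intro exI[of _ "\<lambda>_. U"]) auto
next
  case (Suc c)
  define m where "m = Max (expo V - U)"
  have ne: "expo V - U \<noteq> {}" using Suc.prems(3) by (metis card.empty nat.distinct(1))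
  have m: "m \<in> expo V - U" unfolding m_def using Suc.prems ne by (intro Max_in) auto
  have "m + u \<in> insert m U" if u: "u \<in> expo V" for u
  proof (rule ccontr)
    assume n: "m + u \<notin> insert m U"
    then have "m + u \<in> expo V - U" using m u by (auto simp: keys_add_nat)
    then have "m + u \<le> m" unfolding m_def using Suc.prems by (intro Max_ge) auto
    then have "u \<le> 0" using add_strict_left_mono[of 0 u m] by (metis add.right_neutral leD leI)
    moreover have "u \<ge> 0" by (rule zero_le_expo)
    ultimately show False using n by simp
  qed
  then have up: "up_closed V (insert m U)"
    using Suc.prems(1) m by (auto simp: up_closed_def)
  have eq: "expo V - insert m U = (expo V - U) - {m}" by auto
  have "card (expo V - insert m U) = c" unfolding eq using Suc.prems m by simp
  moreover have "finite (expo V - insert m U)" unfolding eq using Suc.prems by simp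
  ultimately obtain W where W: "W 0 = insert m U" "\<forall>i\<le>c. up_closed V (W i)" "\<forall>i<c. W i \<subset> W (Suc i)"
    using Suc.IH[OF up] by blast
  show ?case
  proof (intro exI[of _ "case_nat U W"] conjI allI impI)
    fix i assume "i \<le> Suc c" then show "up_closed V (case i of 0 \<Rightarrow> U | Suc x \<Rightarrow> W x)"
      using W(2) Suc.prems(1) by (cases i) auto
  next
    fix i assume "i < Suc c"
    then show "(case i of 0 \<Rightarrow> U | Suc x \<Rightarrow> W x) \<subset> (case Suc i of 0 \<Rightarrow> U | Suc x \<Rightarrow> W x)"
      using W m by (cases i) auto
  qed simp
qed

lemma quotient_coset_simps:
  assumes "cring R" "ideal J R"
  shows "carrier (R Quot J) = (\<lambda>x. J +>\<^bsub>R\<^esub> x) ` carrier R"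
    and "\<And>x y. x \<in> carrier R \<Longrightarrow> y \<in> carrier R \<Longrightarrow>
      (J +>\<^bsub>R\<^esub> x) \<oplus>\<^bsub>R Quot J\<^esub> (J +>\<^bsub>R\<^esub> y) = J +>\<^bsub>R\<^esub> (x \<oplus>\<^bsub>R\<^esub> y)"
    and "\<And>x y. x \<in> carrier R \<Longrightarrow> y \<in> carrier R \<Longrightarrow>
      (J +>\<^bsub>R\<^esub> x) \<otimes>\<^bsub>R Quot J\<^esub> (J +>\<^bsub>R\<^esub> y) = J +>\<^bsub>R\<^esub> (x \<otimes>\<^bsub>R\<^esub> y)"
    and "J +>\<^bsub>R\<^esub> \<zero>\<^bsub>R\<^esub> = \<zero>\<^bsub>R Quot J\<^esub>"
proof -
  interpret cring R by fact
  interpret J: ideal J R by fact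
  show "carrier (R Quot J) = (\<lambda>x. J +>\<^bsub>R\<^esub> x) ` carrier R"
    by (auto simp: FactRing_def A_RCOSETS_def')
  show "(J +>\<^bsub>R\<^esub> x) \<oplus>\<^bsub>R Quot J\<^esub> (J +>\<^bsub>R\<^esub> y) = J +>\<^bsub>R\<^esub> (x \<oplus>\<^bsub>R\<^esub> y)"
    if "x \<in> carrier R" "y \<in> carrier R" for x y
    using J.a_rcos_sum[OF that] by (simp add: FactRing_def)
  show "(J +>\<^bsub>R\<^esub> x) \<otimes>\<^bsub>R Quot J\<^esub> (J +>\<^bsub>R\<^esub> y) = J +>\<^bsub>R\<^esub> (x \<otimes>\<^bsub>R\<^esub> y)"
    if "x \<in> carrier R" "y \<in> carrier R" for x y
    using J.rcoset_mult_add[OF that] by (simp add: FactRing_def)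
  show "J +>\<^bsub>R\<^esub> \<zero>\<^bsub>R\<^esub> = \<zero>\<^bsub>R Quot J\<^esub>"
    using J.a_rcos_const[OF additive_subgroup.zero_closed[OF ideal.axioms(1)[OF assms(2)]]]
    by (simp add: FactRing_def)
qed

lemma submodule_quotient:
  assumes "cring R" "ideal J R" "ideal K R"
  shows "submodule ((\<lambda>x. J +>\<^bsub>R\<^esub> x) ` K) R (quotient_module R J)"
proof -
  let ?\<pi> = "\<lambda>x. J +>\<^bsub>R\<^esub> x"
  interpret cring R by fact
  interpret J: ideal J R by fact
  interpret K: ideal K R by fact
  interpret Q: ring "R Quot J" by (rule J.quotient_is_ring)
  have am: "carrier (add_monoid (quotient_module R J)) = carrier (R Quot J)"
    "\<And>X Y. X \<otimes>\<^bsub>add_monoid (quotient_module R J)\<^esub> Y = X \<oplus>\<^bsub>R Quot J\<^esub> Y"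
    "\<one>\<^bsub>add_monoid (quotient_module R J)\<^esub> = \<zero>\<^bsub>R Quot J\<^esub>"
    "\<And>X. inv\<^bsub>add_monoid (quotient_module R J)\<^esub> X = \<ominus>\<^bsub>R Quot J\<^esub> X"
    by (simp_all add: quotient_module_def a_inv_def m_inv_def)
  have Kc: "\<And>x. x \<in> K \<Longrightarrow> x \<in> carrier R" by (rule K.a_Hcarr)
  note qa = quotient_coset_simps(2)[OF assms(1,2)] and q0 = quotient_coset_simps(4)[OF assms(1,2)]
  have qc: "J +>\<^bsub>R\<^esub> x \<in> carrier (R Quot J)" if "x \<in> carrier R" for x
    unfolding quotient_coset_simps(1)[OF assms(1,2)] using that by (rule imageI)
  show ?thesis
  proof (intro submodule.intro subgroup.intro submodule_axioms.intro)
    show "?\<pi> ` K \<subseteq> carrier (add_monoid (quotient_module R J))"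
      unfolding am using qc Kc by auto
    fix X Y assume X: "X \<in> ?\<pi> ` K"
    then obtain x where x: "x \<in> K" "X = J +>\<^bsub>R\<^esub> x" by auto
    {
      assume "Y \<in> ?\<pi> ` K"
      then obtain y where y: "y \<in> K" "Y = J +>\<^bsub>R\<^esub> y" by auto
      show "X \<otimes>\<^bsub>add_monoid (quotient_module R J)\<^esub> Y \<in> ?\<pi> ` K"
        unfolding am using x y qa Kc
          additive_subgroup.a_closed[OF ideal.axioms(1)[OF assms(3)], of x y] by auto
    }
    have mx: "\<ominus>\<^bsub>R\<^esub> x \<in> K" using x(1) by (rule additive_subgroup.a_inv_closed[OF ideal.axioms(1)[OF assms(3)]])
    have "\<ominus>\<^bsub>R Quot J\<^esub> X = J +>\<^bsub>R\<^esub> (\<ominus>\<^bsub>R\<^esub> x)"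
      by (rule Q.minus_equality) (use x mx qa qc Kc q0 l_neg in auto)
    then show "inv\<^bsub>add_monoid (quotient_module R J)\<^esub> X \<in> ?\<pi> ` K"
      unfolding am using mx by simp
  next
    show "\<one>\<^bsub>add_monoid (quotient_module R J)\<^esub> \<in> ?\<pi> ` K"
      unfolding am using q0[symmetric] additive_subgroup.zero_closed[OF ideal.axioms(1)[OF assms(3)]] by auto
  next
    fix a X assume a: "a \<in> carrier R" and "X \<in> ?\<pi> ` K"
    then obtain x where x: "x \<in> K" "X = J +>\<^bsub>R\<^esub> x" by auto
    have "(J +>\<^bsub>R\<^esub> a) \<otimes>\<^bsub>R Quot J\<^esub> X = J +>\<^bsub>R\<^esub> (a \<otimes>\<^bsub>R\<^esub> x)"
      using J.rcoset_mult_add[OF a Kc[OF x(1)]] x by (simp add: FactRing_def)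
    then show "a \<odot>\<^bsub>quotient_module R J\<^esub> X \<in> ?\<pi> ` K"
      using K.I_l_closed[OF x(1) a] by (simp add: quotient_module_def)
  qed
qed

text \<open>Adding the missing monomials one at a time gives a strict chain of submodules.\<close>
lemma length_ge:
  fixes J :: "'k::field mpoly set"
  assumes U: "up_closed V U" and fin: "finite (expo V - U)"
  shows "enat (card (expo V - U)) \<le>
    module_length (mpoly_ring V) (quotient_module (mpoly_ring V) (mspan U :: 'k mpoly set))"
proof -
  let ?R = "mpoly_ring V :: 'k mpoly ring"
  let ?J = "mspan U :: 'k mpoly set"
  let ?c = "card (expo V - U)"
  interpret cring ?R by (rule cring_mpoly_ring)
  interpret J: ideal ?J ?R by (rule ideal_mspan[OF U])
  obtain W where W: "W 0 = U" "\<And>i. i \<le> ?c \<Longrightarrow> up_closed V (W i)" "\<And>i. i < ?c \<Longrightarrow> W i \<subset> W (Suc i)"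
    using up_closed_chain[OF U fin refl] by blast
  have UW: "i \<le> ?c \<Longrightarrow> U \<subseteq> W i" for i
    by (induction i) (use W in \<open>auto dest: Suc_le_lessD\<close>, metis Suc_le_lessD Suc_leD W(3) psubsetD subsetD)
  define N where "N i = (\<lambda>x. ?J +>\<^bsub>?R\<^esub> x) ` mspan (W i)" for i
  have sub: "submodule (N i) ?R (quotient_module ?R ?J)" if "i \<le> ?c" for i
    unfolding N_def by (intro submodule_quotient ideal_mspan U W(2) that cring_mpoly_ring)
  have strict: "N i \<subset> N (Suc i)" if i: "i < ?c" for i
  proof
    show "N i \<subseteq> N (Suc i)" unfolding N_def using W(3)[OF i] by (intro image_mono mspan_mono) auto
    obtain m where m: "m \<in> W (Suc i)" "m \<notin> W i" using W(3)[OF i] by auto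
    let ?x = "single m 1 :: 'k mpoly"
    have "?J +>\<^bsub>?R\<^esub> ?x \<in> N (Suc i)" unfolding N_def using m(1) by (auto intro: single_in_mspan)
    moreover have "?J +>\<^bsub>?R\<^esub> ?x \<notin> N i"
    proof
      assume "?J +>\<^bsub>?R\<^esub> ?x \<in> N i"
      then obtain y where y: "y \<in> mspan (W i)" "?J +>\<^bsub>?R\<^esub> ?x = ?J +>\<^bsub>?R\<^esub> y" unfolding N_def by auto
      have "m \<in> expo V" using m(1) W(2)[of "Suc i"] i up_closed_sub by auto
      then have "?x \<in> ?J +>\<^bsub>?R\<^esub> ?x"
        by (intro J.a_rcos_self) (simp add: single_in_mspan)
      then obtain j where j: "j \<in> ?J" "?x = j + y" unfolding y(2) by (auto simp: a_r_coset_def')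
      have "j \<in> mspan (W i)" using j(1) UW[of i] i mspan_mono by (metis less_imp_le subsetD)
      with j(2) y(1) have "?x \<in> mspan (W i)" using mspan_add by metis
      then show False using m(2) by (simp add: mspan_def)
    qed
    ultimately show "N i \<noteq> N (Suc i)" by auto
  qed
  show ?thesis
    unfolding module_length_def
    by (rule SUP_upper) (use sub strict in blast)
qed

text \<open>In a strict chain of submodules the sets of leading exponents of normal forms grow strictly,
  and they consist of missing exponents.\<close>
lemma length_le:
  assumes U: "up_closed V U" and fin: "finite (expo V - U)"
  shows "module_length (mpoly_ring V) (quotient_module (mpoly_ring V) (mspan U :: 'k::field mpoly set))
    \<le> enat (card (expo V - U))"
proof -
  let ?R = "mpoly_ring V :: 'k mpoly ring"
  let ?J = "mspan U :: 'k mpoly set"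
  let ?M = "quotient_module ?R ?J"
  let ?B = "expo V - U"
  interpret cring ?R by (rule cring_mpoly_ring)
  interpret J: ideal ?J ?R by (rule ideal_mspan[OF U])
  have qa: "(?J +>\<^bsub>?R\<^esub> x) \<oplus>\<^bsub>?M\<^esub> (?J +>\<^bsub>?R\<^esub> y) = ?J +>\<^bsub>?R\<^esub> (x + y)"
    if "x \<in> mspan (expo V)" "y \<in> mspan (expo V)" for x y
    using J.a_rcos_sum[of x y] that by (simp add: FactRing_def quotient_module_def)
  have qm: "a \<odot>\<^bsub>?M\<^esub> (?J +>\<^bsub>?R\<^esub> x) = ?J +>\<^bsub>?R\<^esub> (a * x)"
    if "a \<in> mspan (expo V)" "x \<in> mspan (expo V)" for a x
    using J.rcoset_mult_add[of a x] that by (simp add: FactRing_def quotient_module_def)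
  have q0: "?J +>\<^bsub>?R\<^esub> x = ?J" if "x \<in> ?J" for x
    using that J.a_rcos_const by blast
  have BV: "mspan ?B \<subseteq> (mspan (expo V) :: 'k mpoly set)" by (intro mspan_mono) auto
  have constV: "mpoly_const c \<in> mspan (expo V)" for c :: 'k
    by (auto simp: mpoly_const_def mspan_def)
  have "n \<le> card ?B"
    if N: "\<And>i. i \<le> n \<Longrightarrow> submodule (N i) ?R ?M" "\<And>i. i < n \<Longrightarrow> N i \<subset> N (Suc i)" for n N
  proof -
    \<comment> \<open>the normal forms, supported on the missing exponents, of the elements of \<open>N i\<close>\<close>
    define S where "S i = {p \<in> mspan ?B. ?J +>\<^bsub>?R\<^esub> p \<in> N i}" for i
    have addS: "p + q \<in> S i" if "p \<in> S i" "q \<in> S i" "i \<le> n" for p q i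
    proof -
      interpret N: submodule "N i" ?R ?M by (rule N(1)[OF that(3)])
      have "(?J +>\<^bsub>?R\<^esub> p) \<oplus>\<^bsub>?M\<^esub> (?J +>\<^bsub>?R\<^esub> q) \<in> N i"
        using N.m_closed that(1,2) unfolding S_def by auto
      moreover have "p \<in> mspan (expo V)" "q \<in> mspan (expo V)" "p + q \<in> mspan ?B"
        using that(1,2) BV unfolding S_def by (auto intro: mspan_add)
      ultimately show ?thesis using qa[of p q] unfolding S_def by simp
    qed
    have scS: "mpoly_const c * p \<in> S i" if "p \<in> S i" "i \<le> n" for c p i
    proof -
      interpret N: submodule "N i" ?R ?M by (rule N(1)[OF that(2)])
      have "mpoly_const c \<odot>\<^bsub>?M\<^esub> (?J +>\<^bsub>?R\<^esub> p) \<in> N i"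
        using N.smult_closed[of "mpoly_const c"] that(1) constV unfolding S_def by auto
      moreover have "mpoly_const c * p \<in> mspan ?B"
        using that(1) keys_const_mult[of c p] unfolding S_def mspan_def by blast
      moreover have "p \<in> mspan (expo V)" using that(1) BV unfolding S_def by auto
      ultimately show ?thesis using qm[of "mpoly_const c" p] constV unfolding S_def by simp
    qed
    have zS: "0 \<in> S i" if "i \<le> n" for i
    proof -
      interpret N: submodule "N i" ?R ?M by (rule N(1)[OF that])
      have "?J \<in> N i" using N.one_closed by (simp add: quotient_module_def FactRing_def)
      then show ?thesis using q0[of 0] by (simp add: S_def)
    qed
    have strict: "S i \<noteq> S (Suc i)" if i: "i < n" for i
    proof -
      interpret N: submodule "N (Suc i)" ?R ?M by (rule N(1)) (use i in simp)
      obtain X where X: "X \<in> N (Suc i)" "X \<notin> N i" using N(2)[OF i] by auto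
      then have "X \<in> carrier ?M" using N.subset by auto
      then obtain x where x: "x \<in> mspan (expo V)" "X = ?J +>\<^bsub>?R\<^esub> x"
        by (auto simp: quotient_module_def FactRing_def A_RCOSETS_def')
      define y z where "y = (\<Sum>m\<in>keys x - U. single m (lookup x m))"
        and "z = (\<Sum>m\<in>keys x \<inter> U. single m (lookup x m))"
      have xyz: "x = z + y"
      proof -
        have "x = (\<Sum>m\<in>keys x. single m (lookup x m))"
          by (simp add: sum_single_lookup)
        also have "\<dots> = z + y" unfolding y_def z_def
          by (subst sum.Int_Diff[of _ _ U]) auto
        finally show ?thesis .
      qed
      have y: "y \<in> mspan ?B" unfolding y_def
        using x(1) by (intro mspan_sum single_in_mspan) (auto simp: mspan_def)
      have z: "z \<in> ?J" unfolding z_def by (intro mspan_sum single_in_mspan) auto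
      have "?J +>\<^bsub>?R\<^esub> y = X"
      proof -
        have "x \<in> ?J +>\<^bsub>?R\<^esub> y" using z xyz by (auto simp: a_r_coset_def')
        then show ?thesis using abelian_group.a_repr_independence[OF is_abelian_group, of x ?J y] y BV x J.a_subgroup by auto
      qed
      then have "y \<in> S (Suc i)" "y \<notin> S i" using X y by (auto simp: S_def)
      then show ?thesis by auto
    qed
    have mono: "S i \<subseteq> S (Suc i)" if "i < n" for i
      using N(2)[OF that] unfolding S_def by auto
    have leadB: "lead_set (S i) \<subseteq> ?B" for i
    proof
      fix m assume "m \<in> lead_set (S i)"
      then obtain p where p: "m = Max (keys p)" "p \<in> S i" "p \<noteq> 0"
        by (auto simp: lead_set_def)
      then have "m \<in> keys p" by (auto intro: Max_in)
      then show "m \<in> ?B" using p(2) by (auto simp: S_def mspan_def)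
    qed
    have "i \<le> card (lead_set (S i))" if "i \<le> n" for i
      using that
    proof (induction i)
      case (Suc i)
      have "lead_set (S i) \<subset> lead_set (S (Suc i))"
      proof
        show "lead_set (S i) \<subseteq> lead_set (S (Suc i))"
          using mono[of i] Suc.prems unfolding lead_set_def by auto
        show "lead_set (S i) \<noteq> lead_set (S (Suc i))"
        proof
          assume eq: "lead_set (S i) = lead_set (S (Suc i))"
          have "S i = S (Suc i)"
            by (rule subspace_eq_if_lead_set_eq[OF fin])
              (use Suc.prems mono[of i] addS scS zS eq in \<open>auto simp: S_def\<close>)
          then show False using strict[of i] Suc.prems by auto
        qed
      qed
      then have "card (lead_set (S i)) < card (lead_set (S (Suc i)))"
        using finite_subset[OF leadB fin] by (intro psubset_card_mono) auto
      with Suc show ?case by auto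
    qed simp
    then have "n \<le> card (lead_set (S n))" by blast
    also have "\<dots> \<le> card ?B" by (rule card_mono[OF fin leadB])
    finally show ?thesis .
  qed
  then show ?thesis
    unfolding module_length_def by (intro SUP_least) auto
qed

theorem length_mspan:
  assumes "up_closed V U" "finite (expo V - U)"
  shows "module_length (mpoly_ring V) (quotient_module (mpoly_ring V) (mspan U :: 'k::field mpoly set))
    = enat (card (expo V - U))"
  using length_le[OF assms] length_ge[OF assms] by (intro antisym)

section \<open>Integral closure of a monomial ideal\<close>

text \<open>The lattice points of the Newton polyhedron of \<open>U\<close>: the condition says that \<open>m\<close> is a rational
  convex combination of elements of \<open>U\<close>.\<close>
definition expo_sat :: "nat set \<Rightarrow> (nat \<Rightarrow>\<^sub>0 nat) set \<Rightarrow> (nat \<Rightarrow>\<^sub>0 nat) set" where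
  "expo_sat V U = {m \<in> expo V. \<exists>k\<ge>1. of_nat k * m \<in> expo_pow V U k}"

lemma of_nat_mult_left_cancel_expo: "k \<ge> 1 \<Longrightarrow> of_nat k * m = of_nat k * m' \<Longrightarrow> m = (m' :: nat \<Rightarrow>\<^sub>0 nat)"
  by (rule poly_mapping_eqI) (metis lookup_of_nat_mult mult_left_cancel not_one_le_zero)

lemma up_closed_expo_sat:
  assumes U: "up_closed V U" shows "up_closed V (expo_sat V U)"
  unfolding up_closed_def
proof (intro conjI ballI)
  show "expo_sat V U \<subseteq> expo V" by (auto simp: expo_sat_def)
  fix m u assume "m \<in> expo_sat V U" and u: "u \<in> expo V"
  then obtain k where k: "k \<ge> 1" "of_nat k * m \<in> expo_pow V U k" "m \<in> expo V"
    by (auto simp: expo_sat_def)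
  have "of_nat k * m + of_nat k * u \<in> expo_pow V U k"
    using up_closedD[OF up_closed_expo_pow[OF U] k(2), of "of_nat k * u"] keys_of_nat_mult[of k u] u by auto
  then show "m + u \<in> expo_sat V U"
    using k u by (auto simp: expo_sat_def keys_add_nat algebra_simps intro!: exI[of _ k])
qed

text \<open>The exponents of the monomial ideal generated by those of \<open>U\<close> and \<open>Y\<close>.\<close>
definition up_adjoin :: "nat set \<Rightarrow> (nat \<Rightarrow>\<^sub>0 nat) set \<Rightarrow> (nat \<Rightarrow>\<^sub>0 nat) set \<Rightarrow> (nat \<Rightarrow>\<^sub>0 nat) set" where
  "up_adjoin V U Y = U \<union> {y + u | y u. y \<in> Y \<and> u \<in> expo V}"

lemma up_closed_up_adjoin:
  assumes "up_closed V U" "Y \<subseteq> expo V" shows "up_closed V (up_adjoin V U Y)"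
  unfolding up_closed_def up_adjoin_def
proof (intro conjI ballI)
  show "U \<union> {y + u |y u. y \<in> Y \<and> u \<in> expo V} \<subseteq> expo V"
    using assms unfolding up_closed_def by (clarsimp simp: keys_add_nat) blast
  fix m u assume m: "m \<in> U \<union> {y + u |y u. y \<in> Y \<and> u \<in> expo V}" and u: "u \<in> expo V"
  show "m + u \<in> U \<union> {y + u |y u. y \<in> Y \<and> u \<in> expo V}"
  proof (cases "m \<in> U")
    case True then show ?thesis using up_closedD[OF assms(1)] u by auto
  next
    case False
    then obtain y w where "m = y + w" "y \<in> Y" "w \<in> expo V" using m by auto
    moreover from this u have "w + u \<in> expo V" by (auto simp: keys_add_nat)
    ultimately show ?thesis by (auto simp: add.assoc)
  qed
qed

lemma expo_pow_adjoin_split: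
  assumes Z: "up_closed V Z" and v: "v \<in> expo V"
  shows "x \<in> expo_pow V (up_adjoin V Z {v}) k \<Longrightarrow>
    \<exists>c\<le>k. \<exists>z\<in>expo_pow V Z (k - c). x = of_nat c * v + z"
proof (induction k arbitrary: x)
  case 0 then show ?case by auto
next
  case (Suc k)
  then obtain a b where ab: "x = a + b" "a \<in> expo_pow V (up_adjoin V Z {v}) k" "b \<in> up_adjoin V Z {v}"
    by auto
  from Suc.IH[OF ab(2)] obtain c z where c: "c \<le> k" "z \<in> expo_pow V Z (k - c)" "a = of_nat c * v + z"
    by auto
  show ?case
  proof (cases "b \<in> Z")
    case True
    then have "z + b \<in> expo_pow V Z (Suc (k - c))" using c(2) by auto
    then show ?thesis using c ab(1)
      by (intro exI[of _ c] conjI bexI[of _ "z + b"]) (auto simp: Suc_diff_le add.assoc)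
  next
    case False
    then obtain u where u: "b = v + u" "u \<in> expo V" using ab(3) by (auto simp: up_adjoin_def)
    have "z + u \<in> expo_pow V Z (k - c)" using up_closedD[OF up_closed_expo_pow[OF Z] c(2)] u by auto
    then show ?thesis using c ab(1) u
      by (intro exI[of _ "Suc c"] conjI bexI[of _ "z + u"]) (auto simp: algebra_simps)
  qed
qed

lemma expo_pow_mono:
  assumes "U \<subseteq> Z" shows "expo_pow V U n \<subseteq> expo_pow V Z n"
  using assms by (induction n) (simp, fastforce)

text \<open>Adjoining a point of the Newton polyhedron does not enlarge the polyhedron.\<close>
lemma expo_sat_adjoin:
  assumes Z: "up_closed V Z" and v: "v \<in> expo_sat V Z"
  shows "expo_sat V (up_adjoin V Z {v}) \<subseteq> expo_sat V Z"
proof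
  fix m assume "m \<in> expo_sat V (up_adjoin V Z {v})"
  then obtain k where k: "k \<ge> 1" "of_nat k * m \<in> expo_pow V (up_adjoin V Z {v}) k" "m \<in> expo V"
    by (auto simp: expo_sat_def)
  from v obtain l where l: "l \<ge> 1" "of_nat l * v \<in> expo_pow V Z l" "v \<in> expo V"
    by (auto simp: expo_sat_def)
  from expo_pow_adjoin_split[OF Z l(3) k(2)]
  obtain c z where c: "c \<le> k" "z \<in> expo_pow V Z (k - c)" "of_nat k * m = of_nat c * v + z" by auto
  have "of_nat c * (of_nat l * v) + of_nat l * z \<in> expo_pow V Z (c * l + l * (k - c))"
    by (intro expo_pow_add[OF Z] expo_pow_scale[OF Z] l c)
  moreover have "c * l + l * (k - c) = l * k" using c(1) by (metis add_mult_distrib2 le_add_diff_inverse mult.commute)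
  moreover have "of_nat c * (of_nat l * v) + of_nat l * z = of_nat (l * k) * m"
  proof -
    have "of_nat (l * k) * m = of_nat l * (of_nat k * m)" by (simp add: mult.assoc)
    also have "\<dots> = of_nat l * (of_nat c * v + z)" by (simp only: c(3))
    finally show ?thesis by (simp add: algebra_simps)
  qed
  ultimately have "of_nat (l * k) * m \<in> expo_pow V Z (l * k)" by simp
  moreover have "l * k \<ge> 1" using l(1) k(1) by simp
  ultimately show "m \<in> expo_sat V Z" using k(3) unfolding expo_sat_def by blast
qed

lemma expo_sat_common:
  assumes U: "up_closed V U" and "finite M" "M \<subseteq> expo_sat V U"
  shows "\<exists>K\<ge>1. \<forall>m\<in>M. of_nat K * m \<in> expo_pow V U K"
  using assms(2,3)
proof (induction M rule: finite_induct)
  case empty then show ?case by auto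
next
  case (insert m M)
  then obtain K where K: "K \<ge> 1" "\<And>m. m \<in> M \<Longrightarrow> of_nat K * m \<in> expo_pow V U K" by auto
  obtain l where l: "l \<ge> 1" "of_nat l * m \<in> expo_pow V U l" using insert.prems by (auto simp: expo_sat_def)
  have "of_nat (l * K) * x \<in> expo_pow V U (l * K)" if "x \<in> insert m M" for x
  proof (cases "x = m")
    case True
    have "of_nat K * (of_nat l * m) \<in> expo_pow V U (K * l)" by (rule expo_pow_scale[OF U l(2)])
    then show ?thesis using True by (simp add: algebra_simps)
  next
    case False
    then have "of_nat l * (of_nat K * x) \<in> expo_pow V U (l * K)" using that
      by (intro expo_pow_scale[OF U] K) auto
    then show ?thesis by (simp add: algebra_simps)
  qed
  moreover have "l * K \<ge> 1" using l K by simp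
  ultimately show ?case by blast
qed

text \<open>Suppose that \<open>v\<close> is an exponent of \<open>r\<close> outside the Newton polyhedron of \<open>Z\<close>, and that all exponents of
  \<open>r\<close> lie in the polyhedron spanned by \<open>Z\<close> and \<open>v\<close>. Then \<open>v\<close> is a vertex, so \<open>s v\<close> arises in \<open>r\<^sup>s\<close> only
  as \<open>v + \<dots> + v\<close>, and it cannot arise in \<open>a\<^sub>i r\<^sup>s\<^sup>-\<^sup>i\<close> with \<open>i \<ge> 1\<close>, because an exponent of \<open>a\<^sub>i\<close>
  carries weight on \<open>Z\<close>. So the leading term of the equation cannot cancel.

  For a common denominator \<open>K\<close>, the set \<open>T n\<close> consists of the sums of \<open>n\<close> points of the larger
  polyhedron, and \<open>T' n\<close> of those that are written with a genuine contribution
  other than \<open>n v\<close>.\<close>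
lemma integral_extreme_exponent:
  fixes r :: "'k::field mpoly"
  assumes Z: "up_closed V Z" and UZ: "U \<subseteq> Z" and v: "v \<in> keys r" "v \<in> expo V" "v \<notin> expo_sat V Z"
    and sub: "keys r \<subseteq> expo_sat V (up_adjoin V Z {v})"
    and a: "\<And>i. i \<in> {1..s} \<Longrightarrow> a i \<in> mspan (expo_pow V U i)"
    and eq: "r ^ s + (\<Sum>i = 1..s. a i * r ^ (s - i)) = 0"
  shows False
proof -
  obtain K where K: "K \<ge> 1"
    "\<And>m. m \<in> keys r \<Longrightarrow> of_nat K * m \<in> expo_pow V (up_adjoin V Z {v}) K"
    using expo_sat_common[OF up_closed_up_adjoin[OF Z, of "{v}"] _ sub] v(2) by auto
  define T where "T n = {x. \<exists>c\<le>K*n. \<exists>z\<in>expo_pow V Z (K*n - c). of_nat K * x = of_nat c * v + z}" for n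
  define T' where "T' n = {x. \<exists>c\<le>K*n. \<exists>z\<in>expo_pow V Z (K*n - c). of_nat K * x = of_nat c * v + z \<and> (c < K*n \<or> z \<noteq> 0)}" for n
  have T'T: "T' n \<subseteq> T n" for n unfolding T_def T'_def by blast
  have zero_iff: "p + q = 0 \<longleftrightarrow> p = 0 \<and> q = 0" for p q :: "nat \<Rightarrow>\<^sub>0 nat"
    by (metis (no_types) Un_empty keys_add_nat keys_eq_empty poly_mapping_eqI keys_zero in_keys_iff empty_iff lookup_zero)
  have comb: "\<exists>c\<le>K*(n + n'). \<exists>z\<in>expo_pow V Z (K*(n + n') - c). of_nat K * (x + y) = of_nat c * v + z \<and>
      ((c1 < K*n \<or> z1 \<noteq> 0) \<or> (c2 < K*n' \<or> z2 \<noteq> 0) \<longrightarrow> c < K*(n + n') \<or> z \<noteq> 0)"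
    if "c1 \<le> K*n" "z1 \<in> expo_pow V Z (K*n - c1)" "of_nat K * x = of_nat c1 * v + z1"
       "c2 \<le> K*n'" "z2 \<in> expo_pow V Z (K*n' - c2)" "of_nat K * y = of_nat c2 * v + z2"
    for n n' c1 z1 x c2 z2 y
  proof (intro exI[of _ "c1 + c2"] conjI bexI[of _ "z1 + z2"])
    show "c1 + c2 \<le> K * (n + n')" using that by (simp add: distrib_left)
    have "z1 + z2 \<in> expo_pow V Z ((K*n - c1) + (K*n' - c2))"
      by (intro expo_pow_add[OF Z] that)
    then show "z1 + z2 \<in> expo_pow V Z (K * (n + n') - (c1 + c2))"
      using that(1,4) by (simp add: distrib_left)
    show "of_nat K * (x + y) = of_nat (c1 + c2) * v + (z1 + z2)"
      using that(3,6) by (simp add: algebra_simps)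
    show "(c1 < K*n \<or> z1 \<noteq> 0) \<or> (c2 < K*n' \<or> z2 \<noteq> 0) \<longrightarrow> c1 + c2 < K*(n + n') \<or> z1 + z2 \<noteq> 0"
      using that(1,4) by (auto simp: zero_iff distrib_left)
  qed
  have TT': "x + y \<in> T' (n + n')" if x: "x \<in> T n" and y: "y \<in> T' n'" for x y n n'
  proof -
    obtain c1 z1 where 1: "c1 \<le> K*n" "z1 \<in> expo_pow V Z (K*n - c1)" "of_nat K * x = of_nat c1 * v + z1"
      using x unfolding T_def by auto
    obtain c2 z2 where 2: "c2 \<le> K*n'" "z2 \<in> expo_pow V Z (K*n' - c2)" "of_nat K * y = of_nat c2 * v + z2"
      "c2 < K*n' \<or> z2 \<noteq> 0"
      using y unfolding T'_def by auto
    show ?thesis using comb[OF 1 2(1-3)] 2(4) unfolding T'_def by blast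
  qed
  have TT: "x + y \<in> T (n + n')" if x: "x \<in> T n" and y: "y \<in> T n'" for x y n n'
  proof -
    obtain c1 z1 where 1: "c1 \<le> K*n" "z1 \<in> expo_pow V Z (K*n - c1)" "of_nat K * x = of_nat c1 * v + z1"
      using x unfolding T_def by auto
    obtain c2 z2 where 2: "c2 \<le> K*n'" "z2 \<in> expo_pow V Z (K*n' - c2)" "of_nat K * y = of_nat c2 * v + z2"
      using y unfolding T_def by auto
    show ?thesis using comb[OF 1 2] unfolding T_def by blast
  qed
  have vT: "of_nat n * v \<in> T n" for n
    unfolding T_def
    by (intro CollectI exI[of _ "K*n"] conjI bexI[of _ 0]) (auto simp: mult.assoc)
  have vT': "of_nat n * v \<notin> T' n" for n
  proof
    assume "of_nat n * v \<in> T' n"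
    then obtain c z where c: "c \<le> K*n" "z \<in> expo_pow V Z (K*n - c)"
      "of_nat K * (of_nat n * v) = of_nat c * v + z" "c < K*n \<or> z \<noteq> 0"
      unfolding T'_def by auto
    have "of_nat c * v + of_nat (K*n - c) * v = of_nat (c + (K*n - c)) * v"
      by (simp only: of_nat_add distrib_right)
    also have "\<dots> = of_nat c * v + z" using c(1,3) by (simp add: mult.assoc)
    finally have z: "of_nat (K*n - c) * v = z" by simp
    show False
    proof (cases "c < K*n")
      case True
      then have "K*n - c \<ge> 1" by simp
      then have "v \<in> expo_sat V Z" using z c(2) v(2) unfolding expo_sat_def by auto
      then show False using v(3) by simp
    next
      case False
      then have "z = 0" using z by auto
      then show False using c(4) False by simp
    qed
  qed
  define c where "c = lookup r v"
  have c0: "c \<noteq> 0" using v(1) by (simp add: c_def in_keys_iff)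
  have keysT: "m \<in> T 1" if "m \<in> keys r" for m
    using expo_pow_adjoin_split[OF Z v(2) K(2)[OF that]] unfolding T_def by auto
  have keysT': "m \<in> T' 1" if m: "m \<in> keys r" "m \<noteq> v" for m
  proof -
    obtain d z where d: "d \<le> K" "z \<in> expo_pow V Z (K - d)" "of_nat K * m = of_nat d * v + z"
      using expo_pow_adjoin_split[OF Z v(2) K(2)[OF m(1)]] by auto
    have "d < K \<or> z \<noteq> 0"
    proof (rule ccontr)
      assume "\<not> (d < K \<or> z \<noteq> 0)"
      then have "of_nat K * m = of_nat K * v" using d by simp
      then show False using of_nat_mult_left_cancel_expo[OF K(1)] m(2) by auto
    qed
    then show ?thesis unfolding T'_def using d by auto
  qed
  define r' where "r' = r - single v c"
  have rr: "r = single v c + r'" by (simp add: r'_def)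
  have r': "r' \<in> mspan (T' 1)"
    unfolding mspan_def
  proof (intro CollectI subsetI)
    fix m assume "m \<in> keys r'"
    then have "m \<noteq> v" "m \<in> keys r"
      by (auto simp: r'_def in_keys_iff lookup_minus lookup_single when_def c_def split: if_splits)
    then show "m \<in> T' 1" by (rule keysT'[rotated])
  qed
  have rT: "r \<in> mspan (T 1)" unfolding mspan_def using keysT by auto
  have pow: "r ^ n - single (of_nat n * v) (c ^ n) \<in> mspan (T' n) \<and> r ^ n \<in> mspan (T n)" for n
  proof (induction n)
    case 0
    have "(1 :: 'k mpoly) \<in> mspan (T 0)" using vT[of 0] by (auto simp: mspan_def)
    then show ?case by simp
  next
    case (Suc n)
    let ?R = "r ^ n - single (of_nat n * v) (c ^ n)"
    have "r ^ Suc n - single (of_nat (Suc n) * v) (c ^ Suc n)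
        = r * ?R + single (of_nat n * v) (c ^ n) * r'"
    proof -
      have "single (of_nat (Suc n) * v) (c ^ Suc n)
          = single (of_nat n * v) (c ^ n) * single v c"
        by (simp add: mult_single algebra_simps)
      then show ?thesis by (simp add: r'_def algebra_simps)
    qed
    moreover have "r * ?R \<in> mspan (T' (1 + n))"
      by (rule mspan_mult[OF rT conjunct1[OF Suc]]) (rule TT')
    moreover have "single (of_nat n * v) (c ^ n) * r' \<in> mspan (T' (n + 1))"
      by (rule mspan_mult[OF single_in_mspan[OF vT] r']) (rule TT')
    moreover have "r * r ^ n \<in> mspan (T (1 + n))"
      by (rule mspan_mult[OF rT conjunct2[OF Suc]]) (rule TT)
    ultimately show ?case by (simp add: mspan_add)
  qed
  have "a i * r ^ (s - i) \<in> mspan (T' s)" if i: "i \<in> {1..s}" for i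
  proof (rule mspan_mult[OF a[OF i] conjunct2[OF pow]])
    fix e x assume e: "e \<in> expo_pow V U i" and x: "x \<in> T (s - i)"
    obtain d z where d: "d \<le> K*(s - i)" "z \<in> expo_pow V Z (K*(s - i) - d)" "of_nat K * x = of_nat d * v + z"
      using x unfolding T_def by auto
    have "e \<in> expo_pow V Z i" using e expo_pow_mono[OF UZ] by blast
    then have "z + of_nat K * e \<in> expo_pow V Z ((K*(s - i) - d) + K * i)"
      by (intro expo_pow_add[OF Z] d expo_pow_scale[OF Z])
    moreover have Ki: "K * (s - i) + K * i = K * s" using i by (simp flip: distrib_left)
    moreover have "K * i > 0" using K(1) i by simp
    moreover have "(K*(s - i) - d) + K * i = K * s - d" using d(1) Ki by linarith
    moreover have "d < K * s" using d(1) Ki \<open>K * i > 0\<close> by linarith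
    ultimately have "z + of_nat K * e \<in> expo_pow V Z (K * s - d)" "d < K * s" by simp_all
    moreover have "of_nat K * (e + x) = of_nat d * v + (z + of_nat K * e)"
      using d(3) by (simp add: algebra_simps)
    ultimately show "e + x \<in> T' s" unfolding T'_def
      by (intro CollectI exI[of _ d] conjI bexI[of _ "z + of_nat K * e"]) auto
  qed
  then have "(\<Sum>i = 1..s. a i * r ^ (s - i)) \<in> mspan (T' s)" by (rule mspan_sum)
  then have "(r ^ s - single (of_nat s * v) (c ^ s)) + (\<Sum>i = 1..s. a i * r ^ (s - i)) \<in> mspan (T' s)"
    using pow by (intro mspan_add) auto
  then have "- single (of_nat s * v) (c ^ s) \<in> mspan (T' s)"
    using eq by (simp add: algebra_simps)
  then have "single (of_nat s * v) (c ^ s) \<in> mspan (T' s)"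
    using mspan_uminus by fastforce
  then show False using vT'[of s] c0 by (simp add: single_in_mspan_iff)
qed

text \<open>A smallest set \<open>Y\<close> of exponents of \<open>r\<close> that, together with \<open>U\<close>, spans all of them has only
  vertices as elements. By the preceding lemma it must be empty.\<close>
lemma integral_imp_keys_sat:
  fixes r :: "'k::field mpoly"
  assumes U: "up_closed V U" and r: "r \<in> mspan (expo V)"
    and a: "\<And>i. i \<in> {1..s} \<Longrightarrow> a i \<in> mspan (expo_pow V U i)"
    and eq: "r ^ s + (\<Sum>i = 1..s. a i * r ^ (s - i)) = 0"
  shows "keys r \<subseteq> expo_sat V U"
proof -
  let ?P = "\<lambda>Y. Y \<subseteq> keys r \<and> keys r \<subseteq> expo_sat V (up_adjoin V U Y)"
  have rV: "keys r \<subseteq> expo V" using r by (simp add: mspan_def)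
  have Pr: "?P (keys r)"
  proof (intro conjI subsetI)
    fix m assume m: "m \<in> keys r"
    have "up_closed V (up_adjoin V U (keys r))" using rV by (intro up_closed_up_adjoin U)
    moreover have "m \<in> up_adjoin V U (keys r)"
      using m unfolding up_adjoin_def by (intro UnI2 CollectI exI[of _ m] exI[of _ 0]) simp
    ultimately have "m \<in> expo_pow V (up_adjoin V U (keys r)) 1"
      by (simp only: expo_pow_one)
    then have "of_nat 1 * m \<in> expo_pow V (up_adjoin V U (keys r)) 1"
      by (simp only: of_nat_1 mult_1)
    then show "m \<in> expo_sat V (up_adjoin V U (keys r))" using m rV unfolding expo_sat_def by blast
  qed simp
  \<comment> \<open>minimality makes every element of \<open>Y\<close> a vertex\<close>
  then obtain Y where Y: "?P Y" "\<And>Y'. ?P Y' \<Longrightarrow> card Y \<le> card Y'"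
    using exE[OF ex_has_least_nat[where P = ?P and m = card, OF Pr]] by metis
  show ?thesis
  proof (cases "Y = {}")
    case True then show ?thesis using Y(1) by (simp add: up_adjoin_def)
  next
    case False
    then obtain v where v: "v \<in> Y" by auto
    let ?Z = "up_adjoin V U (Y - {v})"
    have YV: "Y \<subseteq> expo V" using Y(1) rV by auto
    have Z: "up_closed V ?Z" using YV by (intro up_closed_up_adjoin U) auto
    have eqZ: "up_adjoin V ?Z {v} = up_adjoin V U Y" using v by (auto simp: up_adjoin_def)
    have "v \<notin> expo_sat V ?Z"
    proof
      assume "v \<in> expo_sat V ?Z"
      from expo_sat_adjoin[OF Z this] have "?P (Y - {v})" using Y(1) unfolding eqZ by auto
      then have "card Y \<le> card (Y - {v})" by (rule Y(2))
      moreover have "finite Y" using Y(1) finite_subset[OF _ finite_keys] by blast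
      ultimately show False using v by (metis card_Diff1_less leD)
    qed
    then have False
      using integral_extreme_exponent[OF Z _ _ _ _ _ a eq, where v = v] Y(1) v YV
      unfolding eqZ by (auto simp: up_adjoin_def)
    then show ?thesis ..
  qed
qed

subsection \<open>The determinant trick\<close>

text \<open>Sums of terms \<open>b r\<^sup>k\<close> with \<open>b \<in> J\<^sub>i\<close>, \<open>i \<ge> 1\<close> and \<open>i + k = n\<close>, that is, everything that may
  follow \<open>r\<^sup>n\<close> in an equation of integral dependence of degree \<open>n\<close>.\<close>
inductive_set lower_terms :: "(nat \<Rightarrow> 'a::comm_ring_1 set) \<Rightarrow> 'a \<Rightarrow> nat \<Rightarrow> 'a set" for J r n where
  zero: "0 \<in> lower_terms J r n"
| mono: "b \<in> J i \<Longrightarrow> i \<ge> 1 \<Longrightarrow> i + k = n \<Longrightarrow> b * r ^ k \<in> lower_terms J r n"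
| add: "x \<in> lower_terms J r n \<Longrightarrow> y \<in> lower_terms J r n \<Longrightarrow> x + y \<in> lower_terms J r n"

lemma lower_terms_sum: "(\<And>i. i \<in> S \<Longrightarrow> f i \<in> lower_terms J r n) \<Longrightarrow> sum f S \<in> lower_terms J r n"
  by (induction S rule: infinite_finite_induct) (auto intro: lower_terms.intros)

lemma lower_terms_mult_self: "x \<in> lower_terms J r n \<Longrightarrow> r * x \<in> lower_terms J r (Suc n)"
proof (induction rule: lower_terms.induct)
  case (mono b i k)
  then have "b * r ^ Suc k \<in> lower_terms J r (Suc n)" by (intro lower_terms.mono[of b J i]) auto
  then show ?case by (simp add: algebra_simps)
qed (auto simp: distrib_left intro: lower_terms.intros)

lemma lower_terms_mult:
  assumes J: "\<And>i b c. b \<in> J 1 \<Longrightarrow> c \<in> J i \<Longrightarrow> b * c \<in> J (Suc i)" and b: "b \<in> J 1"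
  shows "x \<in> lower_terms J r n \<Longrightarrow> b * x \<in> lower_terms J r (Suc n)"
proof (induction rule: lower_terms.induct)
  case (mono c i k)
  then have "(b * c) * r ^ k \<in> lower_terms J r (Suc n)" using J b by (intro lower_terms.mono[of _ J "Suc i"]) auto
  then show ?case by (simp add: algebra_simps)
qed (auto simp: distrib_left intro: lower_terms.intros)

lemma lower_terms_uminus:
  assumes J: "\<And>i c. c \<in> J i \<Longrightarrow> - c \<in> J i"
  shows "x \<in> lower_terms J r n \<Longrightarrow> - x \<in> lower_terms J r n"
proof (induction rule: lower_terms.induct)
  case (mono c i k)
  then have "(- c) * r ^ k \<in> lower_terms J r n" using J by (intro lower_terms.mono[of _ J i]) auto
  then show ?case by simp
next
  case (add x y)
  then have "- x + - y \<in> lower_terms J r n" by (intro lower_terms.add)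
  then show ?case by simp
qed (auto intro: lower_terms.intros)

text \<open>Expands a product of matrix entries of \<open>r \<cdot> 1 - B\<close>, where \<open>c\<close> marks the diagonal entries:
  only a product of diagonal entries contributes \<open>r\<^sup>n\<close>.\<close>
lemma prod_lower_terms:
  assumes J: "\<And>i b c. b \<in> J 1 \<Longrightarrow> c \<in> J i \<Longrightarrow> b * c \<in> J (Suc i)" "\<And>i c. c \<in> J i \<Longrightarrow> - c \<in> J i"
    and "finite S" and b: "\<And>i. i \<in> S \<Longrightarrow> b i \<in> J 1"
  shows "(\<Prod>i\<in>S. (if c i then r else 0) - b i) - (if \<forall>i\<in>S. c i then r ^ card S else 0)
    \<in> lower_terms J r (card S)"
  using \<open>finite S\<close> b
proof (induction S rule: finite_induct)
  case empty then show ?case by (auto intro: lower_terms.intros)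
next
  case (insert i S)
  let ?P = "\<Prod>i\<in>S. (if c i then r else 0) - b i" and ?L = "if \<forall>i\<in>S. c i then r ^ card S else 0"
  have IH: "?P - ?L \<in> lower_terms J r (card S)" using insert by auto
  have mb: "- b i \<in> J 1" using insert.prems J(2) by auto
  have 1: "(- b i) * (?P - ?L) \<in> lower_terms J r (Suc (card S))"
    by (rule lower_terms_mult[of J, OF J(1) mb IH])
  have 2: "(- b i) * ?L \<in> lower_terms J r (Suc (card S))"
    using lower_terms.mono[of "- b i" J 1 "card S" "Suc (card S)" r, OF mb] by (auto intro: lower_terms.zero)
  have 3: "(if c i then r else 0) * (?P - ?L) \<in> lower_terms J r (Suc (card S))"
    using lower_terms_mult_self[OF IH] by (auto intro: lower_terms.zero)
  have "(\<Prod>i\<in>insert i S. (if c i then r else 0) - b i) - (if \<forall>i\<in>insert i S. c i then r ^ card (insert i S) else 0)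
    = (if c i then r else 0) * (?P - ?L) + ((- b i) * (?P - ?L) + (- b i) * ?L)"
    using insert.hyps by (auto simp: algebra_simps)
  also have "\<dots> \<in> lower_terms J r (Suc (card S))" by (intro lower_terms.add 1 2 3)
  finally show ?case using insert.hyps by simp
qed

lemma lower_terms_explicit:
  assumes J: "\<And>i. 0 \<in> J i" "\<And>i b c. b \<in> J i \<Longrightarrow> c \<in> J i \<Longrightarrow> b + c \<in> J i"
  shows "x \<in> lower_terms J r n \<Longrightarrow> \<exists>a. (\<forall>i\<in>{1..n}. a i \<in> J i) \<and> x = (\<Sum>i=1..n. a i * r ^ (n - i))"
proof (induction rule: lower_terms.induct)
  case zero then show ?case using J by (intro exI[of _ "\<lambda>_. 0"]) auto
next
  case (mono b i k)
  then have "(\<Sum>j=1..n. (if j = i then b else 0) * r ^ (n - j)) = (\<Sum>j=1..n. if j = i then b * r ^ k else 0)"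
    by (intro sum.cong) auto
  also have "\<dots> = b * r ^ k" using mono by auto
  finally show ?case using mono J by (intro exI[of _ "\<lambda>j. if j = i then b else 0"]) auto
next
  case (add x y)
  then obtain a a' where "\<forall>i\<in>{1..n}. a i \<in> J i" "x = (\<Sum>i=1..n. a i * r ^ (n - i))"
     "\<forall>i\<in>{1..n}. a' i \<in> J i" "y = (\<Sum>i=1..n. a' i * r ^ (n - i))" by auto
  then show ?case using J by (intro exI[of _ "\<lambda>i. a i + a' i"]) (auto simp: distrib_right sum.distrib)
qed

text \<open>The vector of the \<open>g\<^sub>i\<close> is a nonzero element of the kernel of \<open>r \<cdot> 1 - B\<close> over a domain. So the
  determinant of this matrix vanishes, and its expansion is an equation of integral dependence.\<close>
lemma determinant_trick:
  fixes r :: "'a::idom"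
  assumes J: "\<And>i. 0 \<in> J i" "\<And>i b c. b \<in> J i \<Longrightarrow> c \<in> J i \<Longrightarrow> b + c \<in> J i"
    "\<And>i b c. b \<in> J 1 \<Longrightarrow> c \<in> J i \<Longrightarrow> b * c \<in> J (Suc i)" "\<And>i c. c \<in> J i \<Longrightarrow> - c \<in> J i"
    and n: "n > 0" and g: "\<And>i. i < n \<Longrightarrow> g i \<noteq> 0"
    and b: "\<And>i j. i < n \<Longrightarrow> j < n \<Longrightarrow> b i j \<in> J 1"
    and rg: "\<And>i. i < n \<Longrightarrow> r * g i = (\<Sum>j<n. b i j * g j)"
  shows "\<exists>a. (\<forall>i\<in>{1..n}. a i \<in> J i) \<and> r ^ n + (\<Sum>i=1..n. a i * r ^ (n - i)) = 0"
proof -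
  define A where "A = mat n n (\<lambda>(i,j). (if i = j then r else 0) - b i j)"
  define v where "v = vec n g"
  have A: "A \<in> carrier_mat n n" by (simp add: A_def)
  have v: "v \<in> carrier_vec n" by (simp add: v_def)
  have v0: "v \<noteq> 0\<^sub>v n"
  proof
    assume "v = 0\<^sub>v n"
    then have "v $ 0 = 0" using n by simp
    then show False using g[OF n] n by (simp add: v_def)
  qed
  have Av: "A *\<^sub>v v = 0\<^sub>v n"
  proof (rule eq_vecI)
    fix i assume i: "i < dim_vec (0\<^sub>v n :: 'a vec)"
    have "(A *\<^sub>v v) $ i = (\<Sum>j<n. ((if i = j then r else 0) - b i j) * g j)"
      using i by (simp add: A_def v_def scalar_prod_def atLeast0LessThan)
    also have "\<dots> = (\<Sum>j<n. if i = j then r * g j else 0) - (\<Sum>j<n. b i j * g j)"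
      by (simp add: left_diff_distrib sum_subtractf if_distrib[of "\<lambda>x. x * _"] cong: if_cong)
    also have "\<dots> = r * g i - (\<Sum>j<n. b i j * g j)" using i by simp
    also have "\<dots> = 0" using rg i by simp
    finally show "(A *\<^sub>v v) $ i = 0\<^sub>v n $ i" using i by simp
  qed (simp add: A_def)
  have det0: "det A = 0" using det_0_iff_vec_prod_zero[OF A] v v0 Av by blast
  let ?Perm = "{p. p permutes {0..<n}}"
  let ?L = "\<lambda>p. if \<forall>i\<in>{0..<n}. p i = i then r ^ n else 0"
  have pterm: "(\<Prod>i = 0..<n. A $$ (i, p i)) - ?L p \<in> lower_terms J r n" if p: "p \<in> ?Perm" for p
  proof -
    have pi: "p i < n" if "i < n" for i using p that by (metis atLeastLessThan_iff mem_Collect_eq permutes_in_image zero_le)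
    have "(\<Prod>i = 0..<n. A $$ (i, p i)) = (\<Prod>i\<in>{0..<n}. (if p i = i then r else 0) - b i (p i))"
      using pi by (intro prod.cong) (auto simp: A_def)
    moreover have "(\<Prod>i\<in>{0..<n}. (if p i = i then r else 0) - b i (p i)) -
        (if \<forall>i\<in>{0..<n}. p i = i then r ^ card {0..<n} else 0) \<in> lower_terms J r (card {0..<n})"
      by (intro prod_lower_terms J(3,4)) (use b pi in \<open>simp_all only: atLeastLessThan_iff finite_atLeastLessThan\<close>)
    ultimately show ?thesis by (simp only: card_atLeastLessThan minus_nat.diff_0)
  qed
  have finP: "finite ?Perm" by (rule finite_permutations) simp
  have "(\<Sum>p\<in>?Perm. signof p * ((\<Prod>i = 0..<n. A $$ (i, p i)) - ?L p)) \<in> lower_terms J r n"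
  proof (rule lower_terms_sum)
    fix p assume p: "p \<in> ?Perm"
    have "(signof p :: 'a) = 1 \<or> (signof p :: 'a) = -1" by (simp add: sign_def)
    then show "signof p * ((\<Prod>i = 0..<n. A $$ (i, p i)) - ?L p) \<in> lower_terms J r n"
    proof
      assume "(signof p :: 'a) = 1" then show ?thesis using pterm[OF p] by simp
    next
      assume s: "(signof p :: 'a) = -1"
      have "- ((\<Prod>i = 0..<n. A $$ (i, p i)) - ?L p) \<in> lower_terms J r n"
        by (rule lower_terms_uminus[of J, OF J(4) pterm[OF p]])
      then show ?thesis unfolding s by simp
    qed
  qed
  also have "(\<Sum>p\<in>?Perm. signof p * ((\<Prod>i = 0..<n. A $$ (i, p i)) - ?L p))
      = det A - (\<Sum>p\<in>?Perm. signof p * ?L p)"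
    by (simp only: right_diff_distrib sum_subtractf det_def'[OF A])
  also have "(\<Sum>p\<in>?Perm. signof p * ?L p) = (\<Sum>p\<in>?Perm. if p = id then r ^ n else 0)"
  proof (rule sum.cong)
    fix p assume p: "p \<in> ?Perm"
    have "(\<forall>i\<in>{0..<n}. p i = i) \<longleftrightarrow> p = id"
      using p permutes_not_in[of p "{0..<n}"] by fastforce
    then show "signof p * ?L p = (if p = id then r ^ n else 0)" by (simp add: sign_id)
  qed simp
  also have "\<dots> = r ^ n" using finP permutes_id[of "{0..<n}"] by simp
  finally have "- (r ^ n) \<in> lower_terms J r n" using det0 by simp
  from lower_terms_explicit[of J, OF J(1,2) this]
  obtain a where "\<forall>i\<in>{1..n}. a i \<in> J i" "- (r ^ n) = (\<Sum>i=1..n. a i * r ^ (n - i))" by blast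
  then show ?thesis by (metis add.right_inverse)
qed

subsection \<open>Polynomials supported on the saturation are integral\<close>

lemma expo_pow_list:
  assumes U: "up_closed V U"
  shows "x \<in> expo_pow V U n \<Longrightarrow> \<exists>xs u. length xs = n \<and> set xs \<subseteq> U \<and> u \<in> expo V \<and> x = sum_list xs + u"
proof (induction n arbitrary: x)
  case 0 then show ?case by auto
next
  case (Suc n)
  then obtain a b where ab: "x = a + b" "a \<in> expo_pow V U n" "b \<in> U" by auto
  from Suc.IH[OF ab(2)] obtain xs u where "length xs = n" "set xs \<subseteq> U" "u \<in> expo V" "a = sum_list xs + u"
    by auto
  then show ?case using ab by (intro exI[of _ "b # xs"] exI[of _ u]) (auto simp: algebra_simps)
qed

lemma pigeonhole_list:
  assumes "finite M" "set L \<subseteq> M" "length L > card M * K"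
  shows "\<exists>m\<in>M. count (mset L) m > K"
proof (rule ccontr)
  assume "\<not> ?thesis"
  then have le: "\<And>m. m \<in> M \<Longrightarrow> count (mset L) m \<le> K" by (auto simp: not_less)
  have "length L = (\<Sum>m\<in>set L. count (mset L) m)"
    by (metis size_mset size_multiset_overloaded_eq set_mset_mset)
  also have "\<dots> \<le> (\<Sum>m\<in>M. count (mset L) m)" using assms(1,2) by (intro sum_mono2) auto
  also have "\<dots> \<le> card M * K" using sum_bounded_above[of M "count (mset L)" K] le by simp
  finally show False using assms(3) by simp
qed

text \<open>A sum of more than \<open>|M| K\<close> elements of \<open>M\<close> contains some \<open>m\<close> at least \<open>K\<close> times, and \<open>K m\<close> can be
  exchanged for \<open>K\<close> elements of \<open>A\<close>. In terms of ideals, with \<open>J\<close> generated by \<open>A\<close> and \<open>L\<close> by \<open>A \<union> M\<close>,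
  this is \<open>L\<^bsup>N+1\<^esup> = J L\<^sup>N\<close> for \<open>N = |M| K\<close>.\<close>
lemma exchange_step:
  fixes M :: "(nat \<Rightarrow>\<^sub>0 nat) set"
  assumes M: "finite M" and K: "K \<ge> 1"
    and xs: "\<And>m. m \<in> M \<Longrightarrow> length (xs m) = K \<and> set (xs m) \<subseteq> A \<and> w m \<in> expo V \<and> of_nat K * m = sum_list (xs m) + w m"
    and L: "set L \<subseteq> A \<union> M" "length L = Suc (card M * K)"
  shows "\<exists>a\<in>A. \<exists>L' u. sum_list L = a + u + sum_list L' \<and> set L' \<subseteq> A \<union> M \<and> length L' = card M * K \<and> u \<in> expo V"
proof (cases "\<exists>a\<in>A. a \<in> set L")
  case True
  then obtain a where a: "a \<in> A" "a \<in> set L" by auto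
  show ?thesis
  proof (intro bexI[OF _ a(1)] exI[of _ "remove1 a L"] exI[of _ 0] conjI)
    show "sum_list L = a + 0 + sum_list (remove1 a L)" using sum_list_map_remove1[OF a(2), of id] by simp
    show "set (remove1 a L) \<subseteq> A \<union> M" using L(1) set_remove1_subset[of a L] by blast
    show "length (remove1 a L) = card M * K" using a(2) L(2) by (simp add: length_remove1)
  qed simp
next
  case False
  then have LM: "set L \<subseteq> M" using L(1) by auto
  then obtain m where m: "m \<in> M" "count (mset L) m > K - 1"
  proof -
    have "card M * (K - 1) \<le> card M * K" by simp
    then have "length L > card M * (K - 1)" using L(2) by linarith
    from pigeonhole_list[OF M LM this] that show ?thesis by blast
  qed
  then have "K \<le> count (mset L) m" by simp
  then have "replicate_mset K m \<subseteq># mset L" by (simp add: count_le_replicate_mset_subset_eq)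
  then obtain X where X: "mset L = replicate_mset K m + X" by (metis subset_mset.le_iff_add)
  obtain R where R: "mset R = X" using ex_mset by blast
  have sumL: "sum_list L = of_nat K * m + sum_list R"
  proof -
    have "sum_mset (replicate_mset j m) = of_nat j * m" for j
      by (induction j) (simp_all add: algebra_simps)
    then show ?thesis by (simp flip: sum_mset_sum_list add: X R)
  qed
  obtain a ys where ay: "xs m = a # ys" using xs[OF m(1)] K by (cases "xs m") auto
  have lenR: "length R + K = Suc (card M * K)"
  proof -
    have "size (mset L) = K + size (mset R)" by (simp add: X R)
    then show ?thesis using L(2) by simp
  qed
  have RM: "set R \<subseteq> M"
  proof -
    have "set_mset (mset R) \<subseteq> set_mset (mset L)" unfolding X R by auto
    then show ?thesis using LM by simp
  qed
  show ?thesis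
  proof (rule bexI[of _ a], intro exI[of _ "ys @ R"] exI[of _ "w m"] conjI)
    show "sum_list L = a + w m + sum_list (ys @ R)"
      using sumL xs[OF m(1)] ay by (simp add: algebra_simps)
    show "set (ys @ R) \<subseteq> A \<union> M" using RM xs[OF m(1)] ay by auto
    show "length (ys @ R) = card M * K" using lenR xs[OF m(1)] ay by auto
    show "w m \<in> expo V" using xs[OF m(1)] by simp
    show "a \<in> A" using xs[OF m(1)] ay by auto
  qed
qed

text \<open>Let \<open>L\<close> be generated by monomials of \<open>J\<close> and the monomials of \<open>r\<close>. Since \<open>r L\<^sup>N \<subseteq> J L\<^sup>N\<close> for large
  \<open>N\<close>, the determinant trick applies to the monomial generators of \<open>L\<^sup>N\<close>.\<close>
lemma keys_sat_imp_integral: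
  fixes r :: "'k::field mpoly"
  assumes U: "up_closed V U" and r: "keys r \<subseteq> expo_sat V U"
  shows "\<exists>n>0. \<exists>a. (\<forall>i\<in>{1..n}. a i \<in> mspan (expo_pow V U i)) \<and> r ^ n + (\<Sum>i = 1..n. a i * r ^ (n - i)) = 0"
proof -
  let ?M = "keys r"
  obtain K where K: "K \<ge> 1" "\<And>m. m \<in> ?M \<Longrightarrow> of_nat K * m \<in> expo_pow V U K"
    using expo_sat_common[OF U finite_keys r] by auto
  have "\<forall>m. \<exists>xs w. m \<in> ?M \<longrightarrow> length xs = K \<and> set xs \<subseteq> U \<and> w \<in> expo V \<and> of_nat K * m = sum_list xs + w"
    using expo_pow_list[OF U K(2)] by blast
  then obtain xs w where xs: "\<And>m. m \<in> ?M \<Longrightarrow> length (xs m) = K \<and> set (xs m) \<subseteq> U \<and> w m \<in> expo V \<and> of_nat K * m = sum_list (xs m) + w m"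
    by metis
  define A where "A = (\<Union>m\<in>?M. set (xs m))"
  have A: "finite A" "A \<subseteq> U" using xs by (auto simp: A_def)
  define N where "N = card ?M * K"
  define G where "G = sum_list ` {L. set L \<subseteq> A \<union> ?M \<and> length L = N}"
  have finG: "finite G" unfolding G_def
    by (intro finite_imageI finite_lists_length_eq) (use A in auto)
  have "\<exists>p. fst p \<in> U \<and> snd p \<in> G \<and> m + g = fst p + snd p" if m: "m \<in> ?M" and g: "g \<in> G" for m g
  proof -
    obtain L where L: "set L \<subseteq> A \<union> ?M" "length L = N" "g = sum_list L" using g by (auto simp: G_def)
    have xs': "length (xs m) = K \<and> set (xs m) \<subseteq> A \<and> w m \<in> expo V \<and> of_nat K * m = sum_list (xs m) + w m"
      if "m \<in> ?M" for m using xs[OF that] that by (auto simp: A_def)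
    have "\<exists>a\<in>A. \<exists>L' u. sum_list (m # L) = a + u + sum_list L' \<and> set L' \<subseteq> A \<union> ?M \<and> length L' = card ?M * K \<and> u \<in> expo V"
      by (rule exchange_step[OF finite_keys K(1) xs']) (use L m in \<open>auto simp: N_def\<close>)
    then obtain a L' u where "a \<in> A" "sum_list (m # L) = a + u + sum_list L'" "set L' \<subseteq> A \<union> ?M"
      "length L' = N" "u \<in> expo V" unfolding N_def by blast
    moreover from this have "a + u \<in> U" using up_closedD[OF U, of a u] A by auto
    ultimately show ?thesis using L(3) by (intro exI[of _ "(a + u, sum_list L')"]) (auto simp: G_def)
  qed
  then obtain f where f: "\<And>m g. m \<in> ?M \<Longrightarrow> g \<in> G \<Longrightarrow> fst (f m g) \<in> U \<and> snd (f m g) \<in> G \<and> m + g = fst (f m g) + snd (f m g)"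
    by metis
  obtain gs where gs: "set gs = G" "distinct gs" using finite_distinct_list[OF finG] by auto
  let ?n = "length gs"
  show ?thesis
  proof (cases "r = 0")
    case True
    then show ?thesis by (intro exI[of _ 1] conjI exI[of _ "\<lambda>_. 0"]) auto
  next
    case False
    then obtain m0 where m0: "m0 \<in> ?M" by (metis keys_zero poly_mapping_eqI in_keys_iff lookup_zero)
    have "sum_list (replicate N m0) \<in> G" unfolding G_def using m0 by (intro imageI) auto
    then have n0: "?n > 0" using gs(1) by (cases gs) auto
    \<comment> \<open>The pair \<open>f m g\<close> splits \<open>m + g\<close> into an exponent of the ideal and a generator. Column \<open>j\<close> of
      the matrix collects the terms of \<open>r\<close> for which this generator is the \<open>j\<close>-th one.\<close>
    define b :: "nat \<Rightarrow> nat \<Rightarrow> 'k mpoly" where "b i j = (\<Sum>m\<in>?M. if snd (f m (gs ! i)) = gs ! j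
        then single (fst (f m (gs ! i))) (lookup r m) else 0)" for i j
    have giG: "gs ! i \<in> G" if "i < ?n" for i using that gs(1) by (metis nth_mem)
    have U1: "expo_pow V U 1 = U" by (rule expo_pow_one[OF U])
    have "\<exists>a. (\<forall>i\<in>{1..?n}. a i \<in> mspan (expo_pow V U i)) \<and> r ^ ?n + (\<Sum>i=1..?n. a i * r ^ (?n - i)) = 0"
    proof (rule determinant_trick[where g = "\<lambda>i. mpoly_monom (gs ! i)" and b = b])
      fix i show "0 \<in> mspan (expo_pow V U i)" by simp
    next
      fix i and c d :: "'k mpoly" assume "c \<in> mspan (expo_pow V U i)" "d \<in> mspan (expo_pow V U i)"
      then show "c + d \<in> mspan (expo_pow V U i)" by (rule mspan_add)
    next
      fix i and c d :: "'k mpoly" assume "c \<in> mspan (expo_pow V U 1)" "d \<in> mspan (expo_pow V U i)"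
      then show "c * d \<in> mspan (expo_pow V U (Suc i))"
        by (rule mspan_mult) (metis expo_pow_add[OF U] plus_1_eq_Suc)
    next
      fix i and c :: "'k mpoly" assume "c \<in> mspan (expo_pow V U i)"
      then show "- c \<in> mspan (expo_pow V U i)" by (rule mspan_uminus)
    next
      show "0 < ?n" by (rule n0)
    next
      fix i show "mpoly_monom (gs ! i) \<noteq> (0 :: 'k mpoly)"
        by (metis keys_zero keys_single mpoly_monom_def one_neq_zero insert_not_empty)
    next
      fix i j assume ij: "i < ?n" "j < ?n"
      show "b i j \<in> mspan (expo_pow V U 1)" unfolding b_def U1
        using f giG[OF ij(1)] by (intro mspan_sum) (auto intro: single_in_mspan)
    next
      fix i assume i: "i < ?n"
      have "r * mpoly_monom (gs ! i) = (\<Sum>m\<in>?M. single m (lookup r m)) * mpoly_monom (gs ! i)"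
        by (simp add: sum_single_lookup)
      also have "\<dots> = (\<Sum>m\<in>?M. single (m + gs ! i) (lookup r m))"
        by (simp add: sum_distrib_right mpoly_monom_def mult_single)
      also have "\<dots> = (\<Sum>m\<in>?M. \<Sum>j<?n. (if snd (f m (gs ! i)) = gs ! j
        then single (fst (f m (gs ! i))) (lookup r m) else 0) * mpoly_monom (gs ! j))"
      proof (rule sum.cong)
        fix m assume m: "m \<in> ?M"
        note fm = f[OF m giG[OF i]]
        obtain j0 where j0: "j0 < ?n" "snd (f m (gs ! i)) = gs ! j0"
          using fm gs(1) by (metis in_set_conv_nth)
        have iff: "snd (f m (gs ! i)) = gs ! j \<longleftrightarrow> j = j0" if "j < ?n" for j
          using that j0 gs(2) by (metis nth_eq_iff_index_eq)
        have "(\<Sum>j<?n. (if snd (f m (gs ! i)) = gs ! j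
            then single (fst (f m (gs ! i))) (lookup r m) else 0) * mpoly_monom (gs ! j))
          = (\<Sum>j<?n. if j = j0 then single (m + gs ! i) (lookup r m) else 0)"
          using fm j0 by (intro sum.cong) (auto simp: iff mpoly_monom_def mult_single)
        then show "single (m + gs ! i) (lookup r m) = (\<Sum>j<?n. (if snd (f m (gs ! i)) = gs ! j
            then single (fst (f m (gs ! i))) (lookup r m) else 0) * mpoly_monom (gs ! j))"
          using j0(1) by simp
      qed simp
      also have "\<dots> = (\<Sum>j<?n. b i j * mpoly_monom (gs ! j))"
        unfolding b_def by (subst sum.swap) (simp only: sum_distrib_right)
      finally show "r * mpoly_monom (gs ! i) = (\<Sum>j<?n. b i j * mpoly_monom (gs ! j))" .
    qed
    then show ?thesis using n0 by blast
  qed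
qed

theorem integral_closure_mspan:
  assumes U: "up_closed V U"
  shows "integral_closure (mpoly_ring V) (mspan U) = (mspan (expo_sat V U) :: 'k::field mpoly set)"
proof -
  have eqn: "r [^]\<^bsub>mpoly_ring V\<^esub> n \<oplus>\<^bsub>mpoly_ring V\<^esub> (\<Oplus>\<^bsub>mpoly_ring V\<^esub>i\<in>{1..n}. a i \<otimes>\<^bsub>mpoly_ring V\<^esub> r [^]\<^bsub>mpoly_ring V\<^esub> (n - i))
      = r ^ n + (\<Sum>i = 1..n. a i * r ^ (n - i))"
    if "r \<in> mspan (expo V)" "\<forall>i\<in>{1..n}. a i \<in> mspan (expo_pow V U i)" for r :: "'k mpoly" and n :: nat and a
  proof -
    have "a i * r ^ (n - i) \<in> mspan (expo V)" if i: "i \<in> {1..n}" for i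
    proof (rule mspan_mult_carrier)
      have "expo_pow V U i \<subseteq> expo V" using up_closed_sub[OF up_closed_expo_pow[OF U]] by blast
      then show "a i \<in> mspan (expo V)" using \<open>\<forall>i\<in>{1..n}. _ i\<close> i mspan_mono by blast
      show "r ^ (n - i) \<in> mspan (expo V)" by (rule mspan_power) fact
    qed
    then have "finsum (mpoly_ring V) (\<lambda>i. a i * r ^ (n - i)) {1..n} = (\<Sum>i = 1..n. a i * r ^ (n - i))"
      by (intro finsum_mpoly_ring) blast+
    then show ?thesis by (simp only: nat_pow_mpoly_ring mpoly_ring_simps)
  qed
  show ?thesis
  proof (intro equalityI subsetI)
    fix r :: "'k mpoly" assume "r \<in> integral_closure (mpoly_ring V) (mspan U)"
    then obtain n a where r: "r \<in> mspan (expo V)" "\<forall>i\<in>{1..n}. a i \<in> mspan (expo_pow V U i)"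
      "r [^]\<^bsub>mpoly_ring V\<^esub> n \<oplus>\<^bsub>mpoly_ring V\<^esub> (\<Oplus>\<^bsub>mpoly_ring V\<^esub>i\<in>{1..n}. a i \<otimes>\<^bsub>mpoly_ring V\<^esub> r [^]\<^bsub>mpoly_ring V\<^esub> (n - i)) = 0"
      unfolding integral_closure_def ideal_pow_mspan[OF U] by auto
    then have "r ^ n + (\<Sum>i = 1..n. a i * r ^ (n - i)) = 0" using eqn by simp
    then show "r \<in> mspan (expo_sat V U)"
      using integral_imp_keys_sat[OF U r(1), of n a] r(2) by (auto simp: mspan_def)
  next
    fix r :: "'k mpoly" assume r: "r \<in> mspan (expo_sat V U)"
    then have rV: "r \<in> mspan (expo V)" by (auto simp: mspan_def expo_sat_def)
    obtain n a where na: "n > 0" "\<forall>i\<in>{1..n}. a i \<in> mspan (expo_pow V U i)" "r ^ n + (\<Sum>i = 1..n. a i * r ^ (n - i)) = 0"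
      using keys_sat_imp_integral[OF U, of r] r by (auto simp: mspan_def)
    have "r [^]\<^bsub>mpoly_ring V\<^esub> n \<oplus>\<^bsub>mpoly_ring V\<^esub> (\<Oplus>\<^bsub>mpoly_ring V\<^esub>i\<in>{1..n}. a i \<otimes>\<^bsub>mpoly_ring V\<^esub> r [^]\<^bsub>mpoly_ring V\<^esub> (n - i)) = \<zero>\<^bsub>mpoly_ring V\<^esub>"
      unfolding eqn[OF rV na(2)] na(3) by simp
    then show "r \<in> integral_closure (mpoly_ring V) (mspan U)"
      unfolding integral_closure_def ideal_pow_mspan[OF U] using rV na(1,2)
      by (intro CollectI conjI exI[of _ n] exI[of _ a]) simp_all
  qed
qed

section \<open>Pure powers in zero dimensional monomial ideals\<close>

lemma primeideal_quotient:
  assumes "cring R" "ideal J R" "primeideal P R" "J \<subseteq> P"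
  shows "primeideal ((\<lambda>x. J +>\<^bsub>R\<^esub> x) ` P) (R Quot J)"
    and "\<And>x. x \<in> carrier R \<Longrightarrow> J +>\<^bsub>R\<^esub> x \<in> (\<lambda>x. J +>\<^bsub>R\<^esub> x) ` P \<longleftrightarrow> x \<in> P"
proof -
  let ?\<pi> = "\<lambda>x. J +>\<^bsub>R\<^esub> x"
  interpret cring R by fact
  interpret J: ideal J R by fact
  interpret P: primeideal P R by fact
  interpret Q: cring "R Quot J" by (rule J.quotient_is_cring[OF assms(1)])
  note Pa = ideal.axioms(1)[OF P.is_ideal]
  note car = quotient_coset_simps(1)[OF assms(1,2)] and qa = quotient_coset_simps(2)[OF assms(1,2)]
    and qm = quotient_coset_simps(3)[OF assms(1,2)] and q0 = quotient_coset_simps(4)[OF assms(1,2)]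
  have Pc: "\<And>x. x \<in> P \<Longrightarrow> x \<in> carrier R" by (rule P.a_Hcarr)
  have iff: "J +>\<^bsub>R\<^esub> x \<in> ?\<pi> ` P \<longleftrightarrow> x \<in> P" if x: "x \<in> carrier R" for x
  proof
    assume "J +>\<^bsub>R\<^esub> x \<in> ?\<pi> ` P"
    then obtain y where y: "y \<in> P" "J +>\<^bsub>R\<^esub> x = J +>\<^bsub>R\<^esub> y" by auto
    then have "x \<in> J +>\<^bsub>R\<^esub> y" using J.a_rcos_self[OF x] by simp
    then obtain j where "j \<in> J" "x = j \<oplus>\<^bsub>R\<^esub> y" by (auto simp: a_r_coset_def')
    then show "x \<in> P" using y(1) assms(4) additive_subgroup.a_closed[OF Pa] by blast
  qed auto
  show "\<And>x. x \<in> carrier R \<Longrightarrow> J +>\<^bsub>R\<^esub> x \<in> ?\<pi> ` P \<longleftrightarrow> x \<in> P" by (rule iff)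
  show "primeideal (?\<pi> ` P) (R Quot J)"
  proof (rule primeidealI)
    show "ideal (?\<pi> ` P) (R Quot J)"
    proof (rule idealI)
      show "ring (R Quot J)" by (rule Q.ring_axioms)
      show "subgroup (?\<pi> ` P) (add_monoid (R Quot J))"
      proof (rule Q.add.subgroupI)
        show "?\<pi> ` P \<subseteq> carrier (R Quot J)" unfolding car using Pc by auto
        show "?\<pi> ` P \<noteq> {}" using additive_subgroup.zero_closed[OF Pa] by blast
        fix X Y assume "X \<in> ?\<pi> ` P"
        then obtain x where x: "x \<in> P" "X = J +>\<^bsub>R\<^esub> x" by auto
        have mx: "\<ominus>\<^bsub>R\<^esub> x \<in> P" using x(1) by (rule additive_subgroup.a_inv_closed[OF Pa])
        have "\<ominus>\<^bsub>R Quot J\<^esub> X = J +>\<^bsub>R\<^esub> (\<ominus>\<^bsub>R\<^esub> x)"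
          by (rule Q.minus_equality) (use x mx qa car Pc q0 l_neg in auto)
        then show "\<ominus>\<^bsub>R Quot J\<^esub> X \<in> ?\<pi> ` P" using mx by auto
        assume "Y \<in> ?\<pi> ` P"
        then obtain y where y: "y \<in> P" "Y = J +>\<^bsub>R\<^esub> y" by auto
        show "X \<oplus>\<^bsub>R Quot J\<^esub> Y \<in> ?\<pi> ` P"
          using x y qa Pc additive_subgroup.a_closed[OF Pa, of x y] by auto
      qed
      fix X Y assume "X \<in> ?\<pi> ` P" "Y \<in> carrier (R Quot J)"
      then obtain x y where xy: "x \<in> P" "X = J +>\<^bsub>R\<^esub> x" "y \<in> carrier R" "Y = J +>\<^bsub>R\<^esub> y"
        unfolding car by auto
      show "Y \<otimes>\<^bsub>R Quot J\<^esub> X \<in> ?\<pi> ` P"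
        using xy qm Pc P.I_l_closed[of x y] by auto
      show "X \<otimes>\<^bsub>R Quot J\<^esub> Y \<in> ?\<pi> ` P"
        using xy qm Pc P.I_r_closed[of x y] by auto
    qed
    show "cring (R Quot J)" by (rule Q.is_cring)
    obtain z where "z \<in> carrier R" "z \<notin> P" using P.I_notcarr Pc by blast
    then have "J +>\<^bsub>R\<^esub> z \<in> carrier (R Quot J)" "J +>\<^bsub>R\<^esub> z \<notin> ?\<pi> ` P"
      unfolding iff[OF \<open>z \<in> carrier R\<close>] car by simp_all
    then show "carrier (R Quot J) \<noteq> ?\<pi> ` P" by metis
    fix X Y assume "X \<in> carrier (R Quot J)" "Y \<in> carrier (R Quot J)"
      and XY: "X \<otimes>\<^bsub>R Quot J\<^esub> Y \<in> ?\<pi> ` P"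
    then obtain x y where xy: "x \<in> carrier R" "X = J +>\<^bsub>R\<^esub> x" "y \<in> carrier R" "Y = J +>\<^bsub>R\<^esub> y"
      unfolding car by auto
    then have "x \<otimes>\<^bsub>R\<^esub> y \<in> P" using XY iff qm by auto
    then have "x \<in> P \<or> y \<in> P" using P.I_prime xy by blast
    then show "X \<in> ?\<pi> ` P \<or> Y \<in> ?\<pi> ` P" using xy by auto
  qed
qed

text \<open>The exponents of the prime ideal generated by the variables in \<open>V - W\<close>.\<close>
definition outside_expo :: "nat set \<Rightarrow> nat set \<Rightarrow> (nat \<Rightarrow>\<^sub>0 nat) set" where
  "outside_expo V W = {m \<in> expo V. \<not> keys m \<subseteq> W}"

lemma up_closed_outside_expo: "up_closed V (outside_expo V W)"
  by (auto simp: up_closed_def outside_expo_def keys_add_nat)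

lemma outside_expo_split:
  fixes p :: "'k::field mpoly"
  assumes "p \<in> mspan (expo V)"
  shows "\<exists>p1 p2. p = p1 + p2 \<and> p1 \<in> mspan (expo W) \<and> p2 \<in> mspan (outside_expo V W)"
proof -
  let ?s = "\<lambda>m. single m (lookup p m)"
  have "p = (\<Sum>m\<in>keys p. ?s m)" by (simp add: sum_single_lookup)
  also have "\<dots> = (\<Sum>m\<in>keys p \<inter> expo W. ?s m) + (\<Sum>m\<in>keys p - expo W. ?s m)"
    by (subst sum.Int_Diff[of _ _ "expo W"]) auto
  finally have "p = (\<Sum>m\<in>keys p \<inter> expo W. ?s m) + (\<Sum>m\<in>keys p - expo W. ?s m)" .
  moreover have "(\<Sum>m\<in>keys p \<inter> expo W. ?s m) \<in> mspan (expo W)"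
    by (intro mspan_sum single_in_mspan) auto
  moreover have "(\<Sum>m\<in>keys p - expo W. ?s m) \<in> mspan (outside_expo V W)"
    using assms by (intro mspan_sum single_in_mspan) (auto simp: mspan_def outside_expo_def)
  ultimately show ?thesis by blast
qed

lemma expo_outside_disjoint: "p \<in> mspan (expo W) \<Longrightarrow> p \<in> mspan (outside_expo V W) \<Longrightarrow> p = 0"
  unfolding mspan_def outside_expo_def keys_eq_empty[symmetric] by blast

text \<open>Modulo this ideal, a polynomial is represented by its part in the variables of \<open>W\<close>, and
  polynomial rings are domains.\<close>
lemma primeideal_outside_expo:
  assumes "W \<subseteq> V"
  shows "primeideal (mspan (outside_expo V W) :: 'k::field mpoly set) (mpoly_ring V)"
proof (rule primeidealI)
  let ?P = "mspan (outside_expo V W) :: 'k mpoly set"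
  show I: "ideal ?P (mpoly_ring V)" by (rule ideal_mspan[OF up_closed_outside_expo])
  show "cring (mpoly_ring V)" by (rule cring_mpoly_ring)
  have "(1 :: 'k mpoly) \<in> mspan (expo V)" "(1 :: 'k mpoly) \<notin> ?P"
    by (auto simp: mspan_def outside_expo_def)
  then show "carrier (mpoly_ring V) \<noteq> ?P" by auto
  fix p q :: "'k mpoly"
  assume "p \<in> carrier (mpoly_ring V)" "q \<in> carrier (mpoly_ring V)" and pq: "p \<otimes>\<^bsub>mpoly_ring V\<^esub> q \<in> ?P"
  then have pV: "p \<in> mspan (expo V)" and qV: "q \<in> mspan (expo V)" by auto
  obtain p1 p2 where p: "p = p1 + p2" "p1 \<in> mspan (expo W)" "p2 \<in> ?P"
    using outside_expo_split[OF pV] by blast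
  obtain q1 q2 where q: "q = q1 + q2" "q1 \<in> mspan (expo W)" "q2 \<in> ?P"
    using outside_expo_split[OF qV] by blast
  have WV: "mspan (expo W) \<subseteq> (mspan (expo V) :: 'k mpoly set)" using assms by (intro mspan_mono) auto
  have "p1 * q2 \<in> ?P" using ideal.I_l_closed[OF I, of q2 p1] q(3) p(2) WV by auto
  moreover have "p2 * q \<in> ?P" using ideal.I_r_closed[OF I, of p2 q] p(3) qV by auto
  ultimately have "p1 * q2 + p2 * q \<in> ?P" by (rule mspan_add)
  then have "- (p1 * q2 + p2 * q) \<in> ?P" by (rule mspan_uminus)
  then have "p * q + - (p1 * q2 + p2 * q) \<in> ?P" using pq by (intro mspan_add) auto
  also have "p * q + - (p1 * q2 + p2 * q) = p1 * q1" by (simp add: p(1) q(1) algebra_simps)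
  finally have "p1 * q1 = 0"
    using mspan_mult_carrier[OF p(2) q(2)] by (rule expo_outside_disjoint[rotated])
  then have "p1 = 0 \<or> q1 = 0" by simp
  then show "p \<in> ?P \<or> q \<in> ?P" using p q by auto
qed

text \<open>If \<open>I\<close> contains no power of \<open>x\<^sub>j\<close>, it lies in the prime ideal generated by the other variables,
  which is properly contained in the ideal of all variables. So the quotient has dimension at least
  one.\<close>
lemma krull_dim_zero_pure_powers:
  assumes U: "up_closed V U" and j: "j \<in> V"
    and dim: "krull_dim (mpoly_ring V Quot (mspan U :: 'k::field mpoly set)) = 0"
  shows "\<exists>b. single j b \<in> U"
proof (rule ccontr)
  assume no: "\<nexists>b. single j b \<in> U"
  let ?R = "mpoly_ring V :: 'k mpoly ring" and ?J = "mspan U :: 'k mpoly set"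
  let ?P = "\<lambda>W. mspan (outside_expo V W) :: 'k mpoly set"
  let ?Q = "\<lambda>W. (\<lambda>x. ?J +>\<^bsub>?R\<^esub> x) ` ?P W"
  have Uj: "U \<subseteq> outside_expo V {j}"
  proof
    fix m assume m: "m \<in> U"
    have "\<not> keys m \<subseteq> {j}"
    proof
      assume k: "keys m \<subseteq> {j}"
      have "m = single j (lookup m j)"
        by (rule poly_mapping_eqI) (use k in \<open>auto simp: lookup_single when_def subset_iff in_keys_iff\<close>)
      then show False using no m by metis
    qed
    then show "m \<in> outside_expo V {j}" using up_closed_sub[OF U m] by (simp add: outside_expo_def)
  qed
  have sub: "outside_expo V {j} \<subseteq> outside_expo V {}" by (auto simp: outside_expo_def)
  have JP: "?J \<subseteq> ?P {j}" "?J \<subseteq> ?P {}" using Uj sub by (auto intro!: mspan_mono simp: mspan_def)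
  note cr = cring_mpoly_ring[of V] and idJ = ideal_mspan[OF U]
  have pr1: "primeideal (?Q {j}) (?R Quot ?J)"
    using j by (intro primeideal_quotient(1) cr idJ primeideal_outside_expo JP) auto
  have pr2: "primeideal (?Q {}) (?R Quot ?J)"
    by (intro primeideal_quotient(1) cr idJ primeideal_outside_expo JP) auto
  have psub: "?Q {j} \<subset> ?Q {}"
  proof
    show "?Q {j} \<subseteq> ?Q {}" by (intro image_mono mspan_mono sub)
    let ?x = "single (single j 1) 1 :: 'k mpoly"
    have x: "?x \<in> carrier ?R" "?x \<in> ?P {}" "?x \<notin> ?P {j}"
      using j by (auto simp: single_in_mspan_iff outside_expo_def simp flip: keys_eq_empty)
    have "?J +>\<^bsub>?R\<^esub> ?x \<notin> ?Q {j}"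
      using primeideal_quotient(2)[OF cr idJ primeideal_outside_expo JP(1) x(1)] j x(3) by auto
    then show "?Q {j} \<noteq> ?Q {}" using x(2) by auto
  qed
  \<comment> \<open>a chain of two primes\<close>
  have "1 \<in> {n::nat. \<exists>P. (\<forall>i\<le>n. primeideal (P i) (?R Quot ?J)) \<and> (\<forall>i<n. P i \<subset> P (Suc i))}"
    by (intro CollectI exI[of _ "\<lambda>i. if i = 0 then ?Q {j} else ?Q {}"]) (use pr1 pr2 psub in auto)
  then have "ereal (real 1) \<le> krull_dim (?R Quot ?J)"
    unfolding krull_dim_def by (rule SUP_upper)
  then show False using dim by simp
qed

section \<open>Eventually polynomial functions and Hilbert functions\<close>

definition eventually_poly :: "(nat \<Rightarrow> nat) \<Rightarrow> bool" where
  "eventually_poly h \<longleftrightarrow> (\<exists>q::rat poly. \<forall>\<^sub>F n in sequentially. of_nat (h n) = poly q (of_nat n))"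

lemma eventually_poly_cong:
  assumes "eventually_poly g" "\<forall>\<^sub>F n in sequentially. h n = g n" shows "eventually_poly h"
proof -
  obtain q where "\<forall>\<^sub>F n in sequentially. of_nat (g n) = poly q (of_nat n :: rat)"
    using assms(1) unfolding eventually_poly_def by blast
  with assms(2) have "\<forall>\<^sub>F n in sequentially. of_nat (h n) = poly q (of_nat n :: rat)"
    by eventually_elim simp
  then show ?thesis unfolding eventually_poly_def by blast
qed

lemma eventually_poly_zero: "eventually_poly (\<lambda>_. 0)"
  unfolding eventually_poly_def by (intro exI[of _ 0]) simp

lemma eventually_poly_add:
  assumes "eventually_poly g" "eventually_poly h" shows "eventually_poly (\<lambda>n. g n + h n)"
proof -
  obtain q r where "\<forall>\<^sub>F n in sequentially. of_nat (g n) = poly q (of_nat n :: rat)"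
    "\<forall>\<^sub>F n in sequentially. of_nat (h n) = poly r (of_nat n :: rat)"
    using assms unfolding eventually_poly_def by blast
  then have "\<forall>\<^sub>F n in sequentially. of_nat (g n + h n) = poly (q + r) (of_nat n :: rat)"
    by eventually_elim simp
  then show ?thesis unfolding eventually_poly_def by blast
qed

lemma eventually_poly_sum:
  assumes "\<And>i. i \<in> S \<Longrightarrow> eventually_poly (h i)" shows "eventually_poly (\<lambda>n. \<Sum>i\<in>S. h i n)"
  using assms by (induction S rule: infinite_finite_induct) (auto intro: eventually_poly_zero eventually_poly_add)

lemma eventually_poly_shift:
  assumes "eventually_poly h" shows "eventually_poly (\<lambda>n. h (n - j))"
proof -
  obtain q where "\<forall>\<^sub>F n in sequentially. of_nat (h n) = poly q (of_nat n :: rat)"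
    using assms unfolding eventually_poly_def by blast
  then obtain N where N: "\<And>n. n \<ge> N \<Longrightarrow> of_nat (h n) = poly q (of_nat n :: rat)"
    by (auto simp: eventually_sequentially)
  have "of_nat (h (n - j)) = poly (q \<circ>\<^sub>p [:- of_nat j, 1:]) (of_nat n :: rat)" if "n \<ge> N + j" for n
    using that N[of "n - j"] by (simp add: poly_pcompose of_nat_diff)
  then show ?thesis unfolding eventually_poly_def eventually_sequentially by blast
qed

text \<open>Solve the binomial expansion of \<open>(x + 1)\<^bsup>n+1\<^esup> - x\<^bsup>n+1\<^esup>\<close> for \<open>x\<^sup>n\<close>.\<close>
lemma antidifference_power: "\<exists>Q::rat poly. \<forall>x. poly Q (x + 1) - poly Q x = x ^ n"
proof (induction n rule: less_induct)
  case (less n)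
  then have "\<forall>i. \<exists>Q::rat poly. i < n \<longrightarrow> (\<forall>x. poly Q (x + 1) - poly Q x = x ^ i)" by blast
  then obtain Q :: "nat \<Rightarrow> rat poly" where Q: "\<And>i x. i < n \<Longrightarrow> poly (Q i) (x + 1) - poly (Q i) x = x ^ i" by metis
  define P where "P = Polynomial.smult (1 / of_nat (Suc n)) (Polynomial.monom 1 (Suc n) - (\<Sum>i<n. Polynomial.smult (of_nat (Suc n choose i)) (Q i)))"
  have "poly P (x + 1) - poly P x = x ^ n" for x
  proof -
    have "(x + 1) ^ Suc n = (\<Sum>i\<le>Suc n. of_nat (Suc n choose i) * x ^ i)"
      by (subst binomial_ring) simp
    also have "\<dots> = (\<Sum>i<n. of_nat (Suc n choose i) * x ^ i) + of_nat (Suc n) * x ^ n + x ^ Suc n"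
      by (simp add: lessThan_Suc_atMost[symmetric] del: binomial_Suc_Suc)
    finally have b: "(x + 1) ^ Suc n - x ^ Suc n - (\<Sum>i<n. of_nat (Suc n choose i) * x ^ i) = of_nat (Suc n) * x ^ n"
      by simp
    have "poly P (x + 1) - poly P x
      = ((x + 1) ^ Suc n - x ^ Suc n - (\<Sum>i<n. of_nat (Suc n choose i) * (poly (Q i) (x + 1) - poly (Q i) x))) / of_nat (Suc n)"
      unfolding P_def
      by (simp add: poly_monom poly_sum diff_divide_distrib right_diff_distrib sum_subtractf
          del: binomial_Suc_Suc power_Suc of_nat_Suc)
    also have "\<dots> = ((x + 1) ^ Suc n - x ^ Suc n - (\<Sum>i<n. of_nat (Suc n choose i) * x ^ i)) / of_nat (Suc n)"
      using Q by simp
    also have "\<dots> = x ^ n" unfolding b by (simp del: of_nat_Suc)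
    finally show ?thesis .
  qed
  then show ?case by blast
qed

lemma antidifference_poly: "\<exists>Q::rat poly. \<forall>x. poly Q (x + 1) - poly Q x = poly q x"
proof -
  obtain Q :: "nat \<Rightarrow> rat poly" where Q: "\<And>i x. poly (Q i) (x + 1) - poly (Q i) x = x ^ i"
    using antidifference_power by metis
  have "poly (\<Sum>i\<le>Polynomial.degree q. Polynomial.smult (poly.coeff q i) (Q i)) (x + 1) - poly (\<Sum>i\<le>Polynomial.degree q. Polynomial.smult (poly.coeff q i) (Q i)) x
      = (\<Sum>i\<le>Polynomial.degree q. poly.coeff q i * (poly (Q i) (x + 1) - poly (Q i) x))" for x
    by (simp add: poly_sum right_diff_distrib sum_subtractf)
  then show ?thesis unfolding Q poly_altdef[of q] by blast
qed

lemma eventually_poly_cumsum: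
  assumes "eventually_poly h" shows "eventually_poly (\<lambda>n. \<Sum>k<n. h k)"
proof -
  obtain q where "\<forall>\<^sub>F n in sequentially. of_nat (h n) = poly q (of_nat n :: rat)"
    using assms unfolding eventually_poly_def by blast
  then obtain N where N: "\<And>n. n \<ge> N \<Longrightarrow> of_nat (h n) = poly q (of_nat n :: rat)"
    by (auto simp: eventually_sequentially)
  obtain Q where Q: "\<And>x. poly Q (x + 1) - poly Q x = poly q x" using antidifference_poly by blast
  define c where "c = of_nat (\<Sum>k<N. h k) - poly Q (of_nat N)"
  have "of_nat (\<Sum>k<n. h k) = poly (Q + [:c:]) (of_nat n)" if "n \<ge> N" for n
    using that
  proof (induction n rule: dec_induct)
    case base then show ?case by (simp add: c_def)
  next
    case (step n)
    have "poly Q (of_nat (Suc n)) = poly Q (of_nat n) + poly q (of_nat n)"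
      using Q[of "of_nat n"] by (simp add: algebra_simps)
    then show ?case using step N[of n] by simp
  qed
  then show ?thesis unfolding eventually_poly_def eventually_sequentially by blast
qed

definition down_closed :: "nat list set \<Rightarrow> bool" where
  "down_closed D \<longleftrightarrow> (\<forall>x\<in>D. \<forall>y. list_all2 (\<le>) y x \<longrightarrow> y \<in> D)"

text \<open>Subsets of \<open>\<nat>\<^sup>r\<close> are represented by lists of length \<open>r\<close>, which allows induction on \<open>r\<close> by fixing the
  first coordinate.\<close>
definition slice :: "nat \<Rightarrow> nat list set \<Rightarrow> nat list set" where
  "slice j D = {y. j # y \<in> D}"

lemma down_closed_slice: "down_closed D \<Longrightarrow> down_closed (slice j D)"
  by (auto simp: down_closed_def slice_def)

lemma slice_antimono: "down_closed D \<Longrightarrow> i \<le> j \<Longrightarrow> slice j D \<subseteq> slice i D"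
  unfolding down_closed_def slice_def
  by (auto simp: list_all2_refl elim!: ballE[of _ _ "_ # _"])

text \<open>Dickson's lemma. The diagonal slices stabilize by induction, which controls all slices with large
  first coordinate; each of the finitely many others stabilizes by induction as well.\<close>
lemma down_closed_chain_stable:
  fixes D :: "nat \<Rightarrow> nat list set"
  assumes "\<And>i. D i \<subseteq> {x. length x = r}" "\<And>i. down_closed (D i)" "antimono D"
  shows "\<exists>N. \<forall>i\<ge>N. D i = D N"
  using assms
proof (induction r arbitrary: D)
  case 0
  show ?case
  proof (cases "\<exists>N. D N = {}")
    case True
    then obtain N where "D N = {}" by auto
    then show ?thesis using antimonoD[OF 0(3)] by (intro exI[of _ N]) auto
  next
    case False
    then have "D i = {[]}" for i using 0(1)[of i] by auto
    then show ?thesis by auto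
  qed
next
  case (Suc r)
  have sl: "slice j (D i) \<subseteq> {x. length x = r}" "down_closed (slice j (D i))" for i j
    using Suc.prems(1)[of i] down_closed_slice[OF Suc.prems(2)] by (auto simp: slice_def)
  have mono: "slice j (D i) \<subseteq> slice j' (D i')" if "i' \<le> i" "j' \<le> j" for i j i' j'
  proof -
    have "slice j (D i) \<subseteq> slice j (D i')" using antimonoD[OF Suc.prems(3) that(1)] by (auto simp: slice_def)
    also have "\<dots> \<subseteq> slice j' (D i')" using slice_antimono[OF Suc.prems(2) that(2)] .
    finally show ?thesis .
  qed
  have "\<exists>N. \<forall>i\<ge>N. slice i (D i) = slice N (D N)"
    by (rule Suc.IH[of "\<lambda>i. slice i (D i)"]) (use sl mono in \<open>auto simp: antimono_def\<close>)
  then obtain N0 where N0: "\<And>i. i \<ge> N0 \<Longrightarrow> slice i (D i) = slice N0 (D N0)" by blast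
  have "\<exists>N. \<forall>i\<ge>N. slice j (D i) = slice j (D N)" for j
    by (rule Suc.IH[of "\<lambda>i. slice j (D i)"]) (use sl mono in \<open>auto simp: antimono_def\<close>)
  then obtain Nf where Nf: "\<And>j i. i \<ge> Nf j \<Longrightarrow> slice j (D i) = slice j (D (Nf j))" by metis
  define N where "N = N0 + (\<Sum>j<N0. Nf j)"
  have NN: "Nf j \<le> N" if "j < N0" for j
    using member_le_sum[of j "{..<N0}" Nf] that by (simp add: N_def)
  have "D i = D N" if i: "i \<ge> N" for i
  proof
    show "D i \<subseteq> D N" using antimonoD[OF Suc.prems(3) i] .
    show "D N \<subseteq> D i"
    proof
      fix x assume x: "x \<in> D N"
      then obtain j y where xj: "x = j # y" using Suc.prems(1)[of N] by (cases x) auto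
      have y: "y \<in> slice j (D N)" using x xj by (simp add: slice_def)
      have "y \<in> slice j (D i)"
      proof (cases "j < N0")
        case True
        then show ?thesis using Nf[OF NN] Nf[of j i] NN[of j] i y by auto
      next
        case False
        then have "y \<in> slice N0 (D N0)" using y mono[of N0 N N0 j] by (auto simp: N_def)
        also have "slice N0 (D N0) = slice (max i j) (D (max i j))" using N0[of "max i j"] False by simp
        also have "\<dots> \<subseteq> slice j (D i)" by (rule mono) auto
        finally show ?thesis .
      qed
      then show "x \<in> D i" using xj by (simp add: slice_def)
    qed
  qed
  then show ?case by blast
qed

fun weight :: "nat list \<Rightarrow> nat list \<Rightarrow> nat" where
  "weight (w # ws) (c # cs) = w * c + weight ws cs"
| "weight _ _ = 0"

text \<open>Induction on the number of variables: by Dickson's lemma the slices of \<open>D\<close> are eventually constant.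
  If the first variable has weight \<open>0\<close>, finiteness forces the constant slice to be empty and the count is a
  finite sum of Hilbert functions. If it has weight \<open>1\<close>, the constant slice contributes a cumulative
  sum.\<close>
theorem hilbert_function_down_closed:
  assumes "set ws \<subseteq> {0, 1}" "D \<subseteq> {x. length x = length ws}" "down_closed D"
    "\<And>n. finite {x \<in> D. weight ws x = n}"
  shows "eventually_poly (\<lambda>n. card {x \<in> D. weight ws x = n})"
  using assms
proof (induction ws arbitrary: D)
  case Nil
  have "\<forall>\<^sub>F n in sequentially. card {x \<in> D. weight [] x = n} = 0"
    unfolding eventually_sequentially
  proof (intro exI[of _ 1] allI impI)
    fix n :: nat assume "1 \<le> n"
    then have "{x \<in> D. weight [] x = n} = {}" by auto
    then show "card {x \<in> D. weight [] x = n} = 0" by (simp only: card.empty)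
  qed
  then show ?case by (rule eventually_poly_cong[OF eventually_poly_zero])
next
  case (Cons w ws)
  define S where "S j = slice j D" for j
  define H where "H j n = card {y \<in> S j. weight ws y = n}" for j n
  have sub: "S j \<subseteq> {x. length x = length ws}" for j using Cons.prems(2) by (auto simp: S_def slice_def)
  have down: "down_closed (S j)" for j unfolding S_def by (rule down_closed_slice[OF Cons.prems(3)])
  have anti: "antimono S" unfolding S_def antimono_def using slice_antimono[OF Cons.prems(3)] by blast
  have fin: "finite {y \<in> S j. weight ws y = n}" for j n
  proof (rule finite_imageD)
    show "inj_on ((#) j) {y \<in> S j. weight ws y = n}" by auto
    show "finite ((#) j ` {y \<in> S j. weight ws y = n})"
      by (rule finite_subset[OF _ Cons.prems(4)[of "w * j + n"]]) (auto simp: S_def slice_def)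
  qed
  have H: "eventually_poly (H j)" for j
    unfolding H_def by (rule Cons.IH[OF _ sub down fin]) (use Cons.prems(1) in auto)
  obtain N where N: "\<And>i. i \<ge> N \<Longrightarrow> S i = S N"
    using down_closed_chain_stable[OF sub down anti] by blast
  have cardU: "card (\<Union>j\<in>J. (#) j ` {y \<in> S j. weight ws y = f j}) = (\<Sum>j\<in>J. H j (f j))" if "finite J" for J f
  proof -
    have "card (\<Union>j\<in>J. (#) j ` {y \<in> S j. weight ws y = f j}) = (\<Sum>j\<in>J. card ((#) j ` {y \<in> S j. weight ws y = f j}))"
      by (rule card_UN_disjoint) (use that fin in auto)
    also have "\<dots> = (\<Sum>j\<in>J. H j (f j))" by (intro sum.cong) (auto simp: H_def card_image)
    finally show ?thesis .
  qed
  have Dc: "x \<in> D \<longleftrightarrow> (\<exists>j y. x = j # y \<and> y \<in> S j)" for x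
    using Cons.prems(2) by (cases x) (auto simp: S_def slice_def)
  have "w = 0 \<or> w = 1" using Cons.prems(1) by auto
  then show ?case
  proof
    assume w: "w = 0"
    have "S N = {}"
    proof (rule ccontr)
      assume "S N \<noteq> {}"
      then obtain y where y: "y \<in> S N" by auto
      have yS: "y \<in> S j" if "j \<ge> N" for j unfolding N[OF that] by (rule y)
      have "(\<lambda>j. j # y) ` {N..} \<subseteq> {x \<in> D. weight (w # ws) x = weight ws y}" using yS w by (auto simp: Dc)
      then have "finite ((\<lambda>j. j # y) ` {N..})" using Cons.prems(4) finite_subset by blast
      moreover have "inj_on (\<lambda>j. j # y) {N..}" by (simp add: inj_on_def)
      ultimately have "finite {N..}" by (rule finite_imageD)
      then show False using infinite_Ici by blast
    qed
    then have empty: "S j = {}" if "j \<ge> N" for j using N[OF that] by simp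
    have "{x \<in> D. weight (w # ws) x = n} = (\<Union>j\<in>{..<N}. (#) j ` {y \<in> S j. weight ws y = n})" for n
    proof (intro equalityI subsetI)
      fix x assume "x \<in> {x \<in> D. weight (w # ws) x = n}"
      then obtain j y where "x = j # y" "y \<in> S j" "weight ws y = n" using w by (auto simp: Dc)
      moreover from this empty have "j < N" by (metis empty_iff not_le)
      ultimately show "x \<in> (\<Union>j\<in>{..<N}. (#) j ` {y \<in> S j. weight ws y = n})" by auto
    qed (auto simp: Dc w)
    then have "card {x \<in> D. weight (w # ws) x = n} = (\<Sum>j<N. H j n)" for n
      using cardU[of "{..<N}" "\<lambda>_. n"] by simp
    then show ?thesis using H by (simp add: eventually_poly_sum)
  next
    assume w: "w = 1"
    have "{x \<in> D. weight (w # ws) x = n} = (\<Union>j\<in>{..n}. (#) j ` {y \<in> S j. weight ws y = n - j})" for n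
    proof (intro equalityI subsetI)
      fix x assume "x \<in> {x \<in> D. weight (w # ws) x = n}"
      then obtain j y where "x = j # y" "y \<in> S j" "j + weight ws y = n" using w by (auto simp: Dc)
      then show "x \<in> (\<Union>j\<in>{..n}. (#) j ` {y \<in> S j. weight ws y = n - j})"
        by (intro UN_I[of j] image_eqI[of _ _ y]) auto
    qed (auto simp: Dc w)
    then have c: "card {x \<in> D. weight (w # ws) x = n} = (\<Sum>j\<le>n. H j (n - j))" for n
      using cardU[of "{..n}" "\<lambda>j. n - j"] by simp
    have "eventually_poly (\<lambda>n. (\<Sum>j<N. H j (n - j)) + (\<Sum>k<Suc n - N. H N k))"
    proof (intro eventually_poly_add eventually_poly_sum eventually_poly_shift H)
      have "eventually_poly (\<lambda>n. (\<Sum>k<n. H N k) + H N n)" by (intro eventually_poly_add eventually_poly_cumsum H)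
      then have "eventually_poly (\<lambda>n. \<Sum>k<Suc n. H N k)" by simp
      from eventually_poly_shift[OF this, of N] show "eventually_poly (\<lambda>n. \<Sum>k<Suc n - N. H N k)"
        by (rule eventually_poly_cong) (auto simp: eventually_sequentially Suc_diff_le intro!: exI[of _ N])
    qed
    then show ?thesis
    proof (rule eventually_poly_cong)
      show "\<forall>\<^sub>F n in sequentially. card {x \<in> D. weight (w # ws) x = n} = (\<Sum>j<N. H j (n - j)) + (\<Sum>k<Suc n - N. H N k)"
        unfolding eventually_sequentially
      proof (intro exI[of _ N] allI impI)
        fix n assume n: "N \<le> n"
        have "(\<Sum>j\<le>n. H j (n - j)) = (\<Sum>j<N. H j (n - j)) + (\<Sum>j\<in>{N..n}. H j (n - j))"
        proof -
          have "{..n} = {..<N} \<union> {N..n}" using n by auto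
          then show ?thesis by (simp add: sum.union_disjoint ivl_disj_int)
        qed
        also have "(\<Sum>j\<in>{N..n}. H j (n - j)) = (\<Sum>j\<in>{N..n}. H N (n - j))"
          by (intro sum.cong refl) (simp only: H_def N[OF iffD1[OF atLeastAtMost_iff, THEN conjunct1]])
        also have "\<dots> = (\<Sum>k<Suc n - N. H N k)"
          by (rule sum.reindex_bij_witness[of _ "\<lambda>k. n - k" "\<lambda>j. n - j"]) auto
        finally show "card {x \<in> D. weight (w # ws) x = n} = (\<Sum>j<N. H j (n - j)) + (\<Sum>k<Suc n - N. H N k)"
          unfolding c .
      qed
    qed
  qed
qed

text \<open>The lexicographic order on lists of equal length, in a form that suits induction on lists.\<close>
fun lexlt :: "nat list \<Rightarrow> nat list \<Rightarrow> bool" where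
  "lexlt (a # as) (b # bs) \<longleftrightarrow> a < b \<or> a = b \<and> lexlt as bs"
| "lexlt _ _ \<longleftrightarrow> False"

lemma lexlt_total: "length x = length y \<Longrightarrow> x = y \<or> lexlt x y \<or> lexlt y x"
  by (induction x y rule: list_induct2) auto

lemma lexlt_add: "length x = length y \<Longrightarrow> length y = length z \<Longrightarrow> lexlt x y \<Longrightarrow> lexlt (map2 (+) x z) (map2 (+) y z)"
  by (induction x y z rule: list_induct3) auto

lemma lexlt_lex: "length x = length y \<Longrightarrow> lexlt x y \<Longrightarrow> (x, y) \<in> lex less_than"
  by (induction x y rule: list_induct2) auto

lemma lexlt_minimal:
  assumes "x \<in> Q" "Q \<subseteq> {x. length x = r}"
  shows "\<exists>z\<in>Q. \<forall>y\<in>Q. \<not> lexlt y z"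
proof -
  obtain z where "z \<in> Q" "\<And>y. (y, z) \<in> lex less_than \<Longrightarrow> y \<notin> Q"
    using wfE_min[OF wf_lex[OF wf_less_than] assms(1)] by blast
  then show ?thesis using lexlt_lex assms(2) by (metis (mono_tags) mem_Collect_eq subsetD)
qed

fun lin_comb :: "(nat \<Rightarrow>\<^sub>0 nat) list \<Rightarrow> nat list \<Rightarrow> (nat \<Rightarrow>\<^sub>0 nat)" where
  "lin_comb (v # vs) (c # cs) = of_nat c * v + lin_comb vs cs"
| "lin_comb _ _ = 0"

lemma lin_comb_add: "length vs = length x \<Longrightarrow> length x = length y \<Longrightarrow> lin_comb vs (map2 (+) x y) = lin_comb vs x + lin_comb vs y"
  by (induction vs x y rule: list_induct3) (auto simp: algebra_simps)

lemma weight_add: "length vs = length x \<Longrightarrow> length x = length y \<Longrightarrow> weight vs (map2 (+) x y) = weight vs x + weight vs y"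
  by (induction vs x y rule: list_induct3) (auto simp: algebra_simps)

lemma list_le_decompose: "list_all2 (\<le>) y x \<Longrightarrow> \<exists>z. length z = length x \<and> x = map2 (+) y (z :: nat list)"
proof (induction rule: list_all2_induct)
  case (Cons a as b bs)
  then obtain z where "length z = length bs" "bs = map2 (+) as z" by auto
  then show ?case using Cons by (intro exI[of _ "(b - a) # z"]) auto
qed simp

text \<open>Among the representations of an element by the generators, choose the lexicographically least one.
  As the order is compatible with addition, parts of least representations are least, so these
  representations form a down-closed set with the same Hilbert function. This replaces the
  passage to an initial ideal.\<close>
lemma hilbert_function_standard:
  assumes len: "length vs = r" "length ws = r" and ws: "set ws \<subseteq> {0, 1}"
    and rep: "\<And>m n. (m, n) \<in> X \<Longrightarrow> \<exists>c. length c = r \<and> lin_comb vs c = m \<and> weight ws c = n"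
    and down: "\<And>c c'. length c = r \<Longrightarrow> length c' = r \<Longrightarrow>
      (lin_comb vs c + lin_comb vs c', weight ws c + weight ws c') \<in> X \<Longrightarrow> (lin_comb vs c, weight ws c) \<in> X"
    and fin: "\<And>n. finite {m. (m, n) \<in> X}"
  shows "eventually_poly (\<lambda>n. card {m. (m, n) \<in> X})"
proof -
  \<comment> \<open>the least representations\<close>
  define D where "D = {c. length c = r \<and> (lin_comb vs c, weight ws c) \<in> X \<and>
    (\<forall>c'. length c' = r \<and> lin_comb vs c' = lin_comb vs c \<and> weight ws c' = weight ws c \<longrightarrow> \<not> lexlt c' c)}"
  have D: "down_closed D"
    unfolding down_closed_def
  proof (intro ballI allI impI)
    fix x y assume x: "x \<in> D" and yx: "list_all2 (\<le>) y x"
    obtain z where z: "length z = length x" "x = map2 (+) y z" using list_le_decompose[OF yx] by auto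
    have lx: "length x = r" using x by (simp add: D_def)
    have ly: "length y = r" using list_all2_lengthD[OF yx] lx by simp
    have lz: "length z = r" using z lx by simp
    have cx: "lin_comb vs x = lin_comb vs y + lin_comb vs z" "weight ws x = weight ws y + weight ws z"
      unfolding z(2) using lin_comb_add weight_add ly lz len by simp_all
    have "(lin_comb vs y, weight ws y) \<in> X" using down[OF ly lz] x cx by (simp add: D_def)
    moreover have "\<not> lexlt c y" if c: "length c = r" "lin_comb vs c = lin_comb vs y" "weight ws c = weight ws y" for c
    proof
      assume "lexlt c y"
      then have "lexlt (map2 (+) c z) x" unfolding z(2) using lexlt_add c(1) ly lz by simp
      moreover have "lin_comb vs (map2 (+) c z) = lin_comb vs x" "weight ws (map2 (+) c z) = weight ws x"
        using lin_comb_add weight_add c lz len cx by simp_all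
      moreover have "length (map2 (+) c z) = r" using c lz by simp
      ultimately show False using x unfolding D_def by blast
    qed
    ultimately show "y \<in> D" using ly by (simp add: D_def)
  qed
  have inj: "inj_on (lin_comb vs) {c \<in> D. weight ws c = n}" for n
  proof (rule inj_onI)
    fix x y assume "x \<in> {c \<in> D. weight ws c = n}" "y \<in> {c \<in> D. weight ws c = n}" "lin_comb vs x = lin_comb vs y"
    then show "x = y" using lexlt_total[of x y] unfolding D_def by auto
  qed
  have img: "lin_comb vs ` {c \<in> D. weight ws c = n} = {m. (m, n) \<in> X}" for n
  proof (intro equalityI subsetI)
    fix m assume m: "m \<in> {m. (m, n) \<in> X}"
    let ?Q = "{c. length c = r \<and> lin_comb vs c = m \<and> weight ws c = n}"
    obtain c where "c \<in> ?Q" using rep m by auto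
    then obtain z where z: "z \<in> ?Q" "\<forall>y\<in>?Q. \<not> lexlt y z"
      using lexlt_minimal[of c ?Q r] by auto
    then have "z \<in> D" using m by (auto simp: D_def)
    then show "m \<in> lin_comb vs ` {c \<in> D. weight ws c = n}" using z(1) by auto
  qed (auto simp: D_def)
  have "card {m. (m, n) \<in> X} = card {c \<in> D. weight ws c = n}" for n
    unfolding img[symmetric] by (rule card_image[OF inj])
  moreover have "eventually_poly (\<lambda>n. card {c \<in> D. weight ws c = n})"
  proof (rule hilbert_function_down_closed[OF ws _ D])
    show "D \<subseteq> {x. length x = length ws}" using len by (auto simp: D_def)
    show "finite {x \<in> D. weight ws x = n}" for n
      using fin[of n] unfolding img[symmetric] by (rule finite_imageD[OF _ inj])
  qed
  ultimately show ?thesis by simp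
qed

subsection \<open>Powers of a zero dimensional monomial ideal\<close>

definition expo_box :: "nat set \<Rightarrow> nat \<Rightarrow> (nat \<Rightarrow>\<^sub>0 nat) set" where
  "expo_box V M = {m. keys m \<subseteq> V \<and> (\<forall>j. lookup m j \<le> M)}"

lemma expo_box_empty [simp]: "expo_box {} M = {0}"
  by (auto simp: expo_box_def)

text \<open>Points of a box over \<open>insert j V\<close> correspond to pairs of a point over \<open>V\<close> and a coordinate at \<open>j\<close>.
  Lattice point sums are thereby computed one variable at a time.\<close>
lemma bij_expo_box_insert:
  assumes "j \<notin> V"
  shows "bij_betw (\<lambda>(z, k). z + single j k) (expo_box V M \<times> {..M}) (expo_box (insert j V) M)"
proof (rule bij_betw_byWitness[where f' = "\<lambda>m. (m - single j (lookup m j), lookup m j)"])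
  have z0: "lookup z j = 0" if "z \<in> expo_box V M" for z
    using that assms by (auto simp: expo_box_def in_keys_iff)
  show "\<forall>a\<in>expo_box V M \<times> {..M}.
      (\<lambda>m. (m - single j (lookup m j), lookup m j)) ((\<lambda>(z, k). z + single j k) a) = a"
    using z0 by (auto simp: lookup_add)
  show "\<forall>m\<in>expo_box (insert j V) M. (\<lambda>(z, k). z + single j k)
      ((\<lambda>m. (m - single j (lookup m j), lookup m j)) m) = m"
    by (auto intro!: poly_mapping_eqI simp: lookup_add lookup_minus lookup_single when_def)
  show "(\<lambda>(z, k). z + single j k) ` (expo_box V M \<times> {..M}) \<subseteq> expo_box (insert j V) M"
    using z0 by (auto simp: expo_box_def keys_add_nat lookup_add lookup_single when_def split: if_splits)
  show "(\<lambda>m. (m - single j (lookup m j), lookup m j)) ` expo_box (insert j V) M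
      \<subseteq> expo_box V M \<times> {..M}"
  proof (rule image_subsetI)
    fix m assume m: "m \<in> expo_box (insert j V) M"
    have "keys (m - single j (lookup m j)) \<subseteq> keys m - {j}"
      by (auto simp: in_keys_iff lookup_minus lookup_single when_def)
    then have "keys (m - single j (lookup m j)) \<subseteq> V"
      using m by (auto simp: expo_box_def)
    then show "(m - single j (lookup m j), lookup m j) \<in> expo_box V M \<times> {..M}"
      using m by (auto simp: expo_box_def lookup_minus intro: le_trans[OF diff_le_self])
  qed
qed

lemma finite_expo_box: "finite V \<Longrightarrow> finite (expo_box V M)"
proof (induction V rule: finite_induct)
  case (insert j V)
  then show ?case using bij_betw_finite[OF bij_expo_box_insert[OF insert.hyps(2), of M]] by simp
qed simp

lemma card_expo_box: "finite V \<Longrightarrow> card (expo_box V M) = (M + 1) ^ card V"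
proof (induction V rule: finite_induct)
  case (insert j V)
  then show ?case using bij_betw_same_card[OF bij_expo_box_insert[OF insert.hyps(2), of M]]
    by (simp add: card_cartesian_product mult.commute)
qed simp

lemma sum_expo_box_insert:
  assumes "j \<notin> V" "finite V"
  shows "(\<Sum>y\<in>expo_box (insert j V) M. F y) = (\<Sum>z\<in>expo_box V M. \<Sum>k\<le>M. F (z + single j k))"
  using sum.reindex_bij_betw[OF bij_expo_box_insert[OF assms(1), of M], of F, symmetric]
  by (simp add: sum.cartesian_product case_prod_unfold)

lemma expo_pow_pure_power:
  assumes "up_closed V U" "single j b \<in> U"
  shows "single j (b * n) \<in> expo_pow V U n"
proof (induction n)
  case (Suc n)
  have "single j (b * n) + single j b \<in> expo_pow V U (Suc n)" using Suc assms by auto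
  then show ?case by (simp flip: single_add add: add.commute)
qed simp

lemma not_expo_pow_bound:
  assumes U: "up_closed V U" and b: "\<And>j. j \<in> V \<Longrightarrow> single j b \<in> U"
    and m: "m \<in> expo V" "m \<notin> expo_pow V U n"
  shows "j \<in> V \<Longrightarrow> lookup m j < b * n"
proof (rule ccontr)
  assume j: "j \<in> V" and "\<not> lookup m j < b * n"
  then have "m \<in> expo_pow V U n"
    using m(1) by (intro up_closed_le[OF up_closed_expo_pow[OF U] expo_pow_pure_power[OF U b[OF j], of n]])
      (auto simp: lookup_single when_def)
  with m(2) show False by simp
qed

lemma not_expo_pow_box:
  assumes U: "up_closed V U" and b: "\<And>j. j \<in> V \<Longrightarrow> single j b \<in> U"
  shows "expo V - expo_pow V U n \<subseteq> expo_box V (b * n)"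
proof
  fix m assume m: "m \<in> expo V - expo_pow V U n"
  have "lookup m j \<le> b * n" for j
  proof (cases "j \<in> V")
    case True
    then show ?thesis using not_expo_pow_bound[OF U b, of m n j] m by simp
  next
    case False
    then have "j \<notin> keys m" using m by auto
    then show ?thesis by (simp add: in_keys_iff)
  qed
  then show "m \<in> expo_box V (b * n)" using m by (simp add: expo_box_def)
qed

lemma finite_not_expo_pow:
  assumes "up_closed V U" "\<And>j. j \<in> V \<Longrightarrow> single j b \<in> U" "finite V"
  shows "finite (expo V - expo_pow V U n)"
  using not_expo_pow_box[OF assms(1,2)] finite_expo_box[OF assms(3)] finite_subset by blast

text \<open>A finite generating set: if some coordinate of an element exceeds \<open>b\<close>, the element is divisible by a
  pure power.\<close>
definition small_gens :: "nat \<Rightarrow> (nat \<Rightarrow>\<^sub>0 nat) set \<Rightarrow> (nat \<Rightarrow>\<^sub>0 nat) set" where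
  "small_gens b U = {a \<in> U. \<forall>j. lookup a j \<le> b}"

lemma finite_small_gens: "up_closed V U \<Longrightarrow> finite V \<Longrightarrow> finite (small_gens b U)"
  by (rule finite_subset[OF _ finite_expo_box[of V b]]) (auto simp: small_gens_def expo_box_def dest: up_closed_sub)

lemma small_gens_generate:
  assumes U: "up_closed V U" and b: "\<And>j. j \<in> V \<Longrightarrow> single j b \<in> U" and m: "m \<in> U"
  shows "\<exists>a\<in>small_gens b U. \<exists>u\<in>expo V. m = a + u"
proof -
  have mV: "keys m \<subseteq> V" using up_closed_sub[OF U m] .
  have "\<exists>a\<in>small_gens b U. \<forall>j. lookup a j \<le> lookup m j"
  proof (cases "\<exists>j. lookup m j > b")
    case True
    then obtain j where j: "lookup m j > b" by auto
    then have "j \<in> V" using mV by (auto simp: in_keys_iff)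
    then show ?thesis using b j
      by (intro bexI[of _ "single j b"]) (auto simp: small_gens_def lookup_single when_def)
  next
    case False
    then show ?thesis using m by (intro bexI[of _ m]) (auto simp: small_gens_def not_less)
  qed
  then obtain a where a: "a \<in> small_gens b U" "\<And>j. lookup a j \<le> lookup m j" by auto
  have "m = a + (m - a)"
    by (rule poly_mapping_eqI) (use a(2) in \<open>simp add: lookup_add lookup_minus\<close>)
  moreover have "m - a \<in> expo V" using mV by (auto simp: in_keys_iff lookup_minus)
  ultimately show ?thesis using a(1) by blast
qed

lemma lin_comb_unit: "i < length vs \<Longrightarrow> lin_comb vs ((replicate (length vs) 0)[i := 1]) = vs ! i"
proof (induction vs arbitrary: i)
  case (Cons v vs)
  have z: "lin_comb vs (replicate (length vs) 0) = 0" for vs by (induction vs) auto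
  show ?case using Cons by (cases i) (auto simp: z)
qed simp

lemma weight_unit: "i < length ws \<Longrightarrow> weight ws ((replicate (length ws) 0)[i := 1]) = ws ! i"
proof (induction ws arbitrary: i)
  case (Cons v vs)
  have z: "weight vs (replicate (length vs) 0) = 0" for vs by (induction vs) auto
  show ?case using Cons by (cases i) (auto simp: z)
qed simp

lemma lin_comb_in_expo_pow:
  assumes U: "up_closed V U"
  shows "length vs = length ws \<Longrightarrow> length ws = length c \<Longrightarrow> (\<And>i. i < length vs \<Longrightarrow> vs ! i \<in> expo_pow V U (ws ! i))
    \<Longrightarrow> lin_comb vs c \<in> expo_pow V U (weight ws c)"
proof (induction vs ws c rule: list_induct3)
  case (Cons v vs w ws c cs)
  have "lin_comb vs cs \<in> expo_pow V U (weight ws cs)" using Cons.IH Cons.prems[of "Suc _"] by auto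
  moreover have "of_nat c * v \<in> expo_pow V U (c * w)" using Cons.prems[of 0] expo_pow_scale[OF U] by auto
  ultimately show ?case using expo_pow_add[OF U] by (simp add: mult.commute)
qed simp

text \<open>The differences \<open>E\<^sub>n - E\<^bsub>n+1\<^esub>\<close> are the degree \<open>n\<close> part of the associated graded ring, which is generated by the
  variables in degree \<open>0\<close> and the generators of the ideal in degree \<open>1\<close>. Summing their sizes gives
  the length of \<open>R/I\<^sup>n\<close>.\<close>
theorem hilbert_function_expo_pow:
  assumes U: "up_closed V U" and b: "\<And>j. j \<in> V \<Longrightarrow> single j b \<in> U" and V: "finite V"
  shows "eventually_poly (\<lambda>n. card (expo V - expo_pow V U n))"
proof -
  define E where "E = expo_pow V U"
  define X where "X = {(m, n). m \<in> E n \<and> m \<notin> E (Suc n)}"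
  obtain js where js: "set js = V" using finite_list[OF V] by blast
  obtain as where as: "set as = small_gens b U" using finite_list[OF finite_small_gens[OF U V]] by blast
  define vs where "vs = map (\<lambda>j. single j 1) js @ as"
  define ws where "ws = replicate (length js) 0 @ replicate (length as) (1::nat)"
  let ?r = "length vs"
  have lw: "length ws = ?r" by (simp add: vs_def ws_def)
  have gen: "vs ! i \<in> E (ws ! i)" if "i < ?r" for i
  proof (cases "i < length js")
    case True
    then show ?thesis using js nth_mem[of i js] by (auto simp: E_def vs_def ws_def nth_append)
  next
    case False
    then have "vs ! i \<in> small_gens b U" using that as nth_mem[of "i - length js" as] by (auto simp: vs_def nth_append)
    then have "vs ! i \<in> U" by (simp add: small_gens_def)
    moreover have "ws ! i = 1" using False that by (simp add: ws_def vs_def nth_append)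
    ultimately show ?thesis unfolding E_def using expo_pow_one[OF U] by metis
  qed
  have combE: "lin_comb vs c \<in> E (weight ws c)" if "length c = ?r" for c
    unfolding E_def by (rule lin_comb_in_expo_pow[OF U]) (use that lw gen in \<open>auto simp: E_def\<close>)
  \<comment> \<open>\<open>P\<close> is the graded monoid spanned by the generators; it contains every pair of \<open>m \<in> E n\<close> and \<open>n\<close>\<close>
  define P where "P = {(lin_comb vs c, weight ws c) | c. length c = ?r}"
  have P0: "(0, 0) \<in> P"
  proof -
    have "lin_comb vs (replicate (length vs) 0) = 0" for vs by (induction vs) auto
    moreover have "weight ws (replicate (length ws) 0) = 0" for ws by (induction ws) auto
    ultimately show ?thesis unfolding P_def
      by (intro CollectI exI[of _ "replicate ?r 0"]) (metis length_replicate lw)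
  qed
  have Padd: "(m + m', n + n') \<in> P" if "(m, n) \<in> P" "(m', n') \<in> P" for m m' n n'
  proof -
    obtain c c' where "m = lin_comb vs c" "n = weight ws c" "length c = ?r" "m' = lin_comb vs c'" "n' = weight ws c'" "length c' = ?r"
      using \<open>(m, n) \<in> P\<close> \<open>(m', n') \<in> P\<close> unfolding P_def by auto
    then show ?thesis unfolding P_def using lin_comb_add[of vs c c'] weight_add[of ws c c'] lw
      by (intro CollectI exI[of _ "map2 (+) c c'"]) simp
  qed
  have Pgen: "(vs ! i, ws ! i) \<in> P" if "i < ?r" for i
    unfolding P_def using lin_comb_unit[OF that] weight_unit[of i ws] that lw
    by (intro CollectI exI[of _ "(replicate ?r 0)[i := 1]"]) simp
  have Psingle: "(single j k, 0) \<in> P" if "j \<in> V" for j k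
  proof (induction k)
    case 0 then show ?case using P0 by simp
  next
    case (Suc k)
    obtain i where i: "i < length js" "js ! i = j" using \<open>j \<in> V\<close> js by (metis in_set_conv_nth)
    then have "(single j 1, 0) \<in> P" using Pgen[of i] by (simp add: vs_def ws_def nth_append)
    from Padd[OF Suc this] show ?case by (simp flip: single_add)
  qed
  have Pexpo: "(m, 0) \<in> P" if m: "m \<in> expo V" for m
  proof -
    have "(\<Sum>j\<in>S. single j (lookup m j), 0) \<in> P" if "finite S" "S \<subseteq> V" for S
      using that
    proof (induction S rule: finite_induct)
      case (insert j S)
      then have "(\<Sum>j\<in>S. single j (lookup m j), 0) \<in> P" by blast
      from Padd[OF Psingle[of j "lookup m j"] this] insert show ?case by simp
    qed (use P0 in simp)
    from this[of "keys m"] m show ?thesis by (simp add: sum_single_lookup)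
  qed
  have PU: "(m, 1) \<in> P" if m: "m \<in> U" for m
  proof -
    obtain a u where au: "a \<in> small_gens b U" "u \<in> expo V" "m = a + u"
      using small_gens_generate[OF U b m] by blast
    obtain i where i: "i < length as" "as ! i = a" using au(1) as by (metis in_set_conv_nth)
    then have "(a, 1) \<in> P" using Pgen[of "length js + i"] by (simp add: vs_def ws_def nth_append)
    from Padd[OF this Pexpo[OF au(2)]] show ?thesis using au(3) by simp
  qed
  have PE: "(m, n) \<in> P" if "m \<in> E n" for m n
    using that
  proof (induction n arbitrary: m)
    case 0 then show ?case using Pexpo by (simp add: E_def)
  next
    case (Suc n)
    then obtain x y where "m = x + y" "x \<in> E n" "y \<in> U" by (auto simp: E_def)
    then show ?case using Padd[OF Suc.IH PU, of x y] by simp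
  qed
  have Efin: "finite (expo V - E n)" for n unfolding E_def by (rule finite_not_expo_pow[OF U b V])
  have EV: "E n \<subseteq> expo V" for n unfolding E_def using up_closed_sub[OF up_closed_expo_pow[OF U]] by blast
  have Esuc: "E (Suc n) \<subseteq> E n" for n unfolding E_def by (rule expo_pow_antimono[OF U]) simp
  have Xn: "{m. (m, n) \<in> X} = E n - E (Suc n)" for n by (auto simp: X_def)
  have "eventually_poly (\<lambda>n. card {m. (m, n) \<in> X})"
  proof (rule hilbert_function_standard[OF refl lw])
    show "set ws \<subseteq> {0, 1}" by (auto simp: ws_def)
    fix m n assume "(m, n) \<in> X"
    then have "(m, n) \<in> P" using PE by (simp add: X_def)
    then show "\<exists>c. length c = ?r \<and> lin_comb vs c = m \<and> weight ws c = n" unfolding P_def by auto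
  next
    fix c c' assume c: "length c = ?r" "length c' = ?r"
      and X: "(lin_comb vs c + lin_comb vs c', weight ws c + weight ws c') \<in> X"
    have "lin_comb vs c \<notin> E (Suc (weight ws c))"
    proof
      assume "lin_comb vs c \<in> E (Suc (weight ws c))"
      then have "lin_comb vs c + lin_comb vs c' \<in> E (Suc (weight ws c) + weight ws c')"
        using combE[OF c(2)] unfolding E_def by (rule expo_pow_add[OF U])
      then show False using X by (simp add: X_def)
    qed
    then show "(lin_comb vs c, weight ws c) \<in> X" using combE[OF c(1)] by (simp add: X_def)
  next
    fix n show "finite {m. (m, n) \<in> X}" unfolding Xn
      by (rule finite_subset[OF _ Efin[of "Suc n"]]) (use EV in auto)
  qed
  from eventually_poly_cumsum[OF this] have "eventually_poly (\<lambda>n. \<Sum>k<n. card (E k - E (Suc k)))" unfolding Xn .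
  moreover have "card (expo V - E n) = (\<Sum>k<n. card (E k - E (Suc k)))" for n
  proof (induction n)
    case 0 then show ?case by (simp add: E_def)
  next
    case (Suc n)
    have "expo V - E (Suc n) = (expo V - E n) \<union> (E n - E (Suc n))" using EV[of n] Esuc[of n] by auto
    moreover have "finite (E n - E (Suc n))" by (rule finite_subset[OF _ Efin[of "Suc n"]]) (use EV in auto)
    ultimately have "card (expo V - E (Suc n)) = card (expo V - E n) + card (E n - E (Suc n))"
      using Efin[of n] by (subst card_Un_disjoint[symmetric]) auto
    then show ?case using Suc by simp
  qed
  ultimately show ?thesis unfolding E_def by simp
qed

section \<open>Lattice points below the Newton polyhedron\<close>

text \<open>For a midpoint convex sequence the trapezoidal sum with step \<open>1\<close> is at most the one with step \<open>2\<close>. The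
  extra term \<open>\<psi> (2 * M) / 2\<close> makes the induction on \<open>M\<close> work.\<close>
lemma trapezoid_line:
  fixes \<psi> :: "nat \<Rightarrow> real"
  assumes "\<And>k. 2 * \<psi> (2*k+1) \<le> \<psi> (2*k) + \<psi> (2*k+2)"
  shows "(\<Sum>k\<le>2*M. (if k = 0 then 1/2 else 1) * \<psi> k) + \<psi> (2*M) / 2
       \<le> (\<Sum>k\<le>2*M. (if odd k then 0 else if k = 0 then 1 else 2) * \<psi> k)"
proof (induction M)
  case (Suc M)
  have "{..2 * Suc M} = insert (2*M+2) (insert (2*M+1) {..2*M})" by auto
  then show ?case using Suc assms[of M] by simp
qed simp

text \<open>A comparison of weights that holds along every line in a coordinate direction carries over to product
  weights, exchanging one direction after the other.\<close>
lemma sum_box_weight_mono: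
  fixes F :: "(nat \<Rightarrow>\<^sub>0 nat) \<Rightarrow> real"
  assumes "finite V" "\<And>k. \<alpha> k \<ge> 0" "\<And>k. \<beta> k \<ge> 0"
    "\<And>j z. j \<in> V \<Longrightarrow> (\<Sum>k\<le>M. \<alpha> k * F (z + single j k)) \<le> (\<Sum>k\<le>M. \<beta> k * F (z + single j k))"
  shows "(\<Sum>y\<in>expo_box V M. (\<Prod>j\<in>V. \<alpha> (lookup y j)) * F y)
       \<le> (\<Sum>y\<in>expo_box V M. (\<Prod>j\<in>V. \<beta> (lookup y j)) * F y)"
  using assms(1,4)
proof (induction V arbitrary: F rule: finite_induct)
  case (insert j W)
  have split: "(\<Sum>y\<in>expo_box (insert j W) M. (\<Prod>i\<in>insert j W. \<gamma> (lookup y i)) * F y)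
      = (\<Sum>z\<in>expo_box W M. (\<Prod>i\<in>W. \<gamma> (lookup z i)) * (\<Sum>k\<le>M. \<gamma> k * F (z + single j k)))"
    for \<gamma> :: "nat \<Rightarrow> real"
    unfolding sum_expo_box_insert[OF insert.hyps(2,1)] sum_distrib_left
  proof (intro sum.cong refl)
    fix z k assume z: "z \<in> expo_box W M"
    have "(\<Prod>i\<in>W. \<gamma> (lookup (z + single j k) i)) = (\<Prod>i\<in>W. \<gamma> (lookup z i))"
      by (intro prod.cong refl) (use insert.hyps in \<open>auto simp: lookup_add lookup_single when_def\<close>)
    moreover have "lookup z j = 0" using z insert.hyps by (auto simp: expo_box_def in_keys_iff)
    ultimately show "(\<Prod>i\<in>insert j W. \<gamma> (lookup (z + single j k) i)) * F (z + single j k)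
        = (\<Prod>i\<in>W. \<gamma> (lookup z i)) * (\<gamma> k * F (z + single j k))"
      using insert.hyps by (simp add: lookup_add)
  qed
  have "(\<Sum>y\<in>expo_box (insert j W) M. (\<Prod>i\<in>insert j W. \<alpha> (lookup y i)) * F y)
      = (\<Sum>k\<le>M. \<alpha> k * (\<Sum>z\<in>expo_box W M. (\<Prod>i\<in>W. \<alpha> (lookup z i)) * F (z + single j k)))"
    unfolding split sum_distrib_left by (subst sum.swap) (simp only: mult.left_commute)
  also have "\<dots> \<le> (\<Sum>k\<le>M. \<alpha> k * (\<Sum>z\<in>expo_box W M. (\<Prod>i\<in>W. \<beta> (lookup z i)) * F (z + single j k)))"
  proof (rule sum_mono, rule mult_left_mono[OF _ assms(2)])
    fix k
    show "(\<Sum>z\<in>expo_box W M. (\<Prod>i\<in>W. \<alpha> (lookup z i)) * F (z + single j k))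
        \<le> (\<Sum>z\<in>expo_box W M. (\<Prod>i\<in>W. \<beta> (lookup z i)) * F (z + single j k))"
    proof (rule insert.IH[of "\<lambda>z. F (z + single j k)"])
      fix i z assume "i \<in> W"
      then show "(\<Sum>l\<le>M. \<alpha> l * F (z + single i l + single j k))
          \<le> (\<Sum>l\<le>M. \<beta> l * F (z + single i l + single j k))"
        using insert.prems[of i "z + single j k"] by (simp add: ac_simps)
    qed
  qed
  also have "\<dots> = (\<Sum>z\<in>expo_box W M. (\<Prod>i\<in>W. \<beta> (lookup z i)) * (\<Sum>k\<le>M. \<alpha> k * F (z + single j k)))"
    unfolding sum_distrib_left by (subst sum.swap) (simp only: mult.left_commute)
  also have "\<dots> \<le> (\<Sum>z\<in>expo_box W M. (\<Prod>i\<in>W. \<beta> (lookup z i)) * (\<Sum>k\<le>M. \<beta> k * F (z + single j k)))"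
  proof (rule sum_mono, rule mult_left_mono)
    fix z show "0 \<le> (\<Prod>i\<in>W. \<beta> (lookup z i))" by (intro prod_nonneg) (use assms(3) in auto)
  qed (use insert.prems in auto)
  also have "\<dots> = (\<Sum>y\<in>expo_box (insert j W) M. (\<Prod>i\<in>insert j W. \<beta> (lookup y i)) * F y)"
    unfolding split ..
  finally show ?case .
qed simp

text \<open>The variable \<open>e\<close> is the direction in which columns are counted, and \<open>V'\<close> holds the
  remaining ones.\<close>
locale pure_power_expo =
  fixes V' :: "nat set" and e :: nat and U :: "(nat \<Rightarrow>\<^sub>0 nat) set" and b :: nat
  assumes fin: "finite V'" and e: "e \<notin> V'" and U: "up_closed (insert e V') U"
    and b: "\<And>j. j \<in> insert e V' \<Longrightarrow> single j b \<in> U"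
begin

abbreviation V where "V \<equiv> insert e V'"

definition pow_expo :: "nat \<Rightarrow> (nat \<Rightarrow>\<^sub>0 nat) set" where "pow_expo n = expo_pow V U n"

text \<open>The exponents of the integral closure of the \<open>n\<close>-th power.\<close>
definition sat_expo :: "nat \<Rightarrow> (nat \<Rightarrow>\<^sub>0 nat) set" where "sat_expo n = expo_sat V (pow_expo n)"

definition heights :: "nat \<Rightarrow> (nat \<Rightarrow>\<^sub>0 nat) \<Rightarrow> real set" where
  "heights n y = {real t / real k | t k. k \<ge> 1 \<and> of_nat k * y + single e t \<in> pow_expo (k * n)}"

text \<open>The height at which \<open>n\<close> times the Newton polyhedron begins above \<open>y\<close>, as an infimum over the
  rational points that witness membership.\<close>
definition \<phi> :: "nat \<Rightarrow> (nat \<Rightarrow>\<^sub>0 nat) \<Rightarrow> real" where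
  "\<phi> n y = Inf (heights n y)"

lemma up_pow_expo: "up_closed V (pow_expo n)" unfolding pow_expo_def by (rule up_closed_expo_pow[OF U])

lemma up_sat_expo: "up_closed V (sat_expo n)" unfolding sat_expo_def by (rule up_closed_expo_sat[OF up_pow_expo])

lemma sat_expo_iff: "m \<in> sat_expo n \<longleftrightarrow> keys m \<subseteq> V \<and> (\<exists>k\<ge>1. of_nat k * m \<in> pow_expo (k * n))"
  unfolding sat_expo_def expo_sat_def pow_expo_def expo_pow_mult[OF U] by (simp add: mult.commute)

lemma pow_expo_sub_sat_expo: "pow_expo n \<subseteq> sat_expo n"
  using up_closed_sub[OF up_pow_expo] by (auto simp: sat_expo_iff intro!: exI[of _ 1])

lemma scale_single: "of_nat k * single (j::nat) t = single j (k * t :: nat)"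
  by (rule poly_mapping_eqI) (simp add: lookup_of_nat_mult lookup_single when_def)

lemma bn_in_pow_expo: "y \<in> expo V' \<Longrightarrow> y + single e (b * n) \<in> pow_expo n"
  using up_closedD[OF up_pow_expo[of n], of "single e (b * n)" y] expo_pow_pure_power[OF U b[of e], of n]
  unfolding pow_expo_def by (simp add: add.commute subset_insertI2)

lemma bn_height: "y \<in> expo V' \<Longrightarrow> real (b * n) \<in> heights n y"
  unfolding heights_def using bn_in_pow_expo[of y n] by (intro CollectI exI[of _ "b * n"] exI[of _ 1]) simp

lemma heights_nonneg: "h \<in> heights n y \<Longrightarrow> h \<ge> 0"
  by (auto simp: heights_def)

lemma bdd_heights: "bdd_below (heights n y)"
  using heights_nonneg by (intro bdd_belowI[of _ 0]) auto

lemma \<phi>_nonneg: "y \<in> expo V' \<Longrightarrow> 0 \<le> \<phi> n y"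
  unfolding \<phi>_def using bn_height[of y n] heights_nonneg by (intro cInf_greatest) auto

lemma \<phi>_le: "y \<in> expo V' \<Longrightarrow> \<phi> n y \<le> real (b * n)"
  unfolding \<phi>_def using bn_height by (intro cInf_lower bdd_heights) auto

lemma \<phi>_lower: "k \<ge> 1 \<Longrightarrow> of_nat k * y + single e t \<in> pow_expo (k * n) \<Longrightarrow> \<phi> n y \<le> real t / real k"
  unfolding \<phi>_def by (intro cInf_lower bdd_heights) (auto simp: heights_def)

lemma \<phi>_less:
  assumes "y \<in> expo V'" "\<phi> n y < x"
  shows "\<exists>t k. k \<ge> 1 \<and> of_nat k * y + single e t \<in> pow_expo (k * n) \<and> real t / real k < x"
proof -
  have "\<exists>h\<in>heights n y. h < x"
    using assms(2) bn_height[OF assms(1), of n] unfolding \<phi>_def by (intro cInf_lessD) auto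
  then show ?thesis by (auto simp: heights_def)
qed

text \<open>Witnesses with denominators \<open>k\<close> and \<open>k'\<close> are combined over the common denominator \<open>k k'\<close>.\<close>
lemma \<phi>_subadd:
  assumes y: "y \<in> expo V'" "y' \<in> expo V'"
  shows "\<phi> (n + n') (y + y') \<le> \<phi> n y + \<phi> n' y'"
proof (rule field_le_epsilon)
  fix \<epsilon> :: real assume eps: "\<epsilon> > 0"
  obtain t k where tk: "k \<ge> 1" "of_nat k * y + single e t \<in> pow_expo (k * n)" "real t / real k < \<phi> n y + \<epsilon>/2"
    using \<phi>_less[OF y(1), of n "\<phi> n y + \<epsilon>/2"] eps by auto
  obtain t' k' where tk': "k' \<ge> 1" "of_nat k' * y' + single e t' \<in> pow_expo (k' * n')" "real t' / real k' < \<phi> n' y' + \<epsilon>/2"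
    using \<phi>_less[OF y(2), of n' "\<phi> n' y' + \<epsilon>/2"] eps by auto
  have "of_nat k' * (of_nat k * y + single e t) + of_nat k * (of_nat k' * y' + single e t')
      \<in> pow_expo (k' * (k * n) + k * (k' * n'))"
    using tk(2) tk'(2) unfolding pow_expo_def by (intro expo_pow_add[OF U] expo_pow_scale[OF U])
  also have "of_nat k' * (of_nat k * y + single e t) + of_nat k * (of_nat k' * y' + single e t')
      = of_nat (k * k') * (y + y') + (single e (k' * t) + single e (k * t'))"
    by (rule poly_mapping_eqI)
      (simp add: lookup_add lookup_of_nat_mult lookup_single when_def distrib_left mult.assoc mult.left_commute del: of_nat_mult)
  also have "k' * (k * n) + k * (k' * n') = (k * k') * (n + n')" by (simp add: algebra_simps)
  finally have "of_nat (k * k') * (y + y') + single e (k' * t + k * t') \<in> pow_expo ((k * k') * (n + n'))"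
    by (simp add: single_add)
  then have "\<phi> (n + n') (y + y') \<le> real (k' * t + k * t') / real (k * k')"
    using tk(1) tk'(1) by (intro \<phi>_lower) auto
  also have "\<dots> = real t / real k + real t' / real k'" using tk(1) tk'(1) by (simp add: field_simps)
  finally show "\<phi> (n + n') (y + y') \<le> \<phi> n y + \<phi> n' y' + \<epsilon>" using tk(3) tk'(3) by simp
qed

lemma \<phi>_double:
  assumes y: "y \<in> expo V'"
  shows "\<phi> (2 * n) (y + y) = 2 * \<phi> n y"
proof (rule antisym)
  show "\<phi> (2 * n) (y + y) \<le> 2 * \<phi> n y" using \<phi>_subadd[OF y y, of n n] by (simp only: mult_2)
  show "2 * \<phi> n y \<le> \<phi> (2 * n) (y + y)"
  proof (rule ccontr)
    assume "\<not> ?thesis"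
    then have "\<phi> (2 * n) (y + y) < 2 * \<phi> n y" by simp
    moreover have "y + y \<in> expo V'" using y by (simp add: keys_add_nat)
    ultimately obtain t k where tk: "k \<ge> 1" "of_nat k * (y + y) + single e t \<in> pow_expo (k * (2 * n))"
      "real t / real k < 2 * \<phi> n y" using \<phi>_less by blast
    have "of_nat (2 * k) * y = of_nat k * (y + y)"
      by (rule poly_mapping_eqI) (simp add: lookup_add lookup_of_nat_mult distrib_left del: of_nat_mult)
    then have "of_nat (2 * k) * y + single e t \<in> pow_expo ((2 * k) * n)"
      using tk(2) by (simp only: mult.assoc mult.left_commute)
    then have "\<phi> n y \<le> real t / real (2 * k)" using tk(1) by (intro \<phi>_lower) auto
    then show False using tk(1,3) by (simp add: field_simps)
  qed
qed

text \<open>Subadditivity and homogeneity make \<open>\<phi> n\<close> midpoint convex.\<close>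
lemma \<phi>_midpoint:
  assumes z: "z \<in> expo V'" and j: "j \<in> V'"
  shows "2 * \<phi> n (z + single j (2*k+1)) \<le> \<phi> n (z + single j (2*k)) + \<phi> n (z + single j (2*k+2))"
proof -
  have in_expo: "z + single j l \<in> expo V'" for l using z j by (simp add: keys_add_nat)
  have eq: "(z + single j (2*k+1)) + (z + single j (2*k+1))
      = (z + single j (2*k)) + (z + single j (2*k+2))"
    by (rule poly_mapping_eqI) (simp add: lookup_add lookup_single when_def)
  have "2 * \<phi> n (z + single j (2*k+1)) = \<phi> (n + n) ((z + single j (2*k)) + (z + single j (2*k+2)))"
    using \<phi>_double[OF in_expo, of n "2*k+1"] unfolding eq mult_2[of n] by (rule sym)
  also have "\<dots> \<le> \<phi> n (z + single j (2*k)) + \<phi> n (z + single j (2*k+2))"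
    by (rule \<phi>_subadd[OF in_expo in_expo])
  finally show ?thesis .
qed

text \<open>The weights of the multidimensional trapezoidal rule on the orthant.\<close>
definition corner_weight :: "(nat \<Rightarrow>\<^sub>0 nat) \<Rightarrow> real" where
  "corner_weight y = (\<Prod>j\<in>V'. if lookup y j = 0 then 1/2 else 1)"

definition corner_sum :: "nat \<Rightarrow> real" where
  "corner_sum n = (\<Sum>y\<in>expo_box V' (b * n). corner_weight y * \<phi> n y)"

lemma box_expo: "y \<in> expo_box W M \<Longrightarrow> W \<subseteq> V' \<Longrightarrow> y \<in> expo V'"
  by (auto simp: expo_box_def)

text \<open>Refining the grid by a factor of two does not increase the trapezoidal sum of a convex function. The
  weight \<open>\<beta>\<close> keeps only the even points, which are the doubles of the points of the coarse grid.\<close>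
lemma corner_sum_double: "corner_sum (2 * n) \<le> 2 ^ (card V' + 1) * corner_sum n"
proof -
  let ?M = "b * n"
  let ?\<alpha> = "\<lambda>k::nat. if k = 0 then 1/2 else 1 :: real" and ?\<beta> = "\<lambda>k::nat. if odd k then 0 else if k = 0 then 1 else 2 :: real"
  \<comment> \<open>The cut-off makes the comparison along lines hold for every base point \<open>z\<close>.\<close>
  let ?F = "\<lambda>y. if y \<in> expo V' then \<phi> (2 * n) y else 0"
  have nonneg: "?F y \<ge> 0" for y using \<phi>_nonneg by auto
  have "corner_sum (2 * n) = (\<Sum>y\<in>expo_box V' (2 * ?M). (\<Prod>j\<in>V'. ?\<alpha> (lookup y j)) * ?F y)"
    unfolding corner_sum_def corner_weight_def
  proof (intro sum.cong)
    fix y assume "y \<in> expo_box V' (2 * ?M)"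
    then have "y \<in> expo V'" by (rule box_expo) simp
    then show "(\<Prod>j\<in>V'. ?\<alpha> (lookup y j)) * \<phi> (2 * n) y = (\<Prod>j\<in>V'. ?\<alpha> (lookup y j)) * ?F y"
      by simp
  qed (simp add: mult.left_commute)
  also have "\<dots> \<le> (\<Sum>y\<in>expo_box V' (2 * ?M). (\<Prod>j\<in>V'. ?\<beta> (lookup y j)) * ?F y)"
  proof (rule sum_box_weight_mono[OF fin])
    fix j z assume j: "j \<in> V'"
    have "2 * ?F (z + single j (2*k+1)) \<le> ?F (z + single j (2*k)) + ?F (z + single j (2*k+2))" for k
    proof (cases "z \<in> expo V'")
      case True
      then have "z + single j l \<in> expo V'" for l using j by (simp add: keys_add_nat)
      then show ?thesis using \<phi>_midpoint[OF True j, of "2 * n" k] by simp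
    next
      case False
      then have "z + single j l \<notin> expo V'" for l by (simp add: keys_add_nat)
      then show ?thesis by simp
    qed
    from trapezoid_line[of "\<lambda>k. ?F (z + single j k)" ?M, OF this]
    show "(\<Sum>k\<le>2 * ?M. ?\<alpha> k * ?F (z + single j k)) \<le> (\<Sum>k\<le>2 * ?M. ?\<beta> k * ?F (z + single j k))"
      using nonneg[of "z + single j (2 * ?M)"] by linarith
  qed auto
  also have "\<dots> = (\<Sum>y\<in>(\<lambda>y. y + y) ` expo_box V' ?M. (\<Prod>j\<in>V'. ?\<beta> (lookup y j)) * ?F y)"
  proof (rule sum.mono_neutral_right)
    show "finite (expo_box V' (2 * ?M))" by (rule finite_expo_box[OF fin])
    show "(\<lambda>y. y + y) ` expo_box V' ?M \<subseteq> expo_box V' (2 * ?M)"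
      by (auto simp: expo_box_def keys_add_nat lookup_add) (metis add_mono mult_2)
    show "\<forall>y\<in>expo_box V' (2 * ?M) - (\<lambda>y. y + y) ` expo_box V' ?M. (\<Prod>j\<in>V'. ?\<beta> (lookup y j)) * ?F y = 0"
    proof
      fix y assume y: "y \<in> expo_box V' (2 * ?M) - (\<lambda>y. y + y) ` expo_box V' ?M"
      have "\<exists>j\<in>V'. odd (lookup y j)"
      proof (rule ccontr)
        assume "\<not> ?thesis"
        then have ev: "even (lookup y j)" for j
        proof (cases "j \<in> V'")
          case False
          then have "j \<notin> keys y" using y by (auto simp: expo_box_def)
          then show ?thesis by (simp add: in_keys_iff)
        qed auto
        define h where "h = Poly_Mapping.map (\<lambda>x. x div 2) y"
        have lh: "lookup h j = lookup y j div 2" for j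
          by (simp add: h_def Poly_Mapping.map.rep_eq when_def)
        have "y = h + h"
        proof (rule poly_mapping_eqI)
          fix j show "lookup y j = lookup (h + h) j"
            using ev[of j] unfolding lookup_add lh by presburger
        qed
        moreover have "h \<in> expo_box V' ?M"
        proof -
          have "keys h \<subseteq> keys y" by (auto simp: in_keys_iff lh)
          moreover have "lookup h j \<le> ?M" for j
          proof -
            have "lookup y j \<le> 2 * ?M" using y by (simp add: expo_box_def)
            then show ?thesis unfolding lh by linarith
          qed
          ultimately show ?thesis using y by (auto simp: expo_box_def)
        qed
        ultimately show False using y by auto
      qed
      then obtain j where "j \<in> V'" "odd (lookup y j)" by auto
      then have "(\<Prod>j\<in>V'. ?\<beta> (lookup y j)) = 0" using fin by (intro prod_zero bexI[of _ j]) auto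
      then show "(\<Prod>j\<in>V'. ?\<beta> (lookup y j)) * ?F y = 0" by simp
    qed
  qed
  also have "\<dots> = (\<Sum>y\<in>expo_box V' ?M. (\<Prod>j\<in>V'. ?\<beta> (lookup (y + y) j)) * ?F (y + y))"
  proof (rule sum.reindex[unfolded o_def])
    show "inj_on (\<lambda>y. y + y) (expo_box V' ?M)"
    proof (rule inj_onI, rule poly_mapping_eqI)
      fix x y :: "nat \<Rightarrow>\<^sub>0 nat" and j assume "x + x = y + y"
      then have "lookup (x + x) j = lookup (y + y) j" by simp
      then show "lookup x j = lookup y j" by (simp add: lookup_add)
    qed
  qed
  also have "\<dots> = (\<Sum>y\<in>expo_box V' ?M. 2 ^ (card V' + 1) * (corner_weight y * \<phi> n y))"
  proof (intro sum.cong refl)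
    fix y assume "y \<in> expo_box V' ?M"
    then have yV: "y \<in> expo V'" by (rule box_expo) simp
    have "(\<Prod>j\<in>V'. ?\<beta> (lookup (y + y) j)) = (\<Prod>j\<in>V'. 2 * ?\<alpha> (lookup y j))"
      by (intro prod.cong refl) (simp add: lookup_add)
    also have "\<dots> = 2 ^ card V' * corner_weight y" by (simp add: prod.distrib corner_weight_def)
    finally have "(\<Prod>j\<in>V'. ?\<beta> (lookup (y + y) j)) = 2 ^ card V' * corner_weight y" .
    moreover have "?F (y + y) = 2 * \<phi> n y" using yV \<phi>_double[OF yV] by (simp add: keys_add_nat)
    ultimately show "(\<Prod>j\<in>V'. ?\<beta> (lookup (y + y) j)) * ?F (y + y) = 2 ^ (card V' + 1) * (corner_weight y * \<phi> n y)"
      by simp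
  qed
  also have "\<dots> = 2 ^ (card V' + 1) * corner_sum n" by (simp only: corner_sum_def sum_distrib_left)
  finally show ?thesis .
qed

subsection \<open>Counting along columns\<close>

definition column :: "nat \<Rightarrow> (nat \<Rightarrow>\<^sub>0 nat) \<Rightarrow> nat" where
  "column n y = card {s. y + single e s \<notin> sat_expo n}"

lemma column_bounds:
  assumes y: "y \<in> expo V'"
  shows "\<phi> n y \<le> real (column n y)" "real (column n y) \<le> \<phi> n y + 1"
    "{s. y + single e s \<notin> sat_expo n} \<subseteq> {..<b * n}"
proof -
  let ?P = "\<lambda>s. y + single e s \<in> sat_expo n"
  have up: "?P s'" if "?P s" "s \<le> s'" for s s'
  proof -
    have "y + single e s + single e (s' - s) \<in> sat_expo n"
      using up_closedD[OF up_sat_expo that(1)] by simp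
    then show ?thesis using that(2) by (simp add: add.assoc flip: single_add)
  qed
  have Pb: "?P (b * n)" using bn_in_pow_expo[OF y] pow_expo_sub_sat_expo by blast
  show "{s. y + single e s \<notin> sat_expo n} \<subseteq> {..<b * n}"
  proof
    fix s assume "s \<in> {s. y + single e s \<notin> sat_expo n}"
    then show "s \<in> {..<b * n}" using up[OF Pb, of s] by (meson lessThan_iff mem_Collect_eq not_le)
  qed
  define s0 where "s0 = (LEAST s. ?P s)"
  have P0: "?P s0" unfolding s0_def by (rule LeastI[of ?P, OF Pb])
  have "{s. y + single e s \<notin> sat_expo n} = {..<s0}"
  proof (intro equalityI subsetI)
    fix s assume "s \<in> {s. y + single e s \<notin> sat_expo n}"
    then show "s \<in> {..<s0}" using up[OF P0, of s] by (meson lessThan_iff mem_Collect_eq not_le)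
  next
    fix s assume "s \<in> {..<s0}"
    then have "s < (LEAST s. ?P s)" by (simp add: s0_def)
    then show "s \<in> {s. y + single e s \<notin> sat_expo n}" using not_less_Least[of s ?P] by simp
  qed
  then have c: "column n y = s0" by (simp add: column_def)
  obtain k where k: "k \<ge> 1" "of_nat k * (y + single e s0) \<in> pow_expo (k * n)"
    using P0 unfolding sat_expo_iff by auto
  then have "of_nat k * y + single e (k * s0) \<in> pow_expo (k * n)" by (simp add: distrib_left scale_single)
  from \<phi>_lower[OF k(1) this] have "\<phi> n y \<le> real s0" using k(1) by simp
  then show "\<phi> n y \<le> real (column n y)" by (simp add: c)
  show "real (column n y) \<le> \<phi> n y + 1"
  proof (rule ccontr)
    assume "\<not> ?thesis"
    then have lt: "\<phi> n y + 1 < real s0" by (simp add: c)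
    then have s0: "s0 \<ge> 1" using \<phi>_nonneg[OF y, of n] by (cases s0) auto
    then have "\<phi> n y < real (s0 - 1)" using lt by (simp add: of_nat_diff)
    from \<phi>_less[OF y this] obtain t k where tk: "k \<ge> 1" "of_nat k * y + single e t \<in> pow_expo (k * n)"
      "real t / real k < real (s0 - 1)" by auto
    have "real t < real (s0 - 1) * real k" using tk(1,3) by (simp only: pos_divide_less_eq of_nat_0_less_iff)
    then have "real t < real ((s0 - 1) * k)" by (simp only: of_nat_mult)
    then have tle: "t \<le> k * (s0 - 1)" by (simp only: of_nat_less_iff mult.commute)
    have "of_nat k * y + single e t + single e (k * (s0 - 1) - t) \<in> pow_expo (k * n)"
      using up_closedD[OF up_pow_expo tk(2)] by simp
    then have "of_nat k * (y + single e (s0 - 1)) \<in> pow_expo (k * n)"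
      using tle by (simp add: add.assoc distrib_left scale_single flip: single_add)
    moreover have "keys (y + single e (s0 - 1)) \<subseteq> V"
      using y by (auto simp: keys_add_nat)
    ultimately have "?P (s0 - 1)" using tk(1) unfolding sat_expo_iff by blast
    then have "s0 \<le> s0 - 1" unfolding s0_def by (rule Least_le)
    then show False using s0 by simp
  qed
qed

lemma complement_box:
  assumes "W \<subseteq> V'"
  shows "expo (insert e W) - sat_expo n \<subseteq> expo_box (insert e W) (b * n)"
proof
  fix m assume m: "m \<in> expo (insert e W) - sat_expo n"
  then have "m \<in> expo V - expo_pow V U n" using assms pow_expo_sub_sat_expo unfolding pow_expo_def by blast
  then have "m \<in> expo_box V (b * n)" using not_expo_pow_box[OF U b] by blast
  then show "m \<in> expo_box (insert e W) (b * n)" using m by (simp add: expo_box_def)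
qed

lemma finite_complement: "W \<subseteq> V' \<Longrightarrow> finite (expo (insert e W) - sat_expo n)"
  using finite_subset[OF complement_box finite_expo_box] finite_subset[OF _ fin] by simp

lemma card_complement:
  assumes W: "W \<subseteq> V'"
  shows "card (expo (insert e W) - sat_expo n) = (\<Sum>y\<in>expo_box W (b * n). column n y)"
proof -
  let ?X = "expo (insert e W) - sat_expo n" and ?M = "b * n"
  have fW: "finite W" and eW: "e \<notin> W" using W fin e finite_subset by auto
  have "card ?X = (\<Sum>y\<in>expo_box (insert e W) ?M. if y \<in> ?X then 1 else 0)"
  proof -
    have "(\<Sum>y\<in>B. if y \<in> X then 1 else 0) = card (B \<inter> X)" if "finite B" for B X :: "(nat \<Rightarrow>\<^sub>0 nat) set"
      using that by (simp add: sum.If_cases Int_def)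
    moreover have "expo_box (insert e W) ?M \<inter> ?X = ?X" using complement_box[OF W, of n] by blast
    moreover have "finite (expo_box (insert e W) ?M)" using finite_expo_box fW by simp
    ultimately show ?thesis by metis
  qed
  also have "\<dots> = (\<Sum>z\<in>expo_box W ?M. \<Sum>k\<le>?M. if z + single e k \<in> ?X then 1 else 0)"
    by (rule sum_expo_box_insert[OF eW fW])
  also have "\<dots> = (\<Sum>z\<in>expo_box W ?M. column n z)"
  proof (intro sum.cong refl)
    fix z assume z: "z \<in> expo_box W ?M"
    then have zV: "z \<in> expo V'" using W by (rule box_expo)
    have zX: "z + single e k \<in> expo (insert e W)" for k
      using z by (auto simp: expo_box_def keys_add_nat)
    have "(\<Sum>k\<le>?M. if z + single e k \<in> ?X then 1 else 0) = card ({..?M} \<inter> {s. z + single e s \<in> ?X})"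
      by (simp only: sum.If_cases finite_atMost card_eq_sum sum.neutral_const add_0_right)
    also have "{..?M} \<inter> {s. z + single e s \<in> ?X} = {s. z + single e s \<notin> sat_expo n}"
      using column_bounds(3)[OF zV, of n] zX by auto
    finally show "(\<Sum>k\<le>?M. if z + single e k \<in> ?X then 1 else 0) = column n z"
      by (simp add: column_def)
  qed
  finally show ?thesis .
qed

definition \<Phi> :: "nat set \<Rightarrow> nat \<Rightarrow> real" where
  "\<Phi> W n = (\<Sum>y\<in>expo_box W (b * n). \<phi> n y)"

lemma card_complement_bounds:
  assumes W: "W \<subseteq> V'"
  shows "\<Phi> W n \<le> real (card (expo (insert e W) - sat_expo n))"
    "real (card (expo (insert e W) - sat_expo n)) \<le> \<Phi> W n + real (b * n + 1) ^ card W"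
proof -
  have fW: "finite W" using W fin finite_subset by auto
  have c: "real (card (expo (insert e W) - sat_expo n)) = (\<Sum>y\<in>expo_box W (b * n). real (column n y))"
    using card_complement[OF W, of n] by simp
  show "\<Phi> W n \<le> real (card (expo (insert e W) - sat_expo n))"
    unfolding c \<Phi>_def by (intro sum_mono column_bounds box_expo[OF _ W])
  have "(\<Sum>y\<in>expo_box W (b * n). real (column n y)) \<le> (\<Sum>y\<in>expo_box W (b * n). \<phi> n y + 1)"
    by (intro sum_mono column_bounds box_expo[OF _ W])
  also have "\<dots> = \<Phi> W n + real (b * n + 1) ^ card W"
    unfolding sum.distrib \<Phi>_def using card_expo_box[OF fW, of "b * n"] by simp
  finally show "real (card (expo (insert e W) - sat_expo n)) \<le> \<Phi> W n + real (b * n + 1) ^ card W"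
    unfolding c .
qed

lemma \<Phi>_le:
  assumes W: "W \<subseteq> V'"
  shows "\<Phi> W n \<le> real (b * n + 1) ^ (card W + 1)"
proof -
  have fW: "finite W" using W fin finite_subset by auto
  have "\<Phi> W n \<le> (\<Sum>y\<in>expo_box W (b * n). real (b * n + 1))"
    unfolding \<Phi>_def by (intro sum_mono order.trans[OF \<phi>_le[OF box_expo[OF _ W]]]) auto
  also have "\<dots> = real (b * n + 1) ^ (card W + 1)" using card_expo_box[OF fW, of "b * n"] by simp
  finally show ?thesis .
qed

lemma \<Phi>_face:
  assumes "J \<subseteq> V'"
  shows "(\<Sum>y\<in>expo_box V' (b * n). (if \<forall>j\<in>J. lookup y j = 0 then 1 else 0) * \<phi> n y) = \<Phi> (V' - J) n"
proof -
  have "(\<Sum>y\<in>expo_box V' (b * n). (if \<forall>j\<in>J. lookup y j = 0 then 1 else 0) * \<phi> n y)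
      = (\<Sum>y\<in>expo_box (V' - J) (b * n). (if \<forall>j\<in>J. lookup y j = 0 then 1 else 0) * \<phi> n y)"
  proof (rule sum.mono_neutral_right)
    show "finite (expo_box V' (b * n))" by (rule finite_expo_box[OF fin])
    show "expo_box (V' - J) (b * n) \<subseteq> expo_box V' (b * n)" by (auto simp: expo_box_def)
    show "\<forall>y\<in>expo_box V' (b * n) - expo_box (V' - J) (b * n). (if \<forall>j\<in>J. lookup y j = 0 then 1 else 0) * \<phi> n y = 0"
      by (auto simp: expo_box_def in_keys_iff subset_iff)
  qed
  also have "\<dots> = \<Phi> (V' - J) n" unfolding \<Phi>_def
    by (intro sum.cong) (auto simp: expo_box_def in_keys_iff subset_iff)
  finally show ?thesis .
qed

lemma corner_weight_eq: "corner_weight y = (1/2) ^ card {j \<in> V'. lookup y j = 0}"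
proof -
  have "corner_weight y = (\<Prod>j\<in>{j \<in> V'. lookup y j = 0}. 1/2)"
    unfolding corner_weight_def using fin by (intro prod.mono_neutral_cong_right) auto
  then show ?thesis by simp
qed

lemma corner_weight_upper: "1 - corner_weight y \<le> (\<Sum>j\<in>V'. if \<forall>i\<in>{j}. lookup y i = 0 then 1 else 0)"
proof -
  let ?Z = "{j \<in> V'. lookup y j = 0}"
  have "(\<Sum>j\<in>V'. if \<forall>i\<in>{j}. lookup y i = 0 then 1 else (0::real)) = real (card ?Z)"
    using fin by (simp add: sum.If_cases Int_def)
  moreover have "1 - (1/2) ^ c \<le> real c" for c :: nat by (cases c) (auto simp: algebra_simps)
  ultimately show ?thesis unfolding corner_weight_eq by simp
qed

text \<open>With \<open>c\<close> zero coordinates this is \<open>c/2 - c(c-1)/2 \<le> 1 - 2\<^sup>-\<^sup>c\<close>; for \<open>c \<ge> 2\<close> the left-hand side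
  is not positive.\<close>
lemma corner_weight_lower:
  "(\<Sum>j\<in>V'. if \<forall>i\<in>{j}. lookup y i = 0 then 1 else 0) / 2
    - (\<Sum>(i,j)\<in>{(i,j). i \<in> V' \<and> j \<in> V' \<and> i \<noteq> j}. if \<forall>l\<in>{i,j}. lookup y l = 0 then 1 else 0) / 2
   \<le> 1 - corner_weight y"
proof -
  let ?Z = "{j \<in> V'. lookup y j = 0}"
  define c where "c = card ?Z"
  have finZ: "finite ?Z" using fin by simp
  have 1: "(\<Sum>j\<in>V'. if \<forall>i\<in>{j}. lookup y i = 0 then 1 else (0::real)) = real c"
    using fin by (simp add: sum.If_cases Int_def c_def)
  have finP: "finite {(i,j). i \<in> V' \<and> j \<in> V' \<and> i \<noteq> j}"
    by (rule finite_subset[of _ "V' \<times> V'"]) (use fin in auto)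
  have "(\<Sum>(i,j)\<in>{(i,j). i \<in> V' \<and> j \<in> V' \<and> i \<noteq> j}. if \<forall>l\<in>{i,j}. lookup y l = 0 then 1 else (0::real))
      = (\<Sum>p\<in>{(i,j). i \<in> V' \<and> j \<in> V' \<and> i \<noteq> j}. if p \<in> ?Z \<times> ?Z - Id_on ?Z then 1 else 0)"
    by (intro sum.cong) (auto simp: Id_on_def split: if_splits)
  also have "\<dots> = real (card ({(i,j). i \<in> V' \<and> j \<in> V' \<and> i \<noteq> j} \<inter> (?Z \<times> ?Z - Id_on ?Z)))"
    using finP by (simp add: sum.If_cases Int_def)
  also have "{(i,j). i \<in> V' \<and> j \<in> V' \<and> i \<noteq> j} \<inter> (?Z \<times> ?Z - Id_on ?Z) = ?Z \<times> ?Z - Id_on ?Z"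
    by (auto simp: Id_on_def)
  also have "card (?Z \<times> ?Z - Id_on ?Z) = c * c - c"
  proof -
    have "Id_on ?Z = (\<lambda>x. (x, x)) ` ?Z" by (auto simp: Id_on_def)
    then have "card (Id_on ?Z) = c" by (simp add: card_image inj_on_def c_def)
    moreover have "Id_on ?Z \<subseteq> ?Z \<times> ?Z" by (auto simp: Id_on_def)
    ultimately show ?thesis using finZ
      by (subst card_Diff_subset) (auto simp: c_def card_cartesian_product intro: finite_subset)
  qed
  finally have 2: "(\<Sum>(i,j)\<in>{(i,j). i \<in> V' \<and> j \<in> V' \<and> i \<noteq> j}. if \<forall>l\<in>{i,j}. lookup y l = 0 then 1 else (0::real)) = real (c * c - c)" .
  have "real c / 2 - real (c * c - c) / 2 \<le> 1 - (1/2) ^ c"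
  proof -
    consider "c = 0" | "c = 1" | "c \<ge> 2" by linarith
    then show ?thesis
    proof cases
      case 3
      then have "2 * c \<le> c * c" by simp
      then have "real c \<le> real (c * c - c)" by linarith
      moreover have "(1/2::real) ^ c \<le> 1" by (simp add: power_le_one)
      ultimately show ?thesis by linarith
    qed auto
  qed
  then show ?thesis unfolding 1 2 corner_weight_eq c_def .
qed

lemma weighted_split: "\<Phi> V' n = corner_sum n + (\<Sum>y\<in>expo_box V' (b * n). (1 - corner_weight y) * \<phi> n y)"
  unfolding \<Phi>_def corner_sum_def by (simp add: algebra_simps sum_subtractf)

theorem length_upper:
  "real (card (expo V - sat_expo n)) \<le> corner_sum n + real (card V' + 1) * real (b * n + 1) ^ card V'"
proof -
  have "(\<Sum>y\<in>expo_box V' (b * n). (1 - corner_weight y) * \<phi> n y)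
      \<le> (\<Sum>y\<in>expo_box V' (b * n). (\<Sum>j\<in>V'. if \<forall>i\<in>{j}. lookup y i = 0 then 1 else 0) * \<phi> n y)"
    by (intro sum_mono mult_right_mono corner_weight_upper \<phi>_nonneg box_expo) auto
  also have "\<dots> = (\<Sum>j\<in>V'. \<Phi> (V' - {j}) n)"
    unfolding sum_distrib_right by (subst sum.swap, intro sum.cong refl \<Phi>_face) auto
  also have "\<dots> \<le> (\<Sum>j\<in>V'. real (b * n + 1) ^ card V')"
  proof (intro sum_mono)
    fix j assume j: "j \<in> V'"
    then have "card (V' - {j}) + 1 = card V'" using fin card_Suc_Diff1[of V' j] by simp
    then show "\<Phi> (V' - {j}) n \<le> real (b * n + 1) ^ card V'" using \<Phi>_le[of "V' - {j}" n] by simp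
  qed
  also have "\<dots> = real (card V') * real (b * n + 1) ^ card V'" by simp
  finally show ?thesis using card_complement_bounds(2)[of V' n] unfolding weighted_split[of n]
    by (simp add: algebra_simps)
qed

text \<open>The weight missing in the trapezoidal sum is at least one half on every coordinate face, up to the points on
  two faces, and the sum of heights over a face differs from a length by at most the number of
  columns.\<close>
theorem length_lower:
  "corner_sum n + (\<Sum>j\<in>V'. real (card (expo (insert e (V' - {j})) - sat_expo n))) / 2 - real (card V') ^ 2 * real (b * n + 1) ^ (card V' - 1)
   \<le> real (card (expo V - sat_expo n))"
proof -
  let ?M = "real (b * n + 1)" and ?c = "card V'"
  let ?B = "expo_box V' (b * n)" and ?P = "{(i,j). i \<in> V' \<and> j \<in> V' \<and> i \<noteq> j}"
  let ?one = "\<lambda>J y. if \<forall>i\<in>J. lookup y i = 0 then 1 else 0 :: real"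
  have finP: "finite ?P" by (rule finite_subset[of _ "V' \<times> V'"]) (use fin in auto)
  have cardP: "card ?P + ?c = ?c ^ 2"
  proof -
    have "?P = V' \<times> V' - (\<lambda>x. (x, x)) ` V'" by auto
    moreover have "card ((\<lambda>x. (x, x)) ` V') = ?c" by (simp add: card_image inj_on_def)
    ultimately have "card ?P = ?c * ?c - ?c"
      using fin by (simp only:) (subst card_Diff_subset, auto simp: card_cartesian_product)
    then show ?thesis by (simp add: power2_eq_square)
  qed
  have pair: "\<Phi> (V' - {i,j}) n \<le> ?M ^ (?c - 1)" if "(i,j) \<in> ?P" for i j
  proof -
    have "card (V' - {i,j}) = ?c - 2" using that fin by (subst card_Diff_subset) auto
    moreover have "?c \<ge> 2" using that fin card_mono[of V' "{i,j}"] by auto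
    ultimately have "card (V' - {i,j}) + 1 = ?c - 1" by simp
    then show ?thesis using \<Phi>_le[of "V' - {i,j}" n] by simp
  qed
  have face: "real (card (expo (insert e (V' - {j})) - sat_expo n)) - ?M ^ (?c - 1) \<le> \<Phi> (V' - {j}) n" if "j \<in> V'" for j
    using card_complement_bounds(2)[of "V' - {j}" n] that fin by simp
  have "(\<Sum>y\<in>?B. ((\<Sum>j\<in>V'. ?one {j} y) / 2 - (\<Sum>(i,j)\<in>?P. ?one {i,j} y) / 2) * \<phi> n y)
      \<le> (\<Sum>y\<in>?B. (1 - corner_weight y) * \<phi> n y)"
    by (intro sum_mono mult_right_mono corner_weight_lower \<phi>_nonneg box_expo) auto
  moreover have "(\<Sum>y\<in>?B. ((\<Sum>j\<in>V'. ?one {j} y) / 2 - (\<Sum>(i,j)\<in>?P. ?one {i,j} y) / 2) * \<phi> n y)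
      = (\<Sum>j\<in>V'. \<Phi> (V' - {j}) n) / 2 - (\<Sum>(i,j)\<in>?P. \<Phi> (V' - {i,j}) n) / 2"
  proof -
    have "(\<Sum>y\<in>?B. (\<Sum>j\<in>V'. ?one {j} y) * \<phi> n y) = (\<Sum>j\<in>V'. \<Phi> (V' - {j}) n)"
      unfolding sum_distrib_right by (subst sum.swap, intro sum.cong refl \<Phi>_face) auto
    moreover have "(\<Sum>y\<in>?B. (\<Sum>p\<in>?P. ?one {fst p, snd p} y) * \<phi> n y) = (\<Sum>p\<in>?P. \<Phi> (V' - {fst p, snd p}) n)"
      unfolding sum_distrib_right by (subst sum.swap, intro sum.cong refl \<Phi>_face) auto
    ultimately show ?thesis
      by (simp add: left_diff_distrib sum_subtractf case_prod_unfold flip: sum_divide_distrib)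
  qed
  moreover have "(\<Sum>(i,j)\<in>?P. \<Phi> (V' - {i,j}) n) \<le> real (card ?P) * ?M ^ (?c - 1)"
    using pair sum_bounded_above[of ?P "\<lambda>(i,j). \<Phi> (V' - {i,j}) n" "?M ^ (?c - 1)"] by auto
  moreover have "(\<Sum>j\<in>V'. real (card (expo (insert e (V' - {j})) - sat_expo n))) - real ?c * ?M ^ (?c - 1) \<le> (\<Sum>j\<in>V'. \<Phi> (V' - {j}) n)"
    using sum_mono[OF face] by (simp add: sum_subtractf)
  moreover have "real ?c * ?M ^ (?c - 1) + real (card ?P) * ?M ^ (?c - 1) = real ?c ^ 2 * ?M ^ (?c - 1)"
  proof -
    have "real ?c + real (card ?P) = real ?c ^ 2" using arg_cong[OF cardP, of real] by simp
    then show ?thesis by (simp only: distrib_right[symmetric])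
  qed
  moreover have "real ?c ^ 2 * ?M ^ (?c - 1) \<ge> 0" by simp
  ultimately show ?thesis
    using card_complement_bounds(1)[OF subset_refl, of n] weighted_split[of n] by linarith
qed

subsection \<open>Comparison of powers with their integral closures\<close>

lemma expo_pow_multiplicities:
  "m \<in> pow_expo n \<Longrightarrow> \<exists>\<mu> u. m = (\<Sum>a\<in>small_gens b U. of_nat (\<mu> a) * a) + u \<and> (\<Sum>a\<in>small_gens b U. \<mu> a) = n \<and> u \<in> expo V"
proof (induction n arbitrary: m)
  case 0
  then show ?case by (intro exI[of _ "\<lambda>_. 0"] exI[of _ m]) (auto simp: pow_expo_def)
next
  case (Suc n)
  have finA: "finite (small_gens b U)" using finite_small_gens[OF U] fin by simp
  obtain x y where xy: "m = x + y" "x \<in> pow_expo n" "y \<in> U" using Suc.prems by (auto simp: pow_expo_def)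
  obtain \<mu> u where mu: "x = (\<Sum>a\<in>small_gens b U. of_nat (\<mu> a) * a) + u"
    "(\<Sum>a\<in>small_gens b U. \<mu> a) = n" "u \<in> expo V" using Suc.IH[OF xy(2)] by auto
  obtain a w where aw: "a \<in> small_gens b U" "w \<in> expo V" "y = a + w" using small_gens_generate[OF U b xy(3)] by blast
  let ?\<nu> = "\<lambda>c. \<mu> c + (if c = a then 1 else 0)"
  have "(\<Sum>c\<in>small_gens b U. of_nat (?\<nu> c) * c) = (\<Sum>c\<in>small_gens b U. of_nat (\<mu> c) * c + (if c = a then c else 0))"
    by (intro sum.cong) (auto simp: algebra_simps)
  also have "\<dots> = (\<Sum>c\<in>small_gens b U. of_nat (\<mu> c) * c) + a" using finA aw(1) by (simp add: sum.distrib)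
  finally have "m = (\<Sum>c\<in>small_gens b U. of_nat (?\<nu> c) * c) + (u + w)" using xy mu aw by (simp add: ac_simps)
  moreover have "(\<Sum>c\<in>small_gens b U. ?\<nu> c) = Suc n" using finA aw(1) mu(2) by (simp add: sum.distrib)
  moreover have "u + w \<in> expo V" using mu(3) aw(2) by (auto simp: keys_add_nat)
  ultimately show ?case by (intro exI[of _ ?\<nu>] exI[of _ "u + w"]) simp
qed

lemma combination_in_pow_expo:
  "finite S \<Longrightarrow> S \<subseteq> U \<Longrightarrow> (\<Sum>a\<in>S. of_nat (\<nu> a) * a) \<in> pow_expo (\<Sum>a\<in>S. \<nu> a)"
proof (induction S rule: finite_induct)
  case empty then show ?case by (simp add: pow_expo_def)
next
  case (insert x S)
  have "x \<in> expo_pow V U 1" using insert.prems expo_pow_one[OF U] by blast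
  then have "of_nat (\<nu> x) * x \<in> pow_expo (\<nu> x * 1)" unfolding pow_expo_def by (rule expo_pow_scale[OF U])
  then have "of_nat (\<nu> x) * x + (\<Sum>a\<in>S. of_nat (\<nu> a) * a) \<in> pow_expo (\<nu> x + (\<Sum>a\<in>S. \<nu> a))"
    using insert unfolding pow_expo_def by (intro expo_pow_add[OF U]) auto
  then show ?case using insert.hyps by simp
qed

text \<open>Write \<open>k m\<close> as a sum of \<open>k (n + c)\<close> generators with multiplicities \<open>\<mu> a\<close>, up to a nonnegative
  vector. Rounding \<open>\<mu> a / k\<close> down loses less than one for each of the \<open>c\<close> generators, so at least \<open>n\<close>
  generators remain, and their sum is still below \<open>m\<close>.\<close>
theorem sat_expo_shift_sub: "sat_expo (n + card (small_gens b U)) \<subseteq> pow_expo n"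
proof
  let ?A = "small_gens b U"
  let ?c = "card ?A"
  fix m assume "m \<in> sat_expo (n + ?c)"
  then obtain k where k: "k \<ge> 1" "of_nat k * m \<in> pow_expo (k * (n + ?c))" and mV: "keys m \<subseteq> V"
    unfolding sat_expo_iff by auto
  have finA: "finite ?A" using finite_small_gens[OF U] fin by simp
  obtain \<mu> u where mu: "of_nat k * m = (\<Sum>a\<in>?A. of_nat (\<mu> a) * a) + u" "(\<Sum>a\<in>?A. \<mu> a) = k * (n + ?c)"
    using expo_pow_multiplicities[OF k(2)] by auto
  let ?\<nu> = "\<lambda>a. \<mu> a div k"
  have "k * (n + ?c) \<le> (\<Sum>a\<in>?A. k * ?\<nu> a + (k - 1))"
    unfolding mu(2)[symmetric]
  proof (rule sum_mono)
    fix a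
    have "\<mu> a mod k \<le> k - 1" using k(1) mod_less_divisor[of k "\<mu> a"] by linarith
    then show "\<mu> a \<le> k * ?\<nu> a + (k - 1)" using mult_div_mod_eq[of k "\<mu> a"] by linarith
  qed
  also have "\<dots> = k * (\<Sum>a\<in>?A. ?\<nu> a) + ?c * (k - 1)" by (simp add: sum.distrib sum_distrib_left)
  also have "\<dots> \<le> k * (\<Sum>a\<in>?A. ?\<nu> a) + k * ?c" by (simp add: mult.commute)
  finally have "n \<le> (\<Sum>a\<in>?A. ?\<nu> a)" using k(1) by (simp add: distrib_left)
  moreover have comb: "(\<Sum>a\<in>?A. of_nat (?\<nu> a) * a) \<in> pow_expo (\<Sum>a\<in>?A. ?\<nu> a)"
    using finA by (rule combination_in_pow_expo) (auto simp: small_gens_def)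
  ultimately have inE: "(\<Sum>a\<in>?A. of_nat (?\<nu> a) * a) \<in> pow_expo n"
    using expo_pow_antimono[OF U] unfolding pow_expo_def by blast
  show "m \<in> pow_expo n"
  proof (rule up_closed_le[OF up_pow_expo inE mV])
    fix j
    have "k * lookup (\<Sum>a\<in>?A. of_nat (?\<nu> a) * a) j = (\<Sum>a\<in>?A. (k * ?\<nu> a) * lookup a j)"
      by (simp add: lookup_sum lookup_of_nat_mult sum_distrib_left mult.assoc)
    also have "\<dots> \<le> (\<Sum>a\<in>?A. \<mu> a * lookup a j)"
      by (intro sum_mono mult_right_mono) auto
    also have "\<dots> \<le> lookup (of_nat k * m) j"
      unfolding mu(1) by (simp add: lookup_sum lookup_add lookup_of_nat_mult)
    also have "\<dots> = k * lookup m j" by (rule lookup_of_nat_mult)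
    finally show "lookup (\<Sum>a\<in>?A. of_nat (?\<nu> a) * a) j \<le> lookup m j"
      using k(1) by simp
  qed
qed

end

section \<open>Comparison of the coefficients\<close>

lemma poly_over_power_tendsto:
  fixes P :: "real poly"
  assumes "Polynomial.degree P \<le> D"
  shows "((\<lambda>x. poly P x / x ^ D) \<longlongrightarrow> poly.coeff P D) at_top"
proof -
  have term0: "((\<lambda>x::real. x ^ i / x ^ D) \<longlongrightarrow> (if i = D then 1 else 0)) at_top" if "i \<le> D" for i
  proof (cases "i = D")
    case True
    have "\<forall>\<^sub>F x::real in at_top. x ^ i / x ^ D = 1"
      using eventually_gt_at_top[of 0] by eventually_elim (simp add: True)
    then show ?thesis using True by (simp add: tendsto_eventually)
  next
    case False
    then have lt: "D - i > 0" using that by simp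
    have "((\<lambda>x::real. inverse (x ^ (D - i))) \<longlongrightarrow> 0) at_top"
      by (intro filterlim_compose[OF tendsto_inverse_0_at_top filterlim_pow_at_top] lt filterlim_ident)
    moreover have "\<forall>\<^sub>F x::real in at_top. inverse (x ^ (D - i)) = x ^ i / x ^ D"
      using eventually_gt_at_top[of 0]
      by eventually_elim (use that in \<open>simp add: power_diff field_simps\<close>)
    ultimately have "((\<lambda>x::real. x ^ i / x ^ D) \<longlongrightarrow> 0) at_top" using tendsto_cong by force
    then show ?thesis using False by simp
  qed
  have "poly P x / x ^ D = (\<Sum>i\<le>D. poly.coeff P i * (x ^ i / x ^ D))" for x
  proof -
    have "poly P x = (\<Sum>i\<le>D. poly.coeff P i * x ^ i)" unfolding poly_altdef
      using assms by (intro sum.mono_neutral_left) (auto simp: coeff_eq_0)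
    then show ?thesis by (simp add: sum_divide_distrib)
  qed
  moreover have "((\<lambda>x. \<Sum>i\<le>D. poly.coeff P i * (x ^ i / x ^ D)) \<longlongrightarrow> (\<Sum>i\<le>D. poly.coeff P i * (if i = D then 1 else 0))) at_top"
    by (intro tendsto_sum tendsto_mult tendsto_const term0) auto
  moreover have "(\<Sum>i\<le>D. poly.coeff P i * (if i = D then 1 else 0)) = poly.coeff P D"
    by (simp add: if_distrib cong: if_cong)
  ultimately show ?thesis by (simp only:)
qed

lemma poly_over_power_LIMSEQ:
  fixes P :: "real poly"
  assumes "Polynomial.degree P \<le> D" "filterlim f at_top sequentially"
  shows "(\<lambda>n. poly P (real (f n)) / real (f n) ^ D) \<longlonglongrightarrow> poly.coeff P D"
  by (rule filterlim_compose[OF poly_over_power_tendsto[OF assms(1)]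
        filterlim_compose[OF filterlim_real_sequentially assms(2)]])

lemma degree_le_if_bounded:
  fixes Q :: "real poly"
  assumes "\<forall>\<^sub>F n in sequentially. \<bar>poly Q (real n)\<bar> \<le> C * real n ^ D"
  shows "Polynomial.degree Q \<le> D"
proof (rule ccontr)
  let ?g = "Polynomial.degree Q"
  assume "\<not> ?g \<le> D"
  then have g: "D < ?g" by simp
  have 1: "(\<lambda>n. \<bar>poly Q (real n) / real n ^ ?g\<bar>) \<longlonglongrightarrow> \<bar>poly.coeff Q ?g\<bar>"
    by (intro tendsto_rabs poly_over_power_LIMSEQ[of Q ?g "\<lambda>n. n"] filterlim_ident order_refl)
  have 2: "(\<lambda>n. poly (Polynomial.monom C D) (real n) / real n ^ ?g) \<longlonglongrightarrow> poly.coeff (Polynomial.monom C D) ?g"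
    using g degree_monom_le[of C D] by (intro poly_over_power_LIMSEQ[of _ ?g "\<lambda>n. n"] filterlim_ident) linarith
  have "\<forall>\<^sub>F n in sequentially. \<bar>poly Q (real n) / real n ^ ?g\<bar> \<le> poly (Polynomial.monom C D) (real n) / real n ^ ?g"
    using assms by eventually_elim (auto simp: poly_monom abs_divide intro!: divide_right_mono)
  then have "\<bar>poly.coeff Q ?g\<bar> \<le> poly.coeff (Polynomial.monom C D) ?g"
    by (intro tendsto_le[OF _ 2 1]) auto
  then have "poly.coeff Q ?g = 0" using g by simp
  then show False using g by (simp add: leading_coeff_0_iff)
qed

lemma coeff_pcompose_shift:
  fixes Q :: "real poly"
  assumes "Polynomial.degree Q \<le> t"
  shows "poly.coeff (Q \<circ>\<^sub>p [:a, 1:]) t = poly.coeff Q t"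
proof (cases "Polynomial.degree Q = t")
  case True
  have "Polynomial.degree (Q \<circ>\<^sub>p [:a, 1:]) = t" using True by (simp add: degree_pcompose)
  then show ?thesis using lead_coeff_comp[of "[:a, 1:]" Q] True by simp
next
  case False
  then show ?thesis using assms by (simp add: coeff_eq_0 degree_pcompose)
qed

context pure_power_expo
begin

text \<open>Along \<open>2\<^sup>k n\<close> the normalized trapezoidal sums decrease, while the normalized lengths tend to the leading
  coefficient and exceed the trapezoidal sums by lower order terms only.\<close>
lemma top_coeff_le_corner_sum:
  fixes P :: "real poly"
  assumes P: "\<forall>\<^sub>F n in sequentially. real (card (expo V - sat_expo n)) = poly P (real n)"
  shows "Polynomial.degree P \<le> card V' + 1"
    and "n \<ge> 1 \<Longrightarrow> poly.coeff P (card V' + 1) * real n ^ (card V' + 1) \<le> corner_sum n"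
proof -
  let ?D = "card V' + 1"
  have cardV: "card V = ?D" using fin e by simp
  have bn: "real (b * n + 1) \<le> real (b + 1) * real n" if "n \<ge> 1" for n using that by (simp add: algebra_simps)
  show deg: "Polynomial.degree P \<le> ?D"
  proof (rule degree_le_if_bounded)
    show "\<forall>\<^sub>F n in sequentially. \<bar>poly P (real n)\<bar> \<le> real (b + 1) ^ ?D * real n ^ ?D"
      using P eventually_ge_at_top[of 1]
    proof eventually_elim
      case (elim n)
      have "card (expo V - sat_expo n) \<le> card (expo_box V (b * n))"
        using complement_box[of V'] fin by (intro card_mono finite_expo_box) auto
      also have "\<dots> = (b * n + 1) ^ ?D" using card_expo_box[of V "b * n"] fin cardV by simp
      finally have "real (card (expo V - sat_expo n)) \<le> real (b * n + 1) ^ ?D"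
        by (metis of_nat_le_iff of_nat_power)
      also have "\<dots> \<le> (real (b + 1) * real n) ^ ?D" using bn[OF elim(2)] by (intro power_mono) auto
      finally show ?case unfolding elim(1)[symmetric] power_mult_distrib abs_of_nat .
    qed
  qed
  assume n: "n \<ge> 1"
  \<comment> \<open>the subsequence along which the trapezoidal sums are compared\<close>
  define f where "f k = 2 ^ k * n" for k :: nat
  have f1: "f k \<ge> 1" for k using n by (simp add: f_def)
  have flim: "filterlim f at_top sequentially"
  proof (rule filterlim_at_top_mono[OF filterlim_ident])
    have "k \<le> f k" for k
    proof -
      have "k \<le> 2 ^ k" using less_exp[of k] by simp
      also have "\<dots> \<le> 2 ^ k * n" using n by simp
      finally show ?thesis by (simp add: f_def)
    qed
    then show "\<forall>\<^sub>F k in sequentially. k \<le> f k" by simp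
  qed
  have Af: "corner_sum (f k) \<le> 2 ^ (?D * k) * corner_sum n" for k
  proof (induction k)
    case (Suc k)
    have "corner_sum (f (Suc k)) = corner_sum (2 * f k)" by (simp add: f_def mult.assoc)
    also have "\<dots> \<le> 2 ^ ?D * corner_sum (f k)" by (rule corner_sum_double)
    also have "\<dots> \<le> 2 ^ ?D * (2 ^ (?D * k) * corner_sum n)" using Suc by (intro mult_left_mono) auto
    also have "\<dots> = 2 ^ (?D * Suc k) * corner_sum n" by (simp add: power_add)
    finally show ?case .
  qed (simp add: f_def)
  let ?C = "real ?D * real (b + 1) ^ card V'"
  have lim1: "(\<lambda>k. poly P (real (f k)) / real (f k) ^ ?D) \<longlonglongrightarrow> poly.coeff P ?D"
    by (rule poly_over_power_LIMSEQ[OF deg flim])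
  have lim2: "(\<lambda>k. corner_sum n / real n ^ ?D + poly (Polynomial.monom ?C (card V')) (real (f k)) / real (f k) ^ ?D)
      \<longlonglongrightarrow> corner_sum n / real n ^ ?D + poly.coeff (Polynomial.monom ?C (card V')) ?D"
    using degree_monom_le[of ?C "card V'"] by (intro tendsto_add tendsto_const poly_over_power_LIMSEQ[OF _ flim]) linarith
  have "\<forall>\<^sub>F k in sequentially. real (card (expo V - sat_expo (f k))) = poly P (real (f k))"
    using P flim by (rule eventually_compose_filterlim)
  then have "\<forall>\<^sub>F k in sequentially. poly P (real (f k)) / real (f k) ^ ?D
      \<le> corner_sum n / real n ^ ?D + poly (Polynomial.monom ?C (card V')) (real (f k)) / real (f k) ^ ?D"
  proof eventually_elim
    case (elim k)
    have fp: "real (f k) ^ ?D > 0" using f1[of k] by simp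
    have "poly P (real (f k)) \<le> corner_sum (f k) + real ?D * real (b * f k + 1) ^ card V'"
      using length_upper[of "f k"] elim by simp
    also have "\<dots> \<le> 2 ^ (?D * k) * corner_sum n + real ?D * (real (b + 1) * real (f k)) ^ card V'"
      using Af[of k] bn[OF f1, of k] by (intro add_mono mult_left_mono power_mono) auto
    finally have le: "poly P (real (f k)) \<le> 2 ^ (?D * k) * corner_sum n + ?C * real (f k) ^ card V'"
      by (simp add: power_mult_distrib mult.assoc)
    have "2 ^ (?D * k) * corner_sum n / real (f k) ^ ?D = corner_sum n / real n ^ ?D"
    proof -
      have "real (f k) ^ ?D = 2 ^ (?D * k) * real n ^ ?D"
        unfolding f_def of_nat_mult power_mult_distrib of_nat_power by (simp only: of_nat_numeral power_mult[symmetric] mult.commute)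
      then show ?thesis by simp
    qed
    then show ?case using divide_right_mono[OF le, of "real (f k) ^ ?D"] fp
      by (simp only: add_divide_distrib poly_monom less_imp_le)
  qed
  then have "poly.coeff P ?D \<le> corner_sum n / real n ^ ?D + poly.coeff (Polynomial.monom ?C (card V')) ?D"
    by (intro tendsto_le[OF _ lim2 lim1]) auto
  then show "poly.coeff P ?D * real n ^ ?D \<le> corner_sum n" using n by (simp add: field_simps)
qed

text \<open>The polynomial \<open>R\<close> collects the difference of the two sides of the lower bound for the length. It is
  bounded below by a multiple of \<open>x\<^bsup>t-1\<^esup>\<close>, so its coefficient of degree \<open>t\<close> is nonnegative. The argument of
  \<open>Q j\<close> is shifted by \<open>c\<close>, because saturations are compared with powers of lower exponent.\<close>
theorem second_coeff_ge:
  fixes P :: "real poly" and Q :: "nat \<Rightarrow> real poly"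
  assumes ne: "V' \<noteq> {}"
    and P: "\<forall>\<^sub>F n in sequentially. real (card (expo V - sat_expo n)) = poly P (real n)"
    and Q: "\<And>j. j \<in> V' \<Longrightarrow> \<forall>\<^sub>F n in sequentially. real (card (expo (insert e (V' - {j})) - pow_expo n)) = poly (Q j) (real n)"
  shows "2 * poly.coeff P (card V') \<ge> (\<Sum>j\<in>V'. poly.coeff (Q j) (card V'))"
proof -
  let ?t = "card V'" and ?c = "card (small_gens b U)"
  have t: "?t \<ge> 1" using ne fin by (simp add: Suc_le_eq card_gt_0_iff)
  have bn: "real (b * n + 1) \<le> real (b + 1) * real n" if "n \<ge> 1" for n using that by (simp add: algebra_simps)
  have degQ: "Polynomial.degree (Q j) \<le> ?t" if j: "j \<in> V'" for j
  proof (rule degree_le_if_bounded)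
    show "\<forall>\<^sub>F n in sequentially. \<bar>poly (Q j) (real n)\<bar> \<le> real (b + 1) ^ ?t * real n ^ ?t"
      using Q[OF j] eventually_ge_at_top[of 1]
    proof eventually_elim
      case (elim n)
      let ?W = "insert e (V' - {j})"
      have "expo ?W - pow_expo n \<subseteq> expo_box ?W (b * n)"
      proof
        fix m assume m: "m \<in> expo ?W - pow_expo n"
        then have "m \<in> expo V - expo_pow V U n" unfolding pow_expo_def by blast
        then have "m \<in> expo_box V (b * n)" using not_expo_pow_box[OF U b] by blast
        then show "m \<in> expo_box ?W (b * n)" using m by (simp add: expo_box_def)
      qed
      then have "card (expo ?W - pow_expo n) \<le> card (expo_box ?W (b * n))"
        using fin by (intro card_mono finite_expo_box) auto
      also have "card ?W = ?t" using fin e j card_Suc_Diff1[of V' j] by simp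
      then have "card (expo_box ?W (b * n)) = (b * n + 1) ^ ?t"
        using card_expo_box[of ?W "b * n"] fin by simp
      finally have "real (card (expo ?W - pow_expo n)) \<le> real (b * n + 1) ^ ?t"
        by (metis of_nat_le_iff of_nat_power)
      also have "\<dots> \<le> (real (b + 1) * real n) ^ ?t" using bn[OF elim(2)] by (intro power_mono) auto
      finally show ?case unfolding elim(1)[symmetric] power_mult_distrib abs_of_nat .
    qed
  qed
  define S where "S = (\<Sum>j\<in>V'. Q j \<circ>\<^sub>p [:- real ?c, 1:])"
  define R where "R = P - Polynomial.monom (poly.coeff P (?t + 1)) (?t + 1) - Polynomial.smult (1/2) S"
  have degS: "Polynomial.degree S \<le> ?t" unfolding S_def
    using degQ by (intro degree_sum_le fin) (simp add: degree_pcompose)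
  have degR: "Polynomial.degree R \<le> ?t"
  proof (rule degree_le, intro allI impI)
    fix i assume i: "?t < i"
    then have "poly.coeff S i = 0" using degS by (intro coeff_eq_0) simp
    moreover have "poly.coeff P i = poly.coeff (Polynomial.monom (poly.coeff P (?t + 1)) (?t + 1)) i"
      using i top_coeff_le_corner_sum(1)[OF P] by (cases "i = ?t + 1") (auto intro: coeff_eq_0)
    ultimately show "poly.coeff R i = 0" by (simp add: R_def)
  qed
  have coeffR: "poly.coeff R ?t = poly.coeff P ?t - (\<Sum>j\<in>V'. poly.coeff (Q j) ?t) / 2"
    using degQ by (simp add: R_def S_def coeff_sum coeff_pcompose_shift)
  \<comment> \<open>bounds the error term of the lower bound for the length\<close>
  let ?K = "real ?t ^ 2 * real (b + 1) ^ (?t - 1)"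
  have "\<forall>\<^sub>F n in sequentially. \<forall>j\<in>V'. real (card (expo (insert e (V' - {j})) - pow_expo n)) = poly (Q j) (real n)"
    using Q fin by (intro eventually_ball_finite) auto
  then have Qc: "\<forall>\<^sub>F x in sequentially. \<forall>j\<in>V'. real (card (expo (insert e (V' - {j})) - pow_expo (x - ?c))) = poly (Q j) (real (x - ?c))"
    by (rule eventually_compose_filterlim) (rule filterlim_minus_const_nat_at_top)
  have "\<forall>\<^sub>F x in sequentially. poly (Polynomial.monom (- ?K) (?t - 1)) (real x) / real x ^ ?t \<le> poly R (real x) / real x ^ ?t"
    using P Qc eventually_ge_at_top[of "?c + 1"]
  proof eventually_elim
    case (elim x)
    have x1: "x \<ge> 1" and xc: "?c \<le> x" using elim(3) by auto
    have "poly S (real x) = (\<Sum>j\<in>V'. poly (Q j) (real (x - ?c)))"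
      using xc by (simp add: S_def poly_sum poly_pcompose of_nat_diff)
    also have "\<dots> = (\<Sum>j\<in>V'. real (card (expo (insert e (V' - {j})) - pow_expo (x - ?c))))"
      using elim(2) by simp
    also have "\<dots> \<le> (\<Sum>j\<in>V'. real (card (expo (insert e (V' - {j})) - sat_expo x)))"
    proof (intro sum_mono of_nat_mono card_mono)
      fix j
      show "finite (expo (insert e (V' - {j})) - sat_expo x)" by (rule finite_complement) auto
      have "sat_expo x \<subseteq> pow_expo (x - ?c)" using sat_expo_shift_sub[of "x - ?c"] xc by simp
      then show "expo (insert e (V' - {j})) - pow_expo (x - ?c) \<subseteq> expo (insert e (V' - {j})) - sat_expo x" by auto
    qed
    finally have S: "poly S (real x) \<le> (\<Sum>j\<in>V'. real (card (expo (insert e (V' - {j})) - sat_expo x)))" .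
    have "real ?t ^ 2 * real (b * x + 1) ^ (?t - 1) \<le> real ?t ^ 2 * (real (b + 1) * real x) ^ (?t - 1)"
      using bn[OF x1] by (intro mult_left_mono power_mono) auto
    also have "\<dots> = ?K * real x ^ (?t - 1)" by (simp add: power_mult_distrib mult.assoc)
    finally have K: "real ?t ^ 2 * real (b * x + 1) ^ (?t - 1) \<le> ?K * real x ^ (?t - 1)" .
    have "poly R (real x) = poly P (real x) - poly.coeff P (?t + 1) * real x ^ (?t + 1) - poly S (real x) / 2"
      unfolding R_def by (simp add: poly_monom)
    then have "poly R (real x) \<ge> - (?K * real x ^ (?t - 1))"
      using S K length_lower[of x] top_coeff_le_corner_sum(2)[OF P x1] elim(1) by linarith
    then show ?case by (intro divide_right_mono) (simp_all add: poly_monom)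
  qed
  moreover have "(\<lambda>x. poly (Polynomial.monom (- ?K) (?t - 1)) (real x) / real x ^ ?t) \<longlonglongrightarrow> poly.coeff (Polynomial.monom (- ?K) (?t - 1)) ?t"
    using degree_monom_le[of "- ?K" "?t - 1"] by (intro poly_over_power_LIMSEQ[of _ ?t "\<lambda>n. n"] filterlim_ident) linarith
  moreover have "(\<lambda>x. poly R (real x) / real x ^ ?t) \<longlonglongrightarrow> poly.coeff R ?t"
    by (intro poly_over_power_LIMSEQ[of _ ?t "\<lambda>n. n"] filterlim_ident degR)
  ultimately have "poly.coeff (Polynomial.monom (- ?K) (?t - 1)) ?t \<le> poly.coeff R ?t"
    by (intro tendsto_le[OF trivial_limit_sequentially])
  moreover have "?t - 1 \<noteq> ?t" using t by linarith
  ultimately have "0 \<le> poly.coeff R ?t" by (simp only: coeff_monom if_False)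
  then show ?thesis unfolding coeffR by simp
qed

end

section \<open>The inequality\<close>

lemma poly_map_of_rat: "poly (map_poly real_of_rat q) (of_nat n) = real_of_rat (poly q (of_nat n))"
proof (induction q)
  case (pCons a q)
  then show ?case by (simp add: map_poly_pCons of_rat_add of_rat_mult)
qed simp

theorem proposition3p16:
  fixes d :: nat
    and I :: "'k::field mpoly set"
    and p :: "rat poly"
  assumes "d \<ge> 2"
    and "monomial_ideal {1..d} I"
    and "krull_dim (mpoly_ring {1..d} Quot I) = 0"
    and "is_hilbert_poly (mpoly_ring {1..d})
           (\<lambda>n. integral_closure (mpoly_ring {1..d}) (ideal_pow (mpoly_ring {1..d}) I n)) p"
  shows "2 * poly.coeff p (d - 1) \<ge>
           (\<Sum>i = 1..d - 1.
              ideal_multiplicity (mpoly_ring ({1..d} - {i})) (d - 1) (set_var_zero i ` I) / fact (d - 1))"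
proof -
  have V: "{1..d} = insert d {1..d-1}" using assms(1) by auto
  obtain U where U: "up_closed {1..d} U" and I: "I = mspan U" using monomial_ideal_mspan[OF assms(2)] by blast
  have "\<exists>b. single j b \<in> U" if "j \<in> {1..d}" for j
    using krull_dim_zero_pure_powers[OF U that] assms(3) unfolding I by blast
  then obtain bj where bj: "\<And>j. j \<in> {1..d} \<Longrightarrow> single j (bj j) \<in> U" by metis
  \<comment> \<open>one exponent that works for all variables\<close>
  define b where "b = (\<Sum>j\<in>{1..d}. bj j)"
  have b: "single j b \<in> U" if "j \<in> {1..d}" for j
  proof (rule up_closed_le[OF U bj[OF that]])
    have "bj j \<le> b" unfolding b_def using that by (intro member_le_sum) auto
    then show "lookup (single j (bj j)) l \<le> lookup (single j b) l" for l
      by (auto simp: lookup_single when_def)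
  qed (use that in auto)
  interpret N: pure_power_expo "{1..d-1}" d U b
    by unfold_locales (use U b V assms(1) in auto)
  have upE: "up_closed {1..d} (N.pow_expo n)" and upG: "up_closed {1..d} (N.sat_expo n)" for n
    using N.up_pow_expo N.up_sat_expo unfolding V by auto
  have Eeq: "N.pow_expo n = expo_pow {1..d} U n" and Geq: "N.sat_expo n = expo_sat {1..d} (N.pow_expo n)" for n
    unfolding N.pow_expo_def N.sat_expo_def V by (rule refl)+
  have "integral_closure (mpoly_ring {1..d}) (ideal_pow (mpoly_ring {1..d}) I n) = mspan (N.sat_expo n)" for n
    unfolding I ideal_pow_mspan[OF U] Eeq[symmetric] integral_closure_mspan[OF upE] Geq ..
  moreover have "module_length (mpoly_ring {1..d}) (quotient_module (mpoly_ring {1..d}) (mspan (N.sat_expo n) :: 'k mpoly set))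
      = enat (card (expo {1..d} - N.sat_expo n))" for n
    by (rule length_mspan[OF upG]) (use N.finite_complement[of "{1..d-1}" n] V in simp)
  ultimately have "\<forall>\<^sub>F n in sequentially. \<exists>l::nat. enat (card (expo {1..d} - N.sat_expo n)) = enat l \<and> poly p (of_nat n) = of_nat l"
    using assms(4) unfolding is_hilbert_poly_def by simp
  then have P: "\<forall>\<^sub>F n in sequentially. real (card (expo (insert d {1..d-1}) - N.sat_expo n)) = poly (map_poly real_of_rat p) (real n)"
    unfolding V[symmetric] by eventually_elim (auto simp: poly_map_of_rat)
  let ?P = "\<lambda>j q. ideal_multiplicity (mpoly_ring ({1..d} - {j})) (d - 1) (set_var_zero j ` I) / fact (d - 1) = poly.coeff q (d - 1)
      \<and> (\<forall>\<^sub>F n in sequentially. real (card (expo (insert d ({1..d-1} - {j})) - N.pow_expo n)) = poly (map_poly real_of_rat q) (real n))"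
  have ex: "\<exists>q. ?P j q"
    if j: "j \<in> {1..d-1}" for j
  proof -
    let ?W = "{1..d} - {j}" and ?Uj = "{m \<in> U. lookup m j = 0}"
    have W: "?W = insert d ({1..d-1} - {j})" using V j by auto
    have Uj: "up_closed ?W ?Uj" by (rule up_closed_face[OF U])
    have bW: "single i b \<in> ?Uj" if "i \<in> ?W" for i
      using b[of i] that by (auto simp: lookup_single when_def)
    have fW: "finite ?W" by simp
    obtain q where q: "\<forall>\<^sub>F n in sequentially. of_nat (card (expo ?W - expo_pow ?W ?Uj n)) = poly q (of_nat n :: rat)"
      using hilbert_function_expo_pow[OF Uj bW fW] unfolding eventually_poly_def by blast
    have face: "expo ?W - expo_pow ?W ?Uj n = expo ?W - N.pow_expo n" for n
      unfolding expo_pow_face[OF U] Eeq by (auto simp: in_keys_iff subset_iff)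
    have pow: "ideal_pow (mpoly_ring ?W) (set_var_zero j ` I) n = mspan (expo_pow ?W ?Uj n)" for n
      unfolding I set_var_zero_mspan by (rule ideal_pow_mspan[OF Uj])
    have "module_length (mpoly_ring ?W) (quotient_module (mpoly_ring ?W) (mspan (expo_pow ?W ?Uj n) :: 'k mpoly set))
        = enat (card (expo ?W - expo_pow ?W ?Uj n))" for n
      by (rule length_mspan[OF up_closed_expo_pow[OF Uj] finite_not_expo_pow[OF Uj bW fW]])
    then have hp: "is_hilbert_poly (mpoly_ring ?W) (ideal_pow (mpoly_ring ?W) (set_var_zero j ` I)) q"
      unfolding is_hilbert_poly_def pow using q by (auto elim!: eventually_mono)
    have "(THE q. is_hilbert_poly (mpoly_ring ?W) (ideal_pow (mpoly_ring ?W) (set_var_zero j ` I)) q) = q"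
      using hp by (rule the_equality) (erule is_hilbert_poly_unique[OF _ hp])
    then have "ideal_multiplicity (mpoly_ring ?W) (d - 1) (set_var_zero j ` I) / fact (d - 1) = poly.coeff q (d - 1)"
      unfolding ideal_multiplicity_def by simp
    moreover have "\<forall>\<^sub>F n in sequentially. real (card (expo ?W - N.pow_expo n)) = poly (map_poly real_of_rat q) (real n)"
      using q unfolding face
    proof eventually_elim
      case (elim n)
      show ?case unfolding poly_map_of_rat elim[symmetric] by simp
    qed
    ultimately show ?thesis unfolding W by blast
  qed
  have "\<forall>j\<in>{1..d-1}. \<exists>q. ?P j q" by (rule ballI, rule ex)
  from bchoice[OF this] obtain q where Pq: "\<forall>j\<in>{1..d-1}. ?P j (q j)" ..
  note q = conjunct1[OF bspec[OF Pq]] and Q = conjunct2[OF bspec[OF Pq]]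
  have "(\<Sum>j\<in>{1..d-1}. poly.coeff (map_poly real_of_rat (q j)) (card {1..d-1})) \<le> 2 * poly.coeff (map_poly real_of_rat p) (card {1..d-1})"
    by (rule N.second_coeff_ge[OF _ P Q]) (use assms(1) in auto)
  then have "real_of_rat (\<Sum>j\<in>{1..d-1}. poly.coeff (q j) (d - 1)) \<le> real_of_rat (2 * poly.coeff p (d - 1))"
    by (simp add: coeff_map_poly of_rat_sum of_rat_mult)
  then have "(\<Sum>j\<in>{1..d-1}. poly.coeff (q j) (d - 1)) \<le> 2 * poly.coeff p (d - 1)"
    by (simp only: of_rat_less_eq)
  moreover have "(\<Sum>j\<in>{1..d-1}. poly.coeff (q j) (d - 1)) = (\<Sum>i = 1..d - 1.
      ideal_multiplicity (mpoly_ring ({1..d} - {i})) (d - 1) (set_var_zero i ` I) / fact (d - 1))"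
    by (intro sum.cong refl) (simp only: q)
  ultimately show ?thesis by simp
qed

end
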